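(* Let $\mathcal R$ be a set of linear DPO rules in $\mathcal C$. The assignment sending each direct $\mathcal R$-derivation (linear DPO step) $\rho:G\Rightarrow H$ to its track span $\operatorname{trk}(\rho)=(G\xleftarrow{d}D\xrightarrow{h}H)$ extends to a pseudofunctor $$\mathbf{Trk}:\mathbf{Rew}_{\mathcal R}\longrightarrow\mathbf{ParSpan}(\mathcal C).$$ For each specified parallel-independence diamond, the two composite track spans are canonically isomorphic.
   Context: Let $\mathcal H$ be the small category with a distinguished object $V$ and objects $E_{n,m}$ for $(n,m)\in\mathbb N^2$, freely generated by morphisms $s_i:E_{n,m}\to V$ ($1\le i\le n$) and $t_j:E_{n,m}\to V$ ($1\le j\le m$). Let $\mathcal C=[\mathcal H,\mathbf{Set}]/\Sigma$ for a fixed $\Sigma\in[\mathcal H,\mathbf{Set}]$ (a Grothendieck topos, hence adhesive). A linear DPO rule is a span of monomorphisms $L\xleftarrow{\ell}K\xrightarrow{r}R$. Given a monic match $m:L\hookrightarrow G$, a direct derivation $\rho:G\Rightarrow H$ consists of an object $D$ (the context) and morphisms $k:K\to D$, $d:D\to G$, $h:D\to H$, $n:R\to H$ such that the squares $m\ell=dk$ and $nr=hk$ are both pushouts; then $d,h$ are monic. Parallel-independence diamonds: two direct derivations $\rho_1:G\Rightarrow H_1$, $\rho_2:G\Rightarrow H_2$ with rules $p_1,p_2$, matches $m_1,m_2$ and contexts $(D_1,d_1,h_1),(D_2,d_2,h_2)$ are parallel independent if there are $i:L_1\to D_2$ and $j:L_2\to D_1$ with $d_2i=m_1$ and $d_1j=m_2$.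 The local Church–Rosser theorem for DPO rewriting then produces residual derivations $\rho_2':H_1\Rightarrow X$ (by $p_2$ at the match $h_1j$) and $\rho_1':H_2\Rightarrow X$ (by $p_1$ at the match $h_2i$) with a common result $X$; this square is a parallel-independence (local Church–Rosser) diamond. $\mathbf{Rew}_{\mathcal R}$ is the bicategory (objects: those of $\mathcal C$) freely generated by direct $\mathcal R$-derivations as 1-cells and by invertible 2-cells $\rho_2'\circ\rho_1\Rightarrow\rho_1'\circ\rho_2$, one for each of a specified collection of parallel-independence diamonds, subject to the usual horizontal and vertical coherence laws. $\mathbf{ParSpan}(\mathcal C)$ is the bicategory whose objects are those of $\mathcal C$, whose 1-cells $X\to Y$ are spans $X\xleftarrow{u}M\xrightarrow{v}Y$ with $u$ monic, and whose 2-cells are isomorphisms of spans (isomorphisms of apexes commuting with both legs). Composition is by chosen pullbacks, with the canonical associativity and unit isomorphisms. The composite track span of a path of derivations is the pullback composite of the track spans of its steps. *)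

theory Defs
  imports Main "HOL-Library.FuncSet" "HOL-Library.Equipollence"
begin

section \<open>Categories\<close>

record ('o, 'a) cat =
  Obj :: "'o set"
  Arr :: "'a set"
  Dom :: "'a \<Rightarrow> 'o"
  Cod :: "'a \<Rightarrow> 'o"
  Ide :: "'o \<Rightarrow> 'a"
  Cmp :: "'a \<Rightarrow> 'a \<Rightarrow> 'a"  (infixl "\<cdot>\<index>" 70)

text \<open>Composition is written in the order of functions: \<open>g \<cdot> f\<close> is \<open>f\<close> followed by \<open>g\<close>. It is only
  meaningful for composable pairs.\<close>

definition Hom :: "('o, 'a) cat \<Rightarrow> 'o \<Rightarrow> 'o \<Rightarrow> 'a set" where
  "Hom C X Y = {f \<in> Arr C. Dom C f = X \<and> Cod C f = Y}"

definition mono_arr :: "('o, 'a) cat \<Rightarrow> 'a \<Rightarrow> bool" where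
  "mono_arr C f \<longleftrightarrow> f \<in> Arr C \<and>
     (\<forall>W. \<forall>g \<in> Hom C W (Dom C f). \<forall>h \<in> Hom C W (Dom C f). f \<cdot>\<^bsub>C\<^esub> g = f \<cdot>\<^bsub>C\<^esub> h \<longrightarrow> g = h)"

definition iso_arr :: "('o, 'a) cat \<Rightarrow> 'a \<Rightarrow> bool" where
  "iso_arr C f \<longleftrightarrow> f \<in> Arr C \<and>
     (\<exists>g \<in> Hom C (Cod C f) (Dom C f). g \<cdot>\<^bsub>C\<^esub> f = Ide C (Dom C f) \<and> f \<cdot>\<^bsub>C\<^esub> g = Ide C (Cod C f))"

text \<open>\<open>is_pushout C f g p q\<close>: the span \<open>f, g\<close> has pushout cocone \<open>p, q\<close>, where \<open>p\<close> starts at the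
  codomain of \<open>f\<close> and \<open>q\<close> at the codomain of \<open>g\<close>.  Dually for \<open>is_pullback C f g p q\<close>.\<close>

definition is_pushout :: "('o, 'a) cat \<Rightarrow> 'a \<Rightarrow> 'a \<Rightarrow> 'a \<Rightarrow> 'a \<Rightarrow> bool" where
  "is_pushout C f g p q \<longleftrightarrow>
     f \<in> Arr C \<and> g \<in> Arr C \<and> p \<in> Arr C \<and> q \<in> Arr C \<and>
     Dom C f = Dom C g \<and> Dom C p = Cod C f \<and> Dom C q = Cod C g \<and> Cod C p = Cod C q \<and>
     p \<cdot>\<^bsub>C\<^esub> f = q \<cdot>\<^bsub>C\<^esub> g \<and>
     (\<forall>Z. \<forall>x \<in> Hom C (Cod C f) Z. \<forall>y \<in> Hom C (Cod C g) Z. x \<cdot>\<^bsub>C\<^esub> f = y \<cdot>\<^bsub>C\<^esub> g \<longrightarrow>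
        (\<exists>!w. w \<in> Hom C (Cod C p) Z \<and> w \<cdot>\<^bsub>C\<^esub> p = x \<and> w \<cdot>\<^bsub>C\<^esub> q = y))"

definition is_pullback :: "('o, 'a) cat \<Rightarrow> 'a \<Rightarrow> 'a \<Rightarrow> 'a \<Rightarrow> 'a \<Rightarrow> bool" where
  "is_pullback C f g p q \<longleftrightarrow>
     f \<in> Arr C \<and> g \<in> Arr C \<and> p \<in> Arr C \<and> q \<in> Arr C \<and>
     Cod C f = Cod C g \<and> Cod C p = Dom C f \<and> Cod C q = Dom C g \<and> Dom C p = Dom C q \<and>
     f \<cdot>\<^bsub>C\<^esub> p = g \<cdot>\<^bsub>C\<^esub> q \<and>
     (\<forall>Z. \<forall>x \<in> Hom C Z (Dom C f). \<forall>y \<in> Hom C Z (Dom C g). f \<cdot>\<^bsub>C\<^esub> x = g \<cdot>\<^bsub>C\<^esub> y \<longrightarrow>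
        (\<exists>!w. w \<in> Hom C Z (Dom C p) \<and> p \<cdot>\<^bsub>C\<^esub> w = x \<and> q \<cdot>\<^bsub>C\<^esub> w = y))"

definition chosen_pullbacks :: "('o, 'a) cat \<Rightarrow> ('a \<Rightarrow> 'a \<Rightarrow> 'a \<times> 'a) \<Rightarrow> bool" where
  "chosen_pullbacks C pb \<longleftrightarrow>
     (\<forall>f \<in> Arr C. \<forall>g \<in> Arr C. Cod C f = Cod C g \<longrightarrow>
        is_pullback C f g (fst (pb f g)) (snd (pb f g)))"


section \<open>Sets, functors, slices\<close>

text \<open>HOL has no type of all sets.  The category of sets is built on a family \<open>U\<close> of subsets of an
  arbitrary type (the small sets), closed under the operations on cardinalities below.  Any such \<open>U\<close> has
  binary products, coproducts, subsets and quotients.  Instances are all subsets of an infinite type,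
  and all subsets of cardinality less than that of the type, when the latter is a (strongly
  inaccessible) cardinal.\<close>

definition set_universe :: "'u set set \<Rightarrow> bool" where
  "set_universe U \<longleftrightarrow>
     (\<exists>A \<in> U. A \<noteq> {}) \<and>
     (\<forall>A \<in> U. \<forall>B. B \<lesssim> A \<longrightarrow> B \<in> U) \<and>
     (\<forall>A \<in> U. \<forall>B \<in> U. \<exists>C \<in> U. A <+> B \<lesssim> C) \<and>
     (\<forall>A \<in> U. \<forall>B \<in> U. \<exists>C \<in> U. A \<times> B \<lesssim> C)"

type_synonym 'u setmap = "'u set \<times> ('u \<Rightarrow> 'u) \<times> 'u set"

definition SetCat :: "'u set set \<Rightarrow> ('u set, 'u setmap) cat" where
  "SetCat U = \<lparr>
     Obj = U,
     Arr = {(A, f, B). A \<in> U \<and> B \<in> U \<and> f \<in> A \<rightarrow>\<^sub>E B},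
     Dom = (\<lambda>(A, f, B). A),
     Cod = (\<lambda>(A, f, B). B),
     Ide = (\<lambda>A. (A, \<lambda>x\<in>A. x, A)),
     Cmp = (\<lambda>(B', g, C) (A, f, B). (A, compose A g f, C)) \<rparr>"

type_synonym ('o, 'a, 'p, 'b) functr = "('o \<Rightarrow> 'p) \<times> ('a \<Rightarrow> 'b)"

text \<open>Functors and natural transformations are \<open>undefined\<close> outside the source category, so that
  equality of functors is equality in HOL.\<close>

definition is_functor :: "('o, 'a) cat \<Rightarrow> ('p, 'b) cat \<Rightarrow> ('o, 'a, 'p, 'b) functr \<Rightarrow> bool" where
  "is_functor A B F \<longleftrightarrow>
     fst F \<in> Obj A \<rightarrow>\<^sub>E Obj B \<and> snd F \<in> Arr A \<rightarrow>\<^sub>E Arr B \<and>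
     (\<forall>f \<in> Arr A. Dom B (snd F f) = fst F (Dom A f) \<and> Cod B (snd F f) = fst F (Cod A f)) \<and>
     (\<forall>X \<in> Obj A. snd F (Ide A X) = Ide B (fst F X)) \<and>
     (\<forall>f \<in> Arr A. \<forall>g \<in> Arr A. Dom A g = Cod A f \<longrightarrow> snd F (g \<cdot>\<^bsub>A\<^esub> f) = snd F g \<cdot>\<^bsub>B\<^esub> snd F f)"

type_synonym ('o, 'a, 'p, 'b) nattrans =
  "('o, 'a, 'p, 'b) functr \<times> ('o \<Rightarrow> 'b) \<times> ('o, 'a, 'p, 'b) functr"

definition is_nattrans :: "('o, 'a) cat \<Rightarrow> ('p, 'b) cat \<Rightarrow> ('o, 'a, 'p, 'b) nattrans \<Rightarrow> bool" where
  "is_nattrans A B = (\<lambda>(F, \<eta>, G).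
     is_functor A B F \<and> is_functor A B G \<and> \<eta> \<in> extensional (Obj A) \<and>
     (\<forall>X \<in> Obj A. \<eta> X \<in> Hom B (fst F X) (fst G X)) \<and>
     (\<forall>f \<in> Arr A. \<eta> (Cod A f) \<cdot>\<^bsub>B\<^esub> snd F f = snd G f \<cdot>\<^bsub>B\<^esub> \<eta> (Dom A f)))"

definition functor_cat ::
  "('o, 'a) cat \<Rightarrow> ('p, 'b) cat \<Rightarrow> (('o, 'a, 'p, 'b) functr, ('o, 'a, 'p, 'b) nattrans) cat" where
  "functor_cat A B = \<lparr>
     Obj = {F. is_functor A B F},
     Arr = {\<alpha>. is_nattrans A B \<alpha>},
     Dom = (\<lambda>(F, \<eta>, G). F),
     Cod = (\<lambda>(F, \<eta>, G). G),
     Ide = (\<lambda>F. (F, \<lambda>X\<in>Obj A. Ide B (fst F X), F)),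
     Cmp = (\<lambda>(G', \<theta>, H) (F, \<eta>, G). (F, \<lambda>X\<in>Obj A. \<theta> X \<cdot>\<^bsub>B\<^esub> \<eta> X, H)) \<rparr>"

definition slice_cat :: "('o, 'a) cat \<Rightarrow> 'o \<Rightarrow> ('a, 'a \<times> 'a \<times> 'a) cat" where
  "slice_cat C S = \<lparr>
     Obj = {a \<in> Arr C. Cod C a = S},
     Arr = {(a, f, b). a \<in> Arr C \<and> b \<in> Arr C \<and> Cod C a = S \<and> Cod C b = S \<and>
              f \<in> Hom C (Dom C a) (Dom C b) \<and> b \<cdot>\<^bsub>C\<^esub> f = a},
     Dom = (\<lambda>(a, f, b). a),
     Cod = (\<lambda>(a, f, b). b),
     Ide = (\<lambda>a. (a, Ide C (Dom C a), a)),
     Cmp = (\<lambda>(b', g, c) (a, f, b). (a, g \<cdot>\<^bsub>C\<^esub> f, c)) \<rparr>"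


section \<open>The index category and typed hypergraphs\<close>

record ('v, 'e) quiver =
  Verts :: "'v set"
  Edges :: "'e set"
  Src :: "'e \<Rightarrow> 'v"
  Tgt :: "'e \<Rightarrow> 'v"

fun is_path :: "('v, 'e) quiver \<Rightarrow> 'v \<Rightarrow> 'e list \<Rightarrow> 'v \<Rightarrow> bool" where
  "is_path Q x [] y \<longleftrightarrow> x = y \<and> x \<in> Verts Q"
| "is_path Q x (e # es) y \<longleftrightarrow> x \<in> Verts Q \<and> e \<in> Edges Q \<and> Src Q e = x \<and> is_path Q (Tgt Q e) es y"

definition free_cat :: "('v, 'e) quiver \<Rightarrow> ('v, 'v \<times> 'e list \<times> 'v) cat" where
  "free_cat Q = \<lparr>
     Obj = Verts Q,
     Arr = {(x, es, y). is_path Q x es y},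
     Dom = (\<lambda>(x, es, y). x),
     Cod = (\<lambda>(x, es, y). y),
     Ide = (\<lambda>x. (x, [], x)),
     Cmp = (\<lambda>(y', fs, z) (x, es, y). (x, es @ fs, z)) \<rparr>"

datatype hvert = HV | HE nat nat

text \<open>\<open>HS n m i\<close> is the generator \<open>s\<^sub>i\<close> and \<open>HT n m j\<close> the generator \<open>t\<^sub>j\<close> on \<open>HE n m\<close>.\<close>

datatype hedge = HS nat nat nat | HT nat nat nat

definition hyper_quiver :: "(hvert, hedge) quiver" where
  "hyper_quiver = \<lparr>
     Verts = UNIV,
     Edges = {HS n m i | n m i. 1 \<le> i \<and> i \<le> n} \<union> {HT n m j | n m j. 1 \<le> j \<and> j \<le> m},
     Src = (\<lambda>e. case e of HS n m i \<Rightarrow> HE n m | HT n m j \<Rightarrow> HE n m),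
     Tgt = (\<lambda>e. HV) \<rparr>"

type_synonym harr = "hvert \<times> hedge list \<times> hvert"

definition HypIndex :: "(hvert, harr) cat" where
  "HypIndex = free_cat hyper_quiver"

type_synonym 'u hyp = "(hvert, harr, 'u set, 'u setmap) functr"
type_synonym 'u hyp_map = "(hvert, harr, 'u set, 'u setmap) nattrans"
type_synonym 'u thyp_map = "'u hyp_map \<times> 'u hyp_map \<times> 'u hyp_map"

definition Hyp :: "'u set set \<Rightarrow> ('u hyp, 'u hyp_map) cat" where
  "Hyp U = functor_cat HypIndex (SetCat U)"

definition TypedHyp :: "'u set set \<Rightarrow> 'u hyp \<Rightarrow> ('u hyp_map, 'u thyp_map) cat" where
  "TypedHyp U S = slice_cat (Hyp U) S"


section \<open>Double-pushout rewriting\<close>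

record 'a rule =
  lft :: 'a
  rgt :: 'a

definition linear_rule :: "('o, 'a) cat \<Rightarrow> 'a rule \<Rightarrow> bool" where
  "linear_rule C p \<longleftrightarrow> mono_arr C (lft p) \<and> mono_arr C (rgt p) \<and> Dom C (lft p) = Dom C (rgt p)"

text \<open>The objects \<open>G\<close>, \<open>D\<close>, \<open>H\<close> are read off from the arrows.\<close>

record 'a deriv =
  rl :: "'a rule"
  mt :: 'a  \<comment> \<open>match \<open>m : L \<rightarrow> G\<close>\<close>
  kk :: 'a  \<comment> \<open>\<open>k : K \<rightarrow> D\<close>\<close>
  dd :: 'a  \<comment> \<open>\<open>d : D \<rightarrow> G\<close>\<close>
  hh :: 'a  \<comment> \<open>\<open>h : D \<rightarrow> H\<close>\<close>
  nn :: 'a  \<comment> \<open>comatch \<open>n : R \<rightarrow> H\<close>\<close>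

definition direct_derivation :: "('o, 'a) cat \<Rightarrow> 'a rule set \<Rightarrow> 'a deriv \<Rightarrow> bool" where
  "direct_derivation C \<R> \<rho> \<longleftrightarrow>
     rl \<rho> \<in> \<R> \<and> mono_arr C (mt \<rho>) \<and>
     is_pushout C (lft (rl \<rho>)) (kk \<rho>) (mt \<rho>) (dd \<rho>) \<and>
     is_pushout C (rgt (rl \<rho>)) (kk \<rho>) (nn \<rho>) (hh \<rho>)"

definition dsource :: "('o, 'a) cat \<Rightarrow> 'a deriv \<Rightarrow> 'o" where
  "dsource C \<rho> = Cod C (dd \<rho>)"

definition dtarget :: "('o, 'a) cat \<Rightarrow> 'a deriv \<Rightarrow> 'o" where
  "dtarget C \<rho> = Cod C (hh \<rho>)"

definition par_indep :: "('o, 'a) cat \<Rightarrow> 'a deriv \<Rightarrow> 'a deriv \<Rightarrow> 'a \<Rightarrow> 'a \<Rightarrow> bool" where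
  "par_indep C \<rho>1 \<rho>2 i j \<longleftrightarrow>
     dsource C \<rho>1 = dsource C \<rho>2 \<and>
     i \<in> Hom C (Dom C (mt \<rho>1)) (Dom C (dd \<rho>2)) \<and> dd \<rho>2 \<cdot>\<^bsub>C\<^esub> i = mt \<rho>1 \<and>
     j \<in> Hom C (Dom C (mt \<rho>2)) (Dom C (dd \<rho>1)) \<and> dd \<rho>1 \<cdot>\<^bsub>C\<^esub> j = mt \<rho>2"

record 'a diamond =
  step1 :: "'a deriv"  \<comment> \<open>\<open>\<rho>\<^sub>1 : G \<Rightarrow> H\<^sub>1\<close>\<close>
  step2 :: "'a deriv"  \<comment> \<open>\<open>\<rho>\<^sub>2 : G \<Rightarrow> H\<^sub>2\<close>\<close>
  res1 :: "'a deriv"   \<comment> \<open>\<open>\<rho>\<^sub>1' : H\<^sub>2 \<Rightarrow> X\<close>\<close>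
  res2 :: "'a deriv"   \<comment> \<open>\<open>\<rho>\<^sub>2' : H\<^sub>1 \<Rightarrow> X\<close>\<close>

text \<open>The output of the construction in the proof of the local Church--Rosser theorem.
  The core \<open>D\<^sub>0\<close> is the pullback of the two contexts, with projections \<open>e1\<close>, \<open>e2\<close>.  It receives both
  interfaces, by \<open>c1 : K\<^sub>1 \<rightarrow> D\<^sub>0\<close> and \<open>c2 : K\<^sub>2 \<rightarrow> D\<^sub>0\<close>.  Pushing \<open>D\<^sub>0\<close> out along \<open>K\<^sub>1 \<rightarrow> R\<^sub>1\<close> gives the
  context of \<open>\<rho>\<^sub>2'\<close> (by \<open>f2\<close>, \<open>g1\<close>), and along \<open>K\<^sub>2 \<rightarrow> R\<^sub>2\<close> the context of \<open>\<rho>\<^sub>1'\<close> (by \<open>f1\<close>, \<open>g2\<close>).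
  The common result \<open>X\<close> is the pushout of these two contexts over \<open>D\<^sub>0\<close>.

  Requiring only that the residuals are derivations with the stated rules and matches and equal
  target objects would not do: the two residuals could then differ by an automorphism of \<open>X\<close>.\<close>

definition lcr_diamond :: "('o, 'a) cat \<Rightarrow> 'a rule set \<Rightarrow> 'a diamond \<Rightarrow> bool" where
  "lcr_diamond C \<R> \<delta> \<longleftrightarrow>
    (let \<rho>1 = step1 \<delta>; \<rho>2 = step2 \<delta>; \<rho>1' = res1 \<delta>; \<rho>2' = res2 \<delta> in
      direct_derivation C \<R> \<rho>1 \<and> direct_derivation C \<R> \<rho>2 \<and>
      direct_derivation C \<R> \<rho>1' \<and> direct_derivation C \<R> \<rho>2' \<and>
      rl \<rho>1' = rl \<rho>1 \<and> rl \<rho>2' = rl \<rho>2 \<and>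
      dsource C \<rho>2' = dtarget C \<rho>1 \<and> dsource C \<rho>1' = dtarget C \<rho>2 \<and>
      dtarget C \<rho>1' = dtarget C \<rho>2' \<and>
      (\<exists>i j. par_indep C \<rho>1 \<rho>2 i j \<and>
        mt \<rho>2' = hh \<rho>1 \<cdot>\<^bsub>C\<^esub> j \<and> mt \<rho>1' = hh \<rho>2 \<cdot>\<^bsub>C\<^esub> i \<and>
        (\<exists>e1 e2 c1 c2 f1 f2 g1 g2.
          is_pullback C (dd \<rho>1) (dd \<rho>2) e1 e2 \<and>
          c1 \<in> Hom C (Dom C (kk \<rho>1)) (Dom C e1) \<and>
          e1 \<cdot>\<^bsub>C\<^esub> c1 = kk \<rho>1 \<and> e2 \<cdot>\<^bsub>C\<^esub> c1 = i \<cdot>\<^bsub>C\<^esub> lft (rl \<rho>1) \<and>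
          c2 \<in> Hom C (Dom C (kk \<rho>2)) (Dom C e1) \<and>
          e1 \<cdot>\<^bsub>C\<^esub> c2 = j \<cdot>\<^bsub>C\<^esub> lft (rl \<rho>2) \<and> e2 \<cdot>\<^bsub>C\<^esub> c2 = kk \<rho>2 \<and>
          is_pushout C (rgt (rl \<rho>1)) c1 g1 f2 \<and>
          is_pushout C (rgt (rl \<rho>2)) c2 g2 f1 \<and>
          Cod C f2 = Dom C (dd \<rho>2') \<and> Cod C f1 = Dom C (dd \<rho>1') \<and>
          kk \<rho>2' = f2 \<cdot>\<^bsub>C\<^esub> c2 \<and> kk \<rho>1' = f1 \<cdot>\<^bsub>C\<^esub> c1 \<and>
          dd \<rho>2' \<cdot>\<^bsub>C\<^esub> f2 = hh \<rho>1 \<cdot>\<^bsub>C\<^esub> e1 \<and> dd \<rho>2' \<cdot>\<^bsub>C\<^esub> g1 = nn \<rho>1 \<and>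
          dd \<rho>1' \<cdot>\<^bsub>C\<^esub> f1 = hh \<rho>2 \<cdot>\<^bsub>C\<^esub> e2 \<and> dd \<rho>1' \<cdot>\<^bsub>C\<^esub> g2 = nn \<rho>2 \<and>
          is_pushout C f1 f2 (hh \<rho>1') (hh \<rho>2') \<and>
          nn \<rho>1' = hh \<rho>2' \<cdot>\<^bsub>C\<^esub> g1 \<and> nn \<rho>2' = hh \<rho>1' \<cdot>\<^bsub>C\<^esub> g2)))"


section \<open>Bicategories and pseudofunctors\<close>

text \<open>\<open>g \<odot> f\<close> is the composite of the 1-cells \<open>f : a \<rightarrow> b\<close> and \<open>g : b \<rightarrow> c\<close>; \<open>\<beta> \<bullet> \<alpha>\<close> is the vertical
  composite (\<open>\<alpha>\<close> first) and \<open>\<beta> \<star> \<alpha>\<close> the horizontal composite.\<close>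

record ('o, 'm, 'c) bicat =
  Ob :: "'o set"
  Hom1 :: "'o \<Rightarrow> 'o \<Rightarrow> 'm set"
  Hom2 :: "'m \<Rightarrow> 'm \<Rightarrow> 'c set"
  id1 :: "'o \<Rightarrow> 'm"
  comp1 :: "'m \<Rightarrow> 'm \<Rightarrow> 'm"  (infixr "\<odot>\<index>" 75)
  id2 :: "'m \<Rightarrow> 'c"
  vcomp :: "'c \<Rightarrow> 'c \<Rightarrow> 'c"  (infixr "\<bullet>\<index>" 65)
  hcomp :: "'c \<Rightarrow> 'c \<Rightarrow> 'c"  (infixr "\<star>\<index>" 70)
  assoc :: "'m \<Rightarrow> 'm \<Rightarrow> 'm \<Rightarrow> 'c"
  lunit :: "'m \<Rightarrow> 'c"
  runit :: "'m \<Rightarrow> 'c"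

definition iso2 :: "('o, 'm, 'c) bicat \<Rightarrow> 'm \<Rightarrow> 'm \<Rightarrow> 'c \<Rightarrow> bool" where
  "iso2 B f g \<alpha> \<longleftrightarrow> \<alpha> \<in> Hom2 B f g \<and>
     (\<exists>\<beta> \<in> Hom2 B g f. \<beta> \<bullet>\<^bsub>B\<^esub> \<alpha> = id2 B f \<and> \<alpha> \<bullet>\<^bsub>B\<^esub> \<beta> = id2 B g)"

locale bicategory =
  fixes B :: "('o, 'm, 'c) bicat" (structure)
  assumes hom1_ob: "f \<in> Hom1 B a b \<Longrightarrow> a \<in> Ob B \<and> b \<in> Ob B"
    and hom1_unique: "f \<in> Hom1 B a b \<Longrightarrow> f \<in> Hom1 B a' b' \<Longrightarrow> a = a' \<and> b = b'"
    and hom2_parallel: "\<alpha> \<in> Hom2 B f g \<Longrightarrow> \<exists>a b. f \<in> Hom1 B a b \<and> g \<in> Hom1 B a b"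
    and id1_hom: "a \<in> Ob B \<Longrightarrow> id1 B a \<in> Hom1 B a a"
    and comp1_hom: "f \<in> Hom1 B a b \<Longrightarrow> g \<in> Hom1 B b c \<Longrightarrow> g \<odot> f \<in> Hom1 B a c"
    and id2_hom: "f \<in> Hom1 B a b \<Longrightarrow> id2 B f \<in> Hom2 B f f"
    and vcomp_hom: "\<alpha> \<in> Hom2 B f g \<Longrightarrow> \<beta> \<in> Hom2 B g h \<Longrightarrow> \<beta> \<bullet> \<alpha> \<in> Hom2 B f h"
    and vcomp_id_right: "\<alpha> \<in> Hom2 B f g \<Longrightarrow> \<alpha> \<bullet> id2 B f = \<alpha>"
    and vcomp_id_left: "\<alpha> \<in> Hom2 B f g \<Longrightarrow> id2 B g \<bullet> \<alpha> = \<alpha>"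
    and vcomp_assoc: "\<alpha> \<in> Hom2 B f g \<Longrightarrow> \<beta> \<in> Hom2 B g h \<Longrightarrow> \<gamma> \<in> Hom2 B h k \<Longrightarrow>
          (\<gamma> \<bullet> \<beta>) \<bullet> \<alpha> = \<gamma> \<bullet> (\<beta> \<bullet> \<alpha>)"
    and hcomp_hom: "f \<in> Hom1 B a b \<Longrightarrow> g \<in> Hom1 B b c \<Longrightarrow> \<alpha> \<in> Hom2 B f f' \<Longrightarrow> \<beta> \<in> Hom2 B g g' \<Longrightarrow>
          \<beta> \<star> \<alpha> \<in> Hom2 B (g \<odot> f) (g' \<odot> f')"
    and hcomp_id: "f \<in> Hom1 B a b \<Longrightarrow> g \<in> Hom1 B b c \<Longrightarrow> id2 B g \<star> id2 B f = id2 B (g \<odot> f)"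
    and interchange: "f \<in> Hom1 B a b \<Longrightarrow> g \<in> Hom1 B b c \<Longrightarrow>
          \<alpha> \<in> Hom2 B f f' \<Longrightarrow> \<alpha>' \<in> Hom2 B f' f'' \<Longrightarrow> \<beta> \<in> Hom2 B g g' \<Longrightarrow> \<beta>' \<in> Hom2 B g' g'' \<Longrightarrow>
          (\<beta>' \<bullet> \<beta>) \<star> (\<alpha>' \<bullet> \<alpha>) = (\<beta>' \<star> \<alpha>') \<bullet> (\<beta> \<star> \<alpha>)"
    and assoc_iso: "f \<in> Hom1 B a b \<Longrightarrow> g \<in> Hom1 B b c \<Longrightarrow> h \<in> Hom1 B c d \<Longrightarrow>
          iso2 B ((h \<odot> g) \<odot> f) (h \<odot> (g \<odot> f)) (assoc B h g f)"
    and assoc_natural: "f \<in> Hom1 B a b \<Longrightarrow> g \<in> Hom1 B b c \<Longrightarrow> h \<in> Hom1 B c d \<Longrightarrow>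
          \<alpha> \<in> Hom2 B f f' \<Longrightarrow> \<beta> \<in> Hom2 B g g' \<Longrightarrow> \<gamma> \<in> Hom2 B h h' \<Longrightarrow>
          assoc B h' g' f' \<bullet> ((\<gamma> \<star> \<beta>) \<star> \<alpha>) = (\<gamma> \<star> (\<beta> \<star> \<alpha>)) \<bullet> assoc B h g f"
    and lunit_iso: "f \<in> Hom1 B a b \<Longrightarrow> iso2 B (id1 B b \<odot> f) f (lunit B f)"
    and lunit_natural: "f \<in> Hom1 B a b \<Longrightarrow> \<alpha> \<in> Hom2 B f f' \<Longrightarrow>
          lunit B f' \<bullet> (id2 B (id1 B b) \<star> \<alpha>) = \<alpha> \<bullet> lunit B f"
    and runit_iso: "f \<in> Hom1 B a b \<Longrightarrow> iso2 B (f \<odot> id1 B a) f (runit B f)"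
    and runit_natural: "f \<in> Hom1 B a b \<Longrightarrow> \<alpha> \<in> Hom2 B f f' \<Longrightarrow>
          runit B f' \<bullet> (\<alpha> \<star> id2 B (id1 B a)) = \<alpha> \<bullet> runit B f"
    and pentagon: "f \<in> Hom1 B a b \<Longrightarrow> g \<in> Hom1 B b c \<Longrightarrow> h \<in> Hom1 B c d \<Longrightarrow> k \<in> Hom1 B d e \<Longrightarrow>
          assoc B k h (g \<odot> f) \<bullet> assoc B (k \<odot> h) g f =
          (id2 B k \<star> assoc B h g f) \<bullet> (assoc B k (h \<odot> g) f \<bullet> (assoc B k h g \<star> id2 B f))"
    and triangle: "f \<in> Hom1 B a b \<Longrightarrow> g \<in> Hom1 B b c \<Longrightarrow>
          (id2 B g \<star> lunit B f) \<bullet> assoc B g (id1 B b) f = runit B g \<star> id2 B f"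

text \<open>\<open>cmpr F g f : F g \<odot> F f \<Rightarrow> F (g \<odot> f)\<close> and \<open>unitr F a : id1 (F a) \<Rightarrow> F (id1 a)\<close> are the structure
  isomorphisms.\<close>

record ('o, 'm, 'c, 'p, 'n, 'd) psfun =
  map0 :: "'o \<Rightarrow> 'p"
  map1 :: "'m \<Rightarrow> 'n"
  map2 :: "'c \<Rightarrow> 'd"
  cmpr :: "'m \<Rightarrow> 'm \<Rightarrow> 'd"
  unitr :: "'o \<Rightarrow> 'd"

locale pseudofunctor = A: bicategory A + B: bicategory B
  for A :: "('o, 'm, 'c) bicat" and B :: "('p, 'n, 'd) bicat" +
  fixes F :: "('o, 'm, 'c, 'p, 'n, 'd) psfun"
  assumes map0_ob: "a \<in> Ob A \<Longrightarrow> map0 F a \<in> Ob B"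
    and map1_hom: "f \<in> Hom1 A a b \<Longrightarrow> map1 F f \<in> Hom1 B (map0 F a) (map0 F b)"
    and map2_hom: "\<alpha> \<in> Hom2 A f g \<Longrightarrow> map2 F \<alpha> \<in> Hom2 B (map1 F f) (map1 F g)"
    and map2_id: "f \<in> Hom1 A a b \<Longrightarrow> map2 F (id2 A f) = id2 B (map1 F f)"
    and map2_vcomp: "\<alpha> \<in> Hom2 A f g \<Longrightarrow> \<beta> \<in> Hom2 A g h \<Longrightarrow>
          map2 F (\<beta> \<bullet>\<^bsub>A\<^esub> \<alpha>) = map2 F \<beta> \<bullet>\<^bsub>B\<^esub> map2 F \<alpha>"
    and cmpr_iso: "f \<in> Hom1 A a b \<Longrightarrow> g \<in> Hom1 A b c \<Longrightarrow>
          iso2 B (map1 F g \<odot>\<^bsub>B\<^esub> map1 F f) (map1 F (g \<odot>\<^bsub>A\<^esub> f)) (cmpr F g f)"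
    and cmpr_natural: "f \<in> Hom1 A a b \<Longrightarrow> g \<in> Hom1 A b c \<Longrightarrow> \<alpha> \<in> Hom2 A f f' \<Longrightarrow> \<beta> \<in> Hom2 A g g' \<Longrightarrow>
          map2 F (\<beta> \<star>\<^bsub>A\<^esub> \<alpha>) \<bullet>\<^bsub>B\<^esub> cmpr F g f = cmpr F g' f' \<bullet>\<^bsub>B\<^esub> (map2 F \<beta> \<star>\<^bsub>B\<^esub> map2 F \<alpha>)"
    and unitr_iso: "a \<in> Ob A \<Longrightarrow> iso2 B (id1 B (map0 F a)) (map1 F (id1 A a)) (unitr F a)"
    and assoc_coherence: "f \<in> Hom1 A a b \<Longrightarrow> g \<in> Hom1 A b c \<Longrightarrow> h \<in> Hom1 A c d \<Longrightarrow>
          map2 F (assoc A h g f) \<bullet>\<^bsub>B\<^esub> (cmpr F (h \<odot>\<^bsub>A\<^esub> g) f \<bullet>\<^bsub>B\<^esub> (cmpr F h g \<star>\<^bsub>B\<^esub> id2 B (map1 F f))) =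
          cmpr F h (g \<odot>\<^bsub>A\<^esub> f) \<bullet>\<^bsub>B\<^esub> ((id2 B (map1 F h) \<star>\<^bsub>B\<^esub> cmpr F g f) \<bullet>\<^bsub>B\<^esub>
            assoc B (map1 F h) (map1 F g) (map1 F f))"
    and lunit_coherence: "f \<in> Hom1 A a b \<Longrightarrow>
          map2 F (lunit A f) \<bullet>\<^bsub>B\<^esub> (cmpr F (id1 A b) f \<bullet>\<^bsub>B\<^esub> (unitr F b \<star>\<^bsub>B\<^esub> id2 B (map1 F f))) =
          lunit B (map1 F f)"
    and runit_coherence: "f \<in> Hom1 A a b \<Longrightarrow>
          map2 F (runit A f) \<bullet>\<^bsub>B\<^esub> (cmpr F f (id1 A a) \<bullet>\<^bsub>B\<^esub> (id2 B (map1 F f) \<star>\<^bsub>B\<^esub> unitr F a)) =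
          runit B (map1 F f)"


section \<open>The free bicategory on a computad with invertible 2-cell generators\<close>

datatype ('o, 'g) tm1 =
    One 'o
  | Gen 'g
  | Comp "('o, 'g) tm1" "('o, 'g) tm1"

record ('o, 'g, 'e) computad =
  Gen0 :: "'o set"
  Gen1 :: "'g set"
  src1 :: "'g \<Rightarrow> 'o"
  trg1 :: "'g \<Rightarrow> 'o"
  Gen2 :: "'e set"
  src2 :: "'e \<Rightarrow> ('o, 'g) tm1"
  trg2 :: "'e \<Rightarrow> ('o, 'g) tm1"

inductive has_type1 :: "('o, 'g, 'e) computad \<Rightarrow> ('o, 'g) tm1 \<Rightarrow> 'o \<Rightarrow> 'o \<Rightarrow> bool" for X where
  "a \<in> Gen0 X \<Longrightarrow> has_type1 X (One a) a a"
| "x \<in> Gen1 X \<Longrightarrow> src1 X x \<in> Gen0 X \<Longrightarrow> trg1 X x \<in> Gen0 X \<Longrightarrow>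
     has_type1 X (Gen x) (src1 X x) (trg1 X x)"
| "has_type1 X f a b \<Longrightarrow> has_type1 X g b c \<Longrightarrow> has_type1 X (Comp g f) a c"

datatype ('o, 'g, 'e) atom2 =
    G2 'e
  | As "('o, 'g) tm1" "('o, 'g) tm1" "('o, 'g) tm1"
  | Lu "('o, 'g) tm1"
  | Ru "('o, 'g) tm1"

datatype ('o, 'g, 'e) tm2 =
    Pos "('o, 'g, 'e) atom2"
  | Inv "('o, 'g, 'e) atom2"
  | Idn "('o, 'g) tm1"
  | VC "('o, 'g, 'e) tm2" "('o, 'g, 'e) tm2"
  | HC "('o, 'g, 'e) tm2" "('o, 'g, 'e) tm2"

inductive atom_type :: "('o, 'g, 'e) computad \<Rightarrow> ('o, 'g, 'e) atom2 \<Rightarrow> ('o, 'g) tm1 \<Rightarrow> ('o, 'g) tm1 \<Rightarrow> bool"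
  for X where
  "e \<in> Gen2 X \<Longrightarrow> has_type1 X (src2 X e) a b \<Longrightarrow> has_type1 X (trg2 X e) a b \<Longrightarrow>
     atom_type X (G2 e) (src2 X e) (trg2 X e)"
| "has_type1 X f a b \<Longrightarrow> has_type1 X g b c \<Longrightarrow> has_type1 X h c d \<Longrightarrow>
     atom_type X (As h g f) (Comp (Comp h g) f) (Comp h (Comp g f))"
| "has_type1 X f a b \<Longrightarrow> atom_type X (Lu f) (Comp (One b) f) f"
| "has_type1 X f a b \<Longrightarrow> atom_type X (Ru f) (Comp f (One a)) f"

inductive has_type2 :: "('o, 'g, 'e) computad \<Rightarrow> ('o, 'g, 'e) tm2 \<Rightarrow> ('o, 'g) tm1 \<Rightarrow> ('o, 'g) tm1 \<Rightarrow> bool"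
  for X where
  "atom_type X x f g \<Longrightarrow> has_type2 X (Pos x) f g"
| "atom_type X x f g \<Longrightarrow> has_type2 X (Inv x) g f"
| "has_type1 X f a b \<Longrightarrow> has_type2 X (Idn f) f f"
| "has_type2 X s f g \<Longrightarrow> has_type2 X t g h \<Longrightarrow> has_type2 X (VC t s) f h"
| "has_type1 X f a b \<Longrightarrow> has_type1 X g b c \<Longrightarrow> has_type2 X s f f' \<Longrightarrow> has_type2 X t g g' \<Longrightarrow>
     has_type2 X (HC t s) (Comp g f) (Comp g' f')"

text \<open>The congruence generated by the bicategory laws and invertibility of all generating 2-cells.\<close>

inductive eq2 :: "('o, 'g, 'e) computad \<Rightarrow> ('o, 'g, 'e) tm2 \<Rightarrow> ('o, 'g, 'e) tm2 \<Rightarrow> bool"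
  for X where
  eq2_refl: "has_type2 X t f g \<Longrightarrow> eq2 X t t"
| eq2_sym: "eq2 X s t \<Longrightarrow> eq2 X t s"
| eq2_trans: "eq2 X s t \<Longrightarrow> eq2 X t u \<Longrightarrow> eq2 X s u"
| eq2_VC: "eq2 X s s' \<Longrightarrow> eq2 X t t' \<Longrightarrow> has_type2 X (VC t s) f g \<Longrightarrow> eq2 X (VC t s) (VC t' s')"
| eq2_HC: "eq2 X s s' \<Longrightarrow> eq2 X t t' \<Longrightarrow> has_type2 X (HC t s) f g \<Longrightarrow> eq2 X (HC t s) (HC t' s')"
| eq2_inv_left: "atom_type X x f g \<Longrightarrow> eq2 X (VC (Inv x) (Pos x)) (Idn f)"
| eq2_inv_right: "atom_type X x f g \<Longrightarrow> eq2 X (VC (Pos x) (Inv x)) (Idn g)"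
| eq2_id_right: "has_type2 X t f g \<Longrightarrow> eq2 X (VC t (Idn f)) t"
| eq2_id_left: "has_type2 X t f g \<Longrightarrow> eq2 X (VC (Idn g) t) t"
| eq2_vassoc: "has_type2 X s f g \<Longrightarrow> has_type2 X t g h \<Longrightarrow> has_type2 X u h k \<Longrightarrow>
    eq2 X (VC (VC u t) s) (VC u (VC t s))"
| eq2_hid: "has_type1 X f a b \<Longrightarrow> has_type1 X g b c \<Longrightarrow>
    eq2 X (HC (Idn g) (Idn f)) (Idn (Comp g f))"
| eq2_interchange: "has_type1 X f a b \<Longrightarrow> has_type1 X g b c \<Longrightarrow>
    has_type2 X s f f' \<Longrightarrow> has_type2 X s' f' f'' \<Longrightarrow> has_type2 X t g g' \<Longrightarrow> has_type2 X t' g' g'' \<Longrightarrow>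
    eq2 X (HC (VC t' t) (VC s' s)) (VC (HC t' s') (HC t s))"
| eq2_assoc_natural: "has_type1 X f a b \<Longrightarrow> has_type1 X g b c \<Longrightarrow> has_type1 X h c d \<Longrightarrow>
    has_type2 X s f f' \<Longrightarrow> has_type2 X t g g' \<Longrightarrow> has_type2 X u h h' \<Longrightarrow>
    eq2 X (VC (Pos (As h' g' f')) (HC (HC u t) s)) (VC (HC u (HC t s)) (Pos (As h g f)))"
| eq2_lunit_natural: "has_type1 X f a b \<Longrightarrow> has_type2 X s f f' \<Longrightarrow>
    eq2 X (VC (Pos (Lu f')) (HC (Idn (One b)) s)) (VC s (Pos (Lu f)))"
| eq2_runit_natural: "has_type1 X f a b \<Longrightarrow> has_type2 X s f f' \<Longrightarrow>
    eq2 X (VC (Pos (Ru f')) (HC s (Idn (One a)))) (VC s (Pos (Ru f)))"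
| eq2_pentagon: "has_type1 X f a b \<Longrightarrow> has_type1 X g b c \<Longrightarrow> has_type1 X h c d \<Longrightarrow> has_type1 X k d e \<Longrightarrow>
    eq2 X (VC (Pos (As k h (Comp g f))) (Pos (As (Comp k h) g f)))
      (VC (HC (Idn k) (Pos (As h g f)))
        (VC (Pos (As k (Comp h g) f)) (HC (Pos (As k h g)) (Idn f))))"
| eq2_triangle: "has_type1 X f a b \<Longrightarrow> has_type1 X g b c \<Longrightarrow>
    eq2 X (VC (HC (Idn g) (Pos (Lu f))) (Pos (As g (One b) f))) (HC (Pos (Ru g)) (Idn f))"

definition cls2 :: "('o, 'g, 'e) computad \<Rightarrow> ('o, 'g, 'e) tm2 \<Rightarrow> ('o, 'g, 'e) tm2 set" where
  "cls2 X t = {u. eq2 X t u}"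

definition free_bicat :: "('o, 'g, 'e) computad \<Rightarrow> ('o, ('o, 'g) tm1, ('o, 'g, 'e) tm2 set) bicat" where
  "free_bicat X = \<lparr>
     Ob = Gen0 X,
     Hom1 = (\<lambda>a b. {f. has_type1 X f a b}),
     Hom2 = (\<lambda>f g. {cls2 X t | t. has_type2 X t f g}),
     id1 = One,
     comp1 = Comp,
     id2 = (\<lambda>f. cls2 X (Idn f)),
     vcomp = (\<lambda>\<beta> \<alpha>. {u. \<exists>t \<in> \<beta>. \<exists>s \<in> \<alpha>. eq2 X (VC t s) u}),
     hcomp = (\<lambda>\<beta> \<alpha>. {u. \<exists>t \<in> \<beta>. \<exists>s \<in> \<alpha>. eq2 X (HC t s) u}),
     assoc = (\<lambda>h g f. cls2 X (Pos (As h g f))),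
     lunit = (\<lambda>f. cls2 X (Pos (Lu f))),
     runit = (\<lambda>f. cls2 X (Pos (Ru f))) \<rparr>"

definition Rew :: "('o, 'a) cat \<Rightarrow> 'a rule set \<Rightarrow> 'a diamond set \<Rightarrow>
    ('o, ('o, 'a deriv) tm1, ('o, 'a deriv, 'a diamond) tm2 set) bicat" where
  "Rew C \<R> \<Delta> = free_bicat \<lparr>
     Gen0 = Obj C,
     Gen1 = {\<rho>. direct_derivation C \<R> \<rho>},
     src1 = dsource C,
     trg1 = dtarget C,
     Gen2 = \<Delta>,
     src2 = (\<lambda>\<delta>. Comp (Gen (res2 \<delta>)) (Gen (step1 \<delta>))),
     trg2 = (\<lambda>\<delta>. Comp (Gen (res1 \<delta>)) (Gen (step2 \<delta>))) \<rparr>"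


section \<open>Spans with monic left leg\<close>

text \<open>A span is the pair of its legs \<open>(u, v)\<close>; the apex is their common domain.  A 2-cell records its
  source and target span along with the isomorphism of apexes.\<close>

type_synonym 'a span = "'a \<times> 'a"

definition apex :: "('o, 'a) cat \<Rightarrow> 'a span \<Rightarrow> 'o" where
  "apex C s = Dom C (fst s)"

definition par_spans :: "('o, 'a) cat \<Rightarrow> 'o \<Rightarrow> 'o \<Rightarrow> 'a span set" where
  "par_spans C X Y = {(u, v). mono_arr C u \<and> v \<in> Arr C \<and> Dom C u = Dom C v \<and> Cod C u = X \<and> Cod C v = Y}"

definition span_isos :: "('o, 'a) cat \<Rightarrow> 'a span \<Rightarrow> 'a span \<Rightarrow> ('a span \<times> 'a \<times> 'a span) set" where
  "span_isos C s t = {(s, \<phi>, t) | \<phi>.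
     (\<exists>X Y. s \<in> par_spans C X Y \<and> t \<in> par_spans C X Y) \<and>
     \<phi> \<in> Hom C (apex C s) (apex C t) \<and> iso_arr C \<phi> \<and>
     fst t \<cdot>\<^bsub>C\<^esub> \<phi> = fst s \<and> snd t \<cdot>\<^bsub>C\<^esub> \<phi> = snd s}"

text \<open>For \<open>s : X \<rightarrow> Y\<close> and \<open>t : Y \<rightarrow> Z\<close> the apex of the composite is the chosen pullback of the right
  leg of \<open>s\<close> along the left leg of \<open>t\<close>; \<open>proj1\<close> and \<open>proj2\<close> are its projections to the apexes of \<open>s\<close>
  and \<open>t\<close>.\<close>

definition proj1 :: "('a \<Rightarrow> 'a \<Rightarrow> 'a \<times> 'a) \<Rightarrow> 'a span \<Rightarrow> 'a span \<Rightarrow> 'a" where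
  "proj1 pb t s = fst (pb (snd s) (fst t))"

definition proj2 :: "('a \<Rightarrow> 'a \<Rightarrow> 'a \<times> 'a) \<Rightarrow> 'a span \<Rightarrow> 'a span \<Rightarrow> 'a" where
  "proj2 pb t s = snd (pb (snd s) (fst t))"

definition span_comp :: "('o, 'a) cat \<Rightarrow> ('a \<Rightarrow> 'a \<Rightarrow> 'a \<times> 'a) \<Rightarrow> 'a span \<Rightarrow> 'a span \<Rightarrow> 'a span" where
  "span_comp C pb t s = (fst s \<cdot>\<^bsub>C\<^esub> proj1 pb t s, snd t \<cdot>\<^bsub>C\<^esub> proj2 pb t s)"

text \<open>Horizontal composites and associators are the arrows between pullbacks determined by the
  universal property.\<close>

definition ParSpan :: "('o, 'a) cat \<Rightarrow> ('a \<Rightarrow> 'a \<Rightarrow> 'a \<times> 'a) \<Rightarrow>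
    ('o, 'a span, 'a span \<times> 'a \<times> 'a span) bicat" where
  "ParSpan C pb = \<lparr>
     Ob = Obj C,
     Hom1 = par_spans C,
     Hom2 = span_isos C,
     id1 = (\<lambda>X. (Ide C X, Ide C X)),
     comp1 = span_comp C pb,
     id2 = (\<lambda>s. (s, Ide C (apex C s), s)),
     vcomp = (\<lambda>(t', \<psi>, u) (s, \<phi>, t). (s, \<psi> \<cdot>\<^bsub>C\<^esub> \<phi>, u)),
     hcomp = (\<lambda>(t, \<psi>, t') (s, \<phi>, s').
        (span_comp C pb t s,
         THE \<chi>. \<chi> \<in> Hom C (apex C (span_comp C pb t s)) (apex C (span_comp C pb t' s')) \<and>
           proj1 pb t' s' \<cdot>\<^bsub>C\<^esub> \<chi> = \<phi> \<cdot>\<^bsub>C\<^esub> proj1 pb t s \<and>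
           proj2 pb t' s' \<cdot>\<^bsub>C\<^esub> \<chi> = \<psi> \<cdot>\<^bsub>C\<^esub> proj2 pb t s,
         span_comp C pb t' s')),
     assoc = (\<lambda>u t s. let ut = span_comp C pb u t; ts = span_comp C pb t s in
        (span_comp C pb ut s,
         THE \<chi>. \<chi> \<in> Hom C (apex C (span_comp C pb ut s)) (apex C (span_comp C pb u ts)) \<and>
           proj1 pb t s \<cdot>\<^bsub>C\<^esub> (proj1 pb u ts \<cdot>\<^bsub>C\<^esub> \<chi>) = proj1 pb ut s \<and>
           proj2 pb t s \<cdot>\<^bsub>C\<^esub> (proj1 pb u ts \<cdot>\<^bsub>C\<^esub> \<chi>) = proj1 pb u t \<cdot>\<^bsub>C\<^esub> proj2 pb ut s \<and>
           proj2 pb u ts \<cdot>\<^bsub>C\<^esub> \<chi> = proj2 pb u t \<cdot>\<^bsub>C\<^esub> proj2 pb ut s,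
         span_comp C pb u ts)),
     lunit = (\<lambda>s. let i = (Ide C (Cod C (snd s)), Ide C (Cod C (snd s))) in
        (span_comp C pb i s, proj1 pb i s, s)),
     runit = (\<lambda>s. let i = (Ide C (Cod C (fst s)), Ide C (Cod C (fst s))) in
        (span_comp C pb s i, proj2 pb s i, s)) \<rparr>"

definition trk :: "'a deriv \<Rightarrow> 'a span" where
  "trk \<rho> = (dd \<rho>, hh \<rho>)"

end

theory Submission imports Defs begin

text \<open>
  Since left legs are monic, there is at most one isomorphism between two given spans.  So
  \<open>ParSpan\<close> is locally thin: parallel 2-cells are equal, and every equation that a bicategory or a
  pseudofunctor into \<open>ParSpan\<close> has to satisfy holds as soon as both of its sides are typed.  The
  theorem thereby reduces to existence statements: track spans have monic left legs
  (\<open>trk_hom\<close>), and the two composite track spans of a diamond are isomorphic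
  (\<open>diamond_iso\<close>).  The extension from generators to all of \<open>Rew\<close> is \<open>free_bicat_extension\<close>.
  It is strict on 1-cells and sends a class of 2-cell terms to the only 2-cell of the right type.

  Both existence statements rest on two properties that the category of typed hypergraphs shares
  with every adhesive category: a pushout of a monomorphism is a monomorphism, and the pushout
  square is then also a pullback (\<open>pushout_of_mono\<close>).  They are proved elementwise.  A
  monomorphism \<open>f\<close> is injective on elements, because its kernel pair exists.  Given a further
  arrow \<open>g\<close> out of the same object, gluing the complement of the image of \<open>f\<close> to the codomain of
  \<open>g\<close> gives one commutative square that has both properties, and every pushout of \<open>f\<close> along
  \<open>g\<close> inherits them from it.

  For a diamond let \<open>D\<^sub>0\<close> be the pullback of the contexts \<open>D\<^sub>1\<close> and \<open>D\<^sub>2\<close>.  The context \<open>D\<^sub>2'\<close> of the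
  residual \<open>\<rho>\<^sub>2'\<close> is the pushout of \<open>K\<^sub>1 \<rightarrow> R\<^sub>1\<close> along \<open>K\<^sub>1 \<rightarrow> D\<^sub>0\<close>, while \<open>H\<^sub>1\<close> is the pushout of the same
  arrow along the composite \<open>K\<^sub>1 \<rightarrow> D\<^sub>0 \<rightarrow> D\<^sub>1\<close>.  Cancelling the first pushout from the second leaves a
  pushout with corners \<open>D\<^sub>0, D\<^sub>1, D\<^sub>2', H\<^sub>1\<close> in which \<open>D\<^sub>0 \<rightarrow> D\<^sub>2'\<close> is monic; so \<open>D\<^sub>0\<close> is also the pullback
  of \<open>D\<^sub>1\<close> and \<open>D\<^sub>2'\<close> over \<open>H\<^sub>1\<close> (\<open>residual_pullback\<close>).  By symmetry it is the pullback of \<open>D\<^sub>2\<close> and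
  \<open>D\<^sub>1'\<close> over \<open>H\<^sub>2\<close>.  Hence both composites are isomorphic to the span from \<open>G\<close> to \<open>X\<close> with apex \<open>D\<^sub>0\<close>.
\<close>

section \<open>Categories, pullbacks and pushouts\<close>

locale category =
  fixes C :: "('o, 'a) cat" (structure)
  assumes dom_obj: "f \<in> Arr C \<Longrightarrow> Dom C f \<in> Obj C"
    and cod_obj: "f \<in> Arr C \<Longrightarrow> Cod C f \<in> Obj C"
    and ide_hom: "X \<in> Obj C \<Longrightarrow> Ide C X \<in> Hom C X X"
    and cmp_hom: "f \<in> Hom C X Y \<Longrightarrow> g \<in> Hom C Y Z \<Longrightarrow> g \<cdot> f \<in> Hom C X Z"
    and cmp_ide_hom: "f \<in> Hom C X Y \<Longrightarrow> f \<cdot> Ide C X = f"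
    and ide_cmp_hom: "f \<in> Hom C X Y \<Longrightarrow> Ide C Y \<cdot> f = f"
    and cmp_assoc_hom: "f \<in> Hom C X Y \<Longrightarrow> g \<in> Hom C Y Z \<Longrightarrow> h \<in> Hom C Z W \<Longrightarrow>
          (h \<cdot> g) \<cdot> f = h \<cdot> (g \<cdot> f)"
begin

lemma ide_simps [simp]:
  assumes "X \<in> Obj C"
  shows "Ide C X \<in> Arr C" "Dom C (Ide C X) = X" "Cod C (Ide C X) = X"
  using ide_hom[OF assms] by (auto simp: Hom_def)

lemma cmp_simps [simp]:
  assumes "f \<in> Arr C" "g \<in> Arr C" "Dom C g = Cod C f"
  shows "g \<cdot> f \<in> Arr C" "Dom C (g \<cdot> f) = Dom C f" "Cod C (g \<cdot> f) = Cod C g"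
  using cmp_hom[of f "Dom C f" "Cod C f" g "Cod C g"] assms by (auto simp: Hom_def)

lemma cmp_ide [simp]: "f \<in> Arr C \<Longrightarrow> X = Dom C f \<Longrightarrow> f \<cdot> Ide C X = f"
  using cmp_ide_hom[of f "Dom C f" "Cod C f"] by (auto simp: Hom_def)

lemma ide_cmp [simp]: "f \<in> Arr C \<Longrightarrow> X = Cod C f \<Longrightarrow> Ide C X \<cdot> f = f"
  using ide_cmp_hom[of f "Dom C f" "Cod C f"] by (auto simp: Hom_def)

lemma cmp_assoc:
  "f \<in> Arr C \<Longrightarrow> g \<in> Arr C \<Longrightarrow> h \<in> Arr C \<Longrightarrow> Dom C g = Cod C f \<Longrightarrow> Dom C h = Cod C g \<Longrightarrow>
     (h \<cdot> g) \<cdot> f = h \<cdot> (g \<cdot> f)"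
  using cmp_assoc_hom[of f "Dom C f" "Cod C f" g "Cod C g" h "Cod C h"] by (auto simp: Hom_def)

lemma mono_cancel:
  assumes "mono_arr C f" "g \<in> Arr C" "h \<in> Arr C" "Cod C g = Dom C f" "Cod C h = Dom C f"
    and "Dom C g = Dom C h" "f \<cdot> g = f \<cdot> h"
  shows "g = h"
  using assms unfolding mono_arr_def Hom_def by blast

lemma mono_arr [dest]: "mono_arr C f \<Longrightarrow> f \<in> Arr C"
  by (simp add: mono_arr_def)

lemma mono_arrI:
  assumes "f \<in> Arr C"
    and "\<And>g h. g \<in> Arr C \<Longrightarrow> h \<in> Arr C \<Longrightarrow> Cod C g = Dom C f \<Longrightarrow> Cod C h = Dom C f \<Longrightarrow>
      Dom C g = Dom C h \<Longrightarrow> f \<cdot> g = f \<cdot> h \<Longrightarrow> g = h"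
  shows "mono_arr C f"
  using assms unfolding mono_arr_def Hom_def by auto

lemma mono_ide: "X \<in> Obj C \<Longrightarrow> mono_arr C (Ide C X)"
  by (rule mono_arrI) (auto simp: ide_cmp)

lemma mono_cmp:
  assumes f: "mono_arr C f" and g: "mono_arr C g" and "Dom C g = Cod C f"
  shows "mono_arr C (g \<cdot> f)"
proof (rule mono_arrI)
  have A: "f \<in> Arr C" "g \<in> Arr C" using f g by auto
  show "g \<cdot> f \<in> Arr C" using A assms by simp
  fix a b assume ab: "a \<in> Arr C" "b \<in> Arr C" "Cod C a = Dom C (g \<cdot> f)" "Cod C b = Dom C (g \<cdot> f)"
    "Dom C a = Dom C b" "(g \<cdot> f) \<cdot> a = (g \<cdot> f) \<cdot> b"
  have "g \<cdot> (f \<cdot> a) = g \<cdot> (f \<cdot> b)" using ab A assms by (simp add: cmp_assoc)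
  then have "f \<cdot> a = f \<cdot> b" using mono_cancel[OF g, of "f \<cdot> a" "f \<cdot> b"] ab A assms by simp
  then show "a = b" using mono_cancel[OF f, of a b] ab A assms by simp
qed

lemma mono_factor:
  assumes "mono_arr C (g \<cdot> f)" and A: "f \<in> Arr C" "g \<in> Arr C" "Dom C g = Cod C f"
  shows "mono_arr C f"
proof (rule mono_arrI[OF A(1)])
  fix a b assume ab: "a \<in> Arr C" "b \<in> Arr C" "Cod C a = Dom C f" "Cod C b = Dom C f"
    "Dom C a = Dom C b" "f \<cdot> a = f \<cdot> b"
  then have "(g \<cdot> f) \<cdot> a = (g \<cdot> f) \<cdot> b" using A by (simp add: cmp_assoc)
  then show "a = b" using mono_cancel[OF assms(1), of a b] ab A by simp
qed

lemma pullback_sym: "is_pullback C f g p q \<Longrightarrow> is_pullback C g f q p"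
  unfolding is_pullback_def by (metis (no_types, lifting))

lemma pullback_ex1:
  assumes "is_pullback C f g p q" "x \<in> Hom C Z (Dom C f)" "y \<in> Hom C Z (Dom C g)" "f \<cdot> x = g \<cdot> y"
  shows "\<exists>!w. w \<in> Hom C Z (Dom C p) \<and> p \<cdot> w = x \<and> q \<cdot> w = y"
  using assms unfolding is_pullback_def by blast

lemma pullback_simps:
  assumes "is_pullback C f g p q"
  shows "f \<in> Arr C" "g \<in> Arr C" "p \<in> Arr C" "q \<in> Arr C"
    "Cod C f = Cod C g" "Cod C p = Dom C f" "Cod C q = Dom C g" "Dom C p = Dom C q"
    "f \<cdot> p = g \<cdot> q"
  using assms unfolding is_pullback_def by blast+

lemma pushout_simps:
  assumes "is_pushout C f g p q"
  shows "f \<in> Arr C" "g \<in> Arr C" "p \<in> Arr C" "q \<in> Arr C"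
    "Dom C f = Dom C g" "Dom C p = Cod C f" "Dom C q = Cod C g" "Cod C p = Cod C q"
    "p \<cdot> f = q \<cdot> g"
  using assms unfolding is_pushout_def by blast+

lemma pullback_pair:
  assumes "is_pullback C f g p q" "x \<in> Arr C" "y \<in> Arr C" "Dom C x = Dom C y"
    and "Cod C x = Dom C f" "Cod C y = Dom C g" "f \<cdot> x = g \<cdot> y"
  obtains w where "w \<in> Arr C" "Dom C w = Dom C x" "Cod C w = Dom C p" "p \<cdot> w = x" "q \<cdot> w = y"
proof -
  have "\<exists>!w. w \<in> Hom C (Dom C x) (Dom C p) \<and> p \<cdot> w = x \<and> q \<cdot> w = y"
    by (rule pullback_ex1[OF assms(1)]) (use assms in \<open>auto simp: Hom_def\<close>)
  then show thesis using that by (auto simp: Hom_def)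
qed

lemma pullback_unique:
  assumes "is_pullback C f g p q" "v \<in> Arr C" "w \<in> Arr C" "Dom C v = Dom C w"
    and "Cod C v = Dom C p" "Cod C w = Dom C p" "p \<cdot> v = p \<cdot> w" "q \<cdot> v = q \<cdot> w"
  shows "v = w"
proof -
  note P = pullback_simps[OF assms(1)]
  have "(f \<cdot> p) \<cdot> w = (g \<cdot> q) \<cdot> w" by (simp only: P(9))
  then have "f \<cdot> (p \<cdot> w) = g \<cdot> (q \<cdot> w)" using P(1-8) assms by (simp add: cmp_assoc)
  then have "\<exists>!z. z \<in> Hom C (Dom C w) (Dom C p) \<and> p \<cdot> z = p \<cdot> w \<and> q \<cdot> z = q \<cdot> w"
    by (intro pullback_ex1[OF assms(1)]) (use P(1-8) assms in \<open>simp_all add: Hom_def\<close>)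
  moreover have "v \<in> Hom C (Dom C w) (Dom C p)" "w \<in> Hom C (Dom C w) (Dom C p)"
    using assms by (auto simp: Hom_def)
  ultimately show ?thesis using assms(7,8) by blast
qed

lemma pullback_mono:
  assumes P: "is_pullback C f g p q" and g: "mono_arr C g"
  shows "mono_arr C p"
proof (rule mono_arrI)
  note P' = pullback_simps[OF P]
  show "p \<in> Arr C" by (rule P'(3))
  fix a b assume ab: "a \<in> Arr C" "b \<in> Arr C" "Cod C a = Dom C p" "Cod C b = Dom C p"
    "Dom C a = Dom C b" "p \<cdot> a = p \<cdot> b"
  have "g \<cdot> (q \<cdot> a) = (f \<cdot> p) \<cdot> a" unfolding P'(9) using P'(1-8) ab by (simp add: cmp_assoc)
  also have "\<dots> = (f \<cdot> p) \<cdot> b" using P'(1-8) ab by (simp add: cmp_assoc)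
  also have "\<dots> = g \<cdot> (q \<cdot> b)" unfolding P'(9) using P'(1-8) ab by (simp add: cmp_assoc)
  finally have "g \<cdot> (q \<cdot> a) = g \<cdot> (q \<cdot> b)" .
  then have "q \<cdot> a = q \<cdot> b"
    using mono_cancel[OF g, of "q \<cdot> a" "q \<cdot> b"] P'(1-8) ab by simp
  then show "a = b" using pullback_unique[OF P, of a b] ab by simp
qed

lemma pushout_copair:
  assumes "is_pushout C f g p q" "x \<in> Hom C (Cod C f) Z" "y \<in> Hom C (Cod C g) Z" "x \<cdot> f = y \<cdot> g"
  shows "\<exists>!w. w \<in> Hom C (Cod C p) Z \<and> w \<cdot> p = x \<and> w \<cdot> q = y"
  using assms unfolding is_pushout_def by blast

text \<open>Restricting the first component of a cocone on the right-hand span \<open>f', e\<close> along \<open>g'\<close> gives a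
  cocone on the outer span \<open>f, e \<cdot> c\<close>.  The arrow that it induces is compatible with the original
  first component because the two agree on both legs of the left-hand pushout.\<close>

lemma pushout_cancel:
  assumes L: "is_pushout C f c g' f'" and O: "is_pushout C f (e \<cdot> c) n h"
    and A: "e \<in> Arr C" "d \<in> Arr C" "Dom C e = Cod C c" "Dom C d = Cod C f'"
    and eq: "d \<cdot> f' = h \<cdot> e" "d \<cdot> g' = n"
  shows "is_pushout C f' e d h"
proof -
  have B: "f \<in> Arr C" "c \<in> Arr C" "g' \<in> Arr C" "f' \<in> Arr C" "n \<in> Arr C" "h \<in> Arr C"
    "Dom C f = Dom C c" "Dom C g' = Cod C f" "Dom C f' = Cod C c" "Cod C f' = Cod C g'"
    "Dom C n = Cod C f" "Dom C h = Cod C e" "Cod C n = Cod C h" "g' \<cdot> f = f' \<cdot> c"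
    using pushout_simps[OF L] pushout_simps[OF O] A by auto
  have cod: "Cod C d = Cod C h"
    using A B eq(2) by (metis cmp_simps(3))
  show ?thesis
    unfolding is_pushout_def
  proof (intro conjI allI ballI impI)
    fix Z x y assume x: "x \<in> Hom C (Cod C f') Z" and y: "y \<in> Hom C (Cod C e) Z"
      and xy: "x \<cdot> f' = y \<cdot> e"
    have xa: "x \<in> Arr C" "y \<in> Arr C" "Dom C x = Cod C f'" "Cod C x = Z" "Dom C y = Cod C e" "Cod C y = Z"
      using x y by (auto simp: Hom_def)
    have e1: "(x \<cdot> g') \<cdot> f = y \<cdot> (e \<cdot> c)"
    proof -
      have "(x \<cdot> g') \<cdot> f = (x \<cdot> f') \<cdot> c" using xa A B by (simp add: cmp_assoc)
      also have "\<dots> = y \<cdot> (e \<cdot> c)" unfolding xy using xa A B by (simp add: cmp_assoc)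
      finally show ?thesis .
    qed
    have xg: "x \<cdot> g' \<in> Hom C (Cod C f) Z" "x \<in> Hom C (Cod C f') Z" "x \<cdot> f' \<in> Hom C (Cod C c) Z"
      "y \<in> Hom C (Cod C (e \<cdot> c)) Z"
      using xa A B by (auto simp: Hom_def)
    have "\<exists>!w. w \<in> Hom C (Cod C n) Z \<and> w \<cdot> n = x \<cdot> g' \<and> w \<cdot> h = y"
      by (rule pushout_copair[OF O xg(1,4) e1])
    then obtain w where w: "w \<in> Hom C (Cod C n) Z" "w \<cdot> n = x \<cdot> g'" "w \<cdot> h = y"
      and wu: "\<And>w'. w' \<in> Hom C (Cod C n) Z \<Longrightarrow> w' \<cdot> n = x \<cdot> g' \<Longrightarrow> w' \<cdot> h = y \<Longrightarrow> w' = w"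
      by blast
    have wa: "w \<in> Arr C" "Dom C w = Cod C h" "Cod C w = Z" using w B by (auto simp: Hom_def)
    have "(x \<cdot> g') \<cdot> f = (x \<cdot> f') \<cdot> c" using xa A B by (simp add: cmp_assoc)
    then have "\<exists>!v. v \<in> Hom C (Cod C g') Z \<and> v \<cdot> g' = x \<cdot> g' \<and> v \<cdot> f' = x \<cdot> f'"
      by (rule pushout_copair[OF L xg(1,3)])
    moreover have "(w \<cdot> d) \<cdot> g' = x \<cdot> g'"
      using w(2) eq(2) wa A B cod by (simp add: cmp_assoc)
    moreover have "(w \<cdot> d) \<cdot> f' = x \<cdot> f'"
    proof -
      have "(w \<cdot> d) \<cdot> f' = w \<cdot> (h \<cdot> e)" using eq(1) wa A B cod by (simp add: cmp_assoc)
      also have "\<dots> = (w \<cdot> h) \<cdot> e" using wa A B cod by (simp add: cmp_assoc)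
      finally show ?thesis using w(3) xy by simp
    qed
    moreover have "w \<cdot> d \<in> Hom C (Cod C g') Z" "x \<in> Hom C (Cod C g') Z"
      using wa xa A B cod by (auto simp: Hom_def)
    ultimately have wd: "w \<cdot> d = x" by blast
    show "\<exists>!w. w \<in> Hom C (Cod C d) Z \<and> w \<cdot> d = x \<and> w \<cdot> h = y"
    proof (rule ex1I[of _ w])
      show "w \<in> Hom C (Cod C d) Z \<and> w \<cdot> d = x \<and> w \<cdot> h = y"
        using wa cod wd w by (simp add: Hom_def)
      fix v assume v: "v \<in> Hom C (Cod C d) Z \<and> v \<cdot> d = x \<and> v \<cdot> h = y"
      then have "v \<cdot> n = x \<cdot> g'"
        using eq(2) A B cod by (auto simp: Hom_def simp flip: cmp_assoc)
      then show "v = w" using wu v cod B by simp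
    qed
  qed (use A B cod eq in simp_all)
qed

text \<open>A pushout maps to every other cocone, so both properties can be tested on one convenient
  cocone: a first factor of a monomorphism is monic, and a commutative square is a pullback if
  it becomes one after its corner is mapped further.\<close>

lemma pushout_mono_transfer:
  assumes P: "is_pushout C f g p q"
    and X: "x \<in> Arr C" "y \<in> Arr C" "Dom C x = Cod C f" "Dom C y = Cod C g" "Cod C x = Cod C y"
      "x \<cdot> f = y \<cdot> g"
    and y: "mono_arr C y" and Q: "is_pullback C x y f g"
  shows "mono_arr C q" "is_pullback C p q f g"
proof -
  have B: "f \<in> Arr C" "g \<in> Arr C" "p \<in> Arr C" "q \<in> Arr C" "Dom C f = Dom C g" "Dom C p = Cod C f"
    "Dom C q = Cod C g" "Cod C p = Cod C q" "p \<cdot> f = q \<cdot> g" using pushout_simps[OF P] by auto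
  obtain w where w: "w \<in> Arr C" "Dom C w = Cod C q" "Cod C w = Cod C x" "w \<cdot> p = x" "w \<cdot> q = y"
  proof -
    have "\<exists>!w. w \<in> Hom C (Cod C p) (Cod C x) \<and> w \<cdot> p = x \<and> w \<cdot> q = y"
      by (rule pushout_copair[OF P]) (use X in \<open>auto simp: Hom_def\<close>)
    then show thesis using that B by (auto simp: Hom_def)
  qed
  show "mono_arr C q" using mono_factor[of w q] y w B by simp
  show "is_pullback C p q f g"
    unfolding is_pullback_def
  proof (intro conjI allI ballI impI)
    fix Z a b assume ab: "a \<in> Hom C Z (Dom C p)" "b \<in> Hom C Z (Dom C q)" "p \<cdot> a = q \<cdot> b"
    have a: "a \<in> Arr C" "b \<in> Arr C" "Cod C a = Dom C p" "Cod C b = Dom C q"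
      using ab by (auto simp: Hom_def)
    have "x \<cdot> a = w \<cdot> (p \<cdot> a)" using a B w by (simp flip: cmp_assoc)
    also have "\<dots> = y \<cdot> b" unfolding ab(3) using a B w by (simp flip: cmp_assoc)
    finally show "\<exists>!w. w \<in> Hom C Z (Dom C f) \<and> f \<cdot> w = a \<and> g \<cdot> w = b"
      using pullback_ex1[OF Q, of a Z b] ab B X by simp
  qed (use B in simp_all)
qed

end

section \<open>Functor categories and slices\<close>

lemma category_SetCat: "category (SetCat U)"
proof (unfold_locales, goal_cases)
  case (7 f X Y g Z h W)
  then show ?case
    by (auto simp: SetCat_def Hom_def compose_def fun_eq_iff restrict_def PiE_iff)
qed (auto simp: SetCat_def Hom_def compose_def fun_eq_iff restrict_def PiE_iff extensional_def split: if_splits)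

lemma is_path_ends: "is_path Q x es y \<Longrightarrow> x \<in> Verts Q \<and> y \<in> Verts Q"
  by (induction es arbitrary: x) auto

lemma is_path_append: "is_path Q x es y \<Longrightarrow> is_path Q y fs z \<Longrightarrow> is_path Q x (es @ fs) z"
  by (induction es arbitrary: x) auto

lemma category_free_cat: "category (free_cat Q)"
  by unfold_locales (auto simp: free_cat_def Hom_def dest: is_path_ends intro: is_path_append)

lemma functor_cat_hom:
  "\<alpha> \<in> Hom (functor_cat J B) F G \<longleftrightarrow> (\<exists>\<eta>. \<alpha> = (F, \<eta>, G) \<and> is_nattrans J B (F, \<eta>, G))"
  by (cases \<alpha>) (auto simp: functor_cat_def Hom_def)

lemma functor_cat_ide: "Ide (functor_cat J B) F = (F, \<lambda>X\<in>Obj J. Ide B (fst F X), F)"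
  by (simp add: functor_cat_def)

lemma functor_cat_cmp:
  "(G', \<theta>, H) \<cdot>\<^bsub>functor_cat J B\<^esub> (F, \<eta>, G) = (F, \<lambda>X\<in>Obj J. \<theta> X \<cdot>\<^bsub>B\<^esub> \<eta> X, H)"
  by (simp add: functor_cat_def)

lemma category_functor_cat:
  assumes "category J" "category B"
  shows "category (functor_cat J B)"
proof -
  interpret J: category J by fact
  interpret B: category B by fact
  have comp: "is_nattrans J B (F, \<lambda>X\<in>Obj J. \<theta> X \<cdot>\<^bsub>B\<^esub> \<eta> X, H)"
    if "is_nattrans J B (F, \<eta>, G)" "is_nattrans J B (G, \<theta>, H)" for F G H \<eta> \<theta>
  proof -
    have n: "is_functor J B F" "is_functor J B G" "is_functor J B H"
      "\<And>X. X \<in> Obj J \<Longrightarrow> \<eta> X \<in> Hom B (fst F X) (fst G X)"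
      "\<And>X. X \<in> Obj J \<Longrightarrow> \<theta> X \<in> Hom B (fst G X) (fst H X)"
      "\<And>f. f \<in> Arr J \<Longrightarrow> \<eta> (Cod J f) \<cdot>\<^bsub>B\<^esub> snd F f = snd G f \<cdot>\<^bsub>B\<^esub> \<eta> (Dom J f)"
      "\<And>f. f \<in> Arr J \<Longrightarrow> \<theta> (Cod J f) \<cdot>\<^bsub>B\<^esub> snd G f = snd H f \<cdot>\<^bsub>B\<^esub> \<theta> (Dom J f)"
      using that by (auto simp: is_nattrans_def)
    have nat: "(\<theta> (Cod J f) \<cdot>\<^bsub>B\<^esub> \<eta> (Cod J f)) \<cdot>\<^bsub>B\<^esub> snd F f = snd H f \<cdot>\<^bsub>B\<^esub> (\<theta> (Dom J f) \<cdot>\<^bsub>B\<^esub> \<eta> (Dom J f))"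
      if f: "f \<in> Arr J" for f
    proof -
      have F: "K \<in> {F, G, H} \<Longrightarrow> snd K f \<in> Hom B (fst K (Dom J f)) (fst K (Cod J f))" for K
        using n(1-3) f by (auto simp: is_functor_def Hom_def)
      have D: "Dom J f \<in> Obj J" "Cod J f \<in> Obj J" using f J.dom_obj J.cod_obj by auto
      have "(\<theta> (Cod J f) \<cdot>\<^bsub>B\<^esub> \<eta> (Cod J f)) \<cdot>\<^bsub>B\<^esub> snd F f = \<theta> (Cod J f) \<cdot>\<^bsub>B\<^esub> (\<eta> (Cod J f) \<cdot>\<^bsub>B\<^esub> snd F f)"
        by (rule B.cmp_assoc_hom[OF F n(4)[OF D(2)] n(5)[OF D(2)]]) simp
      also have "\<dots> = \<theta> (Cod J f) \<cdot>\<^bsub>B\<^esub> (snd G f \<cdot>\<^bsub>B\<^esub> \<eta> (Dom J f))" by (simp only: n(6)[OF f])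
      also have "\<dots> = (\<theta> (Cod J f) \<cdot>\<^bsub>B\<^esub> snd G f) \<cdot>\<^bsub>B\<^esub> \<eta> (Dom J f)"
        by (rule B.cmp_assoc_hom[OF n(4)[OF D(1)] F n(5)[OF D(2)], symmetric]) simp
      also have "\<dots> = (snd H f \<cdot>\<^bsub>B\<^esub> \<theta> (Dom J f)) \<cdot>\<^bsub>B\<^esub> \<eta> (Dom J f)" by (simp only: n(7)[OF f])
      also have "\<dots> = snd H f \<cdot>\<^bsub>B\<^esub> (\<theta> (Dom J f) \<cdot>\<^bsub>B\<^esub> \<eta> (Dom J f))"
        by (rule B.cmp_assoc_hom[OF n(4)[OF D(1)] n(5)[OF D(1)] F]) simp
      finally show ?thesis .
    qed
    have "\<theta> X \<cdot>\<^bsub>B\<^esub> \<eta> X \<in> Hom B (fst F X) (fst H X)" if "X \<in> Obj J" for X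
      by (rule B.cmp_hom[OF n(4)[OF that] n(5)[OF that]])
    then show ?thesis
      using n(1-3) nat J.dom_obj J.cod_obj by (auto simp: is_nattrans_def)
  qed
  show ?thesis
  proof (unfold_locales, goal_cases)
    case (1 \<alpha>) then show ?case by (auto simp: functor_cat_def is_nattrans_def)
  next
    case (2 \<alpha>) then show ?case by (auto simp: functor_cat_def is_nattrans_def)
  next
    case (3 F)
    then have F: "is_functor J B F" by (simp add: functor_cat_def)
    have 1: "Ide B (fst F X) \<in> Hom B (fst F X) (fst F X)" if "X \<in> Obj J" for X
      using F that B.ide_hom by (auto simp: is_functor_def)
    have "Ide B (fst F (Cod J f)) \<cdot>\<^bsub>B\<^esub> snd F f = snd F f \<cdot>\<^bsub>B\<^esub> Ide B (fst F (Dom J f))" if "f \<in> Arr J" for f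
    proof -
      have "snd F f \<in> Arr B" using F that by (auto simp: is_functor_def)
      with F that show ?thesis by (simp add: is_functor_def)
    qed
    with F 1 show ?case
      unfolding functor_cat_hom functor_cat_ide by (auto simp: is_nattrans_def J.dom_obj J.cod_obj)
  next
    case (4 \<alpha> F G \<beta> H)
    then obtain \<eta> \<theta> where a: "\<alpha> = (F, \<eta>, G)" "\<beta> = (G, \<theta>, H)"
      and n: "is_nattrans J B (F, \<eta>, G)" "is_nattrans J B (G, \<theta>, H)"
      by (auto simp: functor_cat_hom)
    show ?case unfolding a functor_cat_hom functor_cat_cmp using comp[OF n] by blast
  next
    case (5 \<alpha> F G)
    then obtain \<eta> where a: "\<alpha> = (F, \<eta>, G)" and n: "is_nattrans J B (F, \<eta>, G)"
      by (auto simp: functor_cat_hom)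
    have "(\<lambda>X\<in>Obj J. \<eta> X \<cdot>\<^bsub>B\<^esub> (\<lambda>X\<in>Obj J. Ide B (fst F X)) X) = \<eta>"
      by (rule extensionalityI[of _ "Obj J"]) (use n B.cmp_ide_hom in \<open>auto simp: is_nattrans_def\<close>)
    then show ?case by (simp add: a functor_cat_cmp functor_cat_ide)
  next
    case (6 \<alpha> F G)
    then obtain \<eta> where a: "\<alpha> = (F, \<eta>, G)" and n: "is_nattrans J B (F, \<eta>, G)"
      by (auto simp: functor_cat_hom)
    have "(\<lambda>X\<in>Obj J. (\<lambda>X\<in>Obj J. Ide B (fst G X)) X \<cdot>\<^bsub>B\<^esub> \<eta> X) = \<eta>"
      by (rule extensionalityI[of _ "Obj J"]) (use n B.ide_cmp_hom in \<open>auto simp: is_nattrans_def\<close>)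
    then show ?case by (simp add: a functor_cat_cmp functor_cat_ide)
  next
    case (7 \<alpha> F G \<beta> H \<gamma> K)
    then obtain \<eta> \<theta> \<iota> where a: "\<alpha> = (F, \<eta>, G)" "\<beta> = (G, \<theta>, H)" "\<gamma> = (H, \<iota>, K)"
      and n: "is_nattrans J B (F, \<eta>, G)" "is_nattrans J B (G, \<theta>, H)" "is_nattrans J B (H, \<iota>, K)"
      by (auto simp: functor_cat_hom)
    have "(\<iota> X \<cdot>\<^bsub>B\<^esub> \<theta> X) \<cdot>\<^bsub>B\<^esub> \<eta> X = \<iota> X \<cdot>\<^bsub>B\<^esub> (\<theta> X \<cdot>\<^bsub>B\<^esub> \<eta> X)" if "X \<in> Obj J" for X
      by (rule B.cmp_assoc_hom) (use n that in \<open>auto simp: is_nattrans_def\<close>)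
    then show ?case by (simp add: a functor_cat_cmp functor_cat_ide cong: restrict_cong)
  qed
qed

lemma slice_cat_hom:
  "m \<in> Hom (slice_cat C S) a b \<longleftrightarrow> (\<exists>f. m = (a, f, b) \<and> a \<in> Arr C \<and> b \<in> Arr C \<and> Cod C a = S \<and> Cod C b = S \<and>
     f \<in> Hom C (Dom C a) (Dom C b) \<and> b \<cdot>\<^bsub>C\<^esub> f = a)"
  by (cases m) (auto simp: slice_cat_def Hom_def)

lemma slice_cat_cmp: "(b', g, c) \<cdot>\<^bsub>slice_cat C S\<^esub> (a, f, b) = (a, g \<cdot>\<^bsub>C\<^esub> f, c)"
  by (simp add: slice_cat_def)

lemma slice_cat_ide: "Ide (slice_cat C S) a = (a, Ide C (Dom C a), a)"
  by (simp add: slice_cat_def)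

lemma category_slice_cat:
  assumes "category C"
  shows "category (slice_cat C S)"
proof -
  interpret category C by fact
  show ?thesis
  proof (unfold_locales, goal_cases)
    case (1 m) then show ?case by (auto simp: slice_cat_def)
  next
    case (2 m) then show ?case by (auto simp: slice_cat_def)
  next
    case (3 a)
    then have "a \<in> Arr C" "Cod C a = S" by (auto simp: slice_cat_def)
    then show ?case by (simp add: slice_cat_hom slice_cat_ide ide_hom dom_obj)
  next
    case (4 m a b n c)
    then obtain f g where m: "m = (a, f, b)" "n = (b, g, c)" and A: "a \<in> Arr C" "c \<in> Arr C" "Cod C a = S" "Cod C c = S"
      and fh: "f \<in> Hom C (Dom C a) (Dom C b)" and fe: "b \<cdot>\<^bsub>C\<^esub> f = a"
      and gh: "g \<in> Hom C (Dom C b) (Dom C c)" and ge: "c \<cdot>\<^bsub>C\<^esub> g = b"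
      by (auto simp: slice_cat_hom)
    have f: "f \<in> Arr C" "Dom C f = Dom C a" "Cod C f = Dom C b"
      and g: "g \<in> Arr C" "Dom C g = Dom C b" "Cod C g = Dom C c"
      using fh gh by (auto simp: Hom_def)
    have "c \<cdot>\<^bsub>C\<^esub> (g \<cdot>\<^bsub>C\<^esub> f) = a" using cmp_assoc[of f g c] A f g fe ge by simp
    then show ?case using A cmp_hom[OF fh gh] by (simp add: m slice_cat_hom slice_cat_cmp)
  next
    case (5 m a b)
    then obtain f where "m = (a, f, b)" "f \<in> Hom C (Dom C a) (Dom C b)" by (auto simp: slice_cat_hom)
    then show ?case by (simp add: slice_cat_cmp slice_cat_ide cmp_ide_hom)
  next
    case (6 m a b)
    then obtain f where "m = (a, f, b)" "f \<in> Hom C (Dom C a) (Dom C b)" by (auto simp: slice_cat_hom)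
    then show ?case by (simp add: slice_cat_cmp slice_cat_ide ide_cmp_hom)
  next
    case (7 m a b n c k d)
    then obtain f g h where "m = (a, f, b)" "n = (b, g, c)" "k = (c, h, d)"
      and "f \<in> Hom C (Dom C a) (Dom C b)" "g \<in> Hom C (Dom C b) (Dom C c)" "h \<in> Hom C (Dom C c) (Dom C d)"
      by (auto simp: slice_cat_hom)
    then show ?case by (simp add: slice_cat_cmp cmp_assoc_hom)
  qed
qed

section \<open>Typed presheaves by elements\<close>

lemma SetCat_cmp: "(B', g, D) \<cdot>\<^bsub>SetCat U\<^esub> (A, f, B) = (A, compose A g f, D)"
  by (simp add: SetCat_def)

lemma SetCat_hom:
  "t \<in> Hom (SetCat U) A B \<longleftrightarrow> A \<in> U \<and> B \<in> U \<and> fst (snd t) \<in> A \<rightarrow>\<^sub>E B \<and> t = (A, fst (snd t), B)"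
  by (cases t) (auto simp: SetCat_def Hom_def)

lemma SetCat_ide: "Ide (SetCat U) A = (A, \<lambda>x\<in>A. x, A)"
  by (simp add: SetCat_def)

lemma SetCat_obj: "Obj (SetCat U) = U"
  by (simp add: SetCat_def)

lemma functor_SetCat_iff:
  assumes "category J"
  shows "is_functor J (SetCat U) F \<longleftrightarrow>
    fst F \<in> Obj J \<rightarrow>\<^sub>E U \<and> snd F \<in> extensional (Arr J) \<and>
    (\<forall>u \<in> Arr J. snd F u \<in> Hom (SetCat U) (fst F (Dom J u)) (fst F (Cod J u))) \<and>
    (\<forall>X \<in> Obj J. snd F (Ide J X) = Ide (SetCat U) (fst F X)) \<and>
    (\<forall>u \<in> Arr J. \<forall>v \<in> Arr J. Dom J v = Cod J u \<longrightarrow> snd F (v \<cdot>\<^bsub>J\<^esub> u) = snd F v \<cdot>\<^bsub>SetCat U\<^esub> snd F u)"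
  unfolding is_functor_def SetCat_obj by (auto simp: Hom_def PiE_def)

locale typed_presheaves = J: category J
  for J :: "('j, 'k) cat" +
  fixes U :: "'u set set" and S :: "('j, 'k, 'u set, 'u setmap) functr"
  assumes U: "set_universe U" and S: "is_functor J (SetCat U) S"
begin

abbreviation TP where "TP \<equiv> slice_cat (functor_cat J (SetCat U)) S"

text \<open>An object of the slice is a triple \<open>(F, \<eta>, S)\<close>, and an arrow from \<open>a\<close> to \<open>b\<close> is a triple
  \<open>(a, (F, \<theta>, G), b)\<close>.  The following functions extract the underlying data: the elements \<open>el a h\<close> of
  a typed presheaf at \<open>h\<close>, the action of an arrow of the index category on them, the type of an
  element, the function that an arrow of the slice gives at \<open>h\<close>, and the action on the types.\<close>

definition el where "el a h = fst (fst a) h"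
definition act where "act a u = fst (snd (snd (fst a) u))"
definition ty where "ty a h = fst (snd (fst (snd a) h))"
definition fn where "fn m h = fst (snd (fst (snd (fst (snd m))) h))"
definition sact where "sact u = fst (snd (snd S u))"

lemma obj_iff: "a \<in> Obj TP \<longleftrightarrow> is_nattrans J (SetCat U) a \<and> snd (snd a) = S"
  by (cases a) (auto simp: slice_cat_def functor_cat_def)

lemma S_act: "u \<in> Arr J \<Longrightarrow> snd S u = (fst S (Dom J u), sact u, fst S (Cod J u))"
  using S unfolding functor_SetCat_iff[OF J.category_axioms] SetCat_hom sact_def by metis+

lemma obj_structure:
  assumes a: "a \<in> Obj TP"
  shows "is_functor J (SetCat U) (fst a)"
    and "h \<in> Obj J \<Longrightarrow> el a h \<in> U"
    and "u \<in> Arr J \<Longrightarrow> snd (fst a) u = (el a (Dom J u), act a u, el a (Cod J u))"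
    and "u \<in> Arr J \<Longrightarrow> act a u \<in> el a (Dom J u) \<rightarrow>\<^sub>E el a (Cod J u)"
    and "h \<in> Obj J \<Longrightarrow> fst (snd a) h = (el a h, ty a h, fst S h)"
    and "h \<in> Obj J \<Longrightarrow> ty a h \<in> el a h \<rightarrow>\<^sub>E fst S h"
    and "a = (fst a, fst (snd a), S)" "fst (snd a) \<in> extensional (Obj J)"
proof -
  obtain F \<eta> where e: "a = (F, \<eta>, S)" and n: "is_nattrans J (SetCat U) (F, \<eta>, S)"
    using a by (cases a) (auto simp: obj_iff)
  then have F: "is_functor J (SetCat U) F" and x: "\<eta> \<in> extensional (Obj J)"
    and \<eta>: "\<And>X. X \<in> Obj J \<Longrightarrow> \<eta> X \<in> Hom (SetCat U) (fst F X) (fst S X)"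
    by (auto simp: is_nattrans_def)
  note F' = F[unfolded functor_SetCat_iff[OF J.category_axioms]]
  show "is_functor J (SetCat U) (fst a)" "a = (fst a, fst (snd a), S)" "fst (snd a) \<in> extensional (Obj J)"
    using F x by (simp_all add: e)
  show "h \<in> Obj J \<Longrightarrow> el a h \<in> U" using F' by (auto simp: e el_def)
  show "u \<in> Arr J \<Longrightarrow> snd (fst a) u = (el a (Dom J u), act a u, el a (Cod J u))"
    and "u \<in> Arr J \<Longrightarrow> act a u \<in> el a (Dom J u) \<rightarrow>\<^sub>E el a (Cod J u)"
    using F' unfolding SetCat_hom by (simp_all add: e el_def act_def)
  show "h \<in> Obj J \<Longrightarrow> fst (snd a) h = (el a h, ty a h, fst S h)"
    and "h \<in> Obj J \<Longrightarrow> ty a h \<in> el a h \<rightarrow>\<^sub>E fst S h"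
    using \<eta>[of h] unfolding SetCat_hom by (simp_all add: e el_def ty_def)
qed

lemma act_el: "a \<in> Obj TP \<Longrightarrow> u \<in> Arr J \<Longrightarrow> x \<in> el a (Dom J u) \<Longrightarrow> act a u x \<in> el a (Cod J u)"
  using obj_structure(4) by blast

lemma ty_el: "a \<in> Obj TP \<Longrightarrow> h \<in> Obj J \<Longrightarrow> x \<in> el a h \<Longrightarrow> ty a h x \<in> fst S h"
  using obj_structure(6) by blast

lemma act_ide:
  assumes "a \<in> Obj TP" "h \<in> Obj J" "x \<in> el a h"
  shows "act a (Ide J h) x = x"
proof -
  have "snd (fst a) (Ide J h) = (fst (fst a) h, \<lambda>x\<in>fst (fst a) h. x, fst (fst a) h)"
    using obj_structure(1)[OF assms(1)] assms(2)
    unfolding functor_SetCat_iff[OF J.category_axioms] SetCat_ide by blast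
  then show ?thesis using assms(3) by (simp add: act_def el_def)
qed

lemma act_cmp:
  assumes a: "a \<in> Obj TP" and uv: "u \<in> Arr J" "v \<in> Arr J" "Dom J v = Cod J u" and x: "x \<in> el a (Dom J u)"
  shows "act a (v \<cdot>\<^bsub>J\<^esub> u) x = act a v (act a u x)"
proof -
  have "snd (fst a) (v \<cdot>\<^bsub>J\<^esub> u) = snd (fst a) v \<cdot>\<^bsub>SetCat U\<^esub> snd (fst a) u"
    using obj_structure(1)[OF a] uv unfolding functor_SetCat_iff[OF J.category_axioms] by blast
  also have "\<dots> = (el a (Dom J u), compose (el a (Dom J u)) (act a v) (act a u), el a (Cod J v))"
    unfolding obj_structure(3)[OF a uv(1)] obj_structure(3)[OF a uv(2)] SetCat_cmp ..
  finally have "act a (v \<cdot>\<^bsub>J\<^esub> u) = compose (el a (Dom J u)) (act a v) (act a u)"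
    by (simp add: act_def)
  then show ?thesis using x by (simp add: compose_eq)
qed

lemma ty_act:
  assumes a: "a \<in> Obj TP" and u: "u \<in> Arr J" and x: "x \<in> el a (Dom J u)"
  shows "ty a (Cod J u) (act a u x) = sact u (ty a (Dom J u) x)"
proof -
  have "fst (snd a) (Cod J u) \<cdot>\<^bsub>SetCat U\<^esub> snd (fst a) u = snd S u \<cdot>\<^bsub>SetCat U\<^esub> fst (snd a) (Dom J u)"
    using a u by (cases a) (auto simp: obj_iff is_nattrans_def)
  then have "compose (el a (Dom J u)) (ty a (Cod J u)) (act a u) =
      compose (el a (Dom J u)) (sact u) (ty a (Dom J u))"
    unfolding obj_structure(3)[OF a u] obj_structure(5)[OF a J.cod_obj[OF u]]
      obj_structure(5)[OF a J.dom_obj[OF u]] S_act[OF u] SetCat_cmp by simp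
  from fun_cong[OF this, of x] show ?thesis using x by (simp add: compose_eq)
qed

lemma TP_cmp: "(b', (G', \<theta>, H), c) \<cdot>\<^bsub>TP\<^esub> (a, (F, \<eta>, G), b) = (a, (F, \<lambda>X\<in>Obj J. \<theta> X \<cdot>\<^bsub>SetCat U\<^esub> \<eta> X, H), c)"
  by (simp add: slice_cat_def functor_cat_def)

text \<open>The fourth clause is what makes it possible to compare arrows on elements in \<open>hom_eqI\<close>.\<close>

lemma hom_structure:
  assumes m: "m \<in> Hom TP a b"
  shows "a \<in> Obj TP" "b \<in> Obj TP"
    and "\<And>h. h \<in> Obj J \<Longrightarrow> fn m h \<in> el a h \<rightarrow>\<^sub>E el b h"
    and "m = (a, (fst a, \<lambda>h\<in>Obj J. (el a h, fn m h, el b h), fst b), b)"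
    and "\<And>u x. u \<in> Arr J \<Longrightarrow> x \<in> el a (Dom J u) \<Longrightarrow>
      fn m (Cod J u) (act a u x) = act b u (fn m (Dom J u) x)"
    and "\<And>h x. h \<in> Obj J \<Longrightarrow> x \<in> el a h \<Longrightarrow> ty b h (fn m h x) = ty a h x"
proof -
  obtain F \<theta> G where e: "m = (a, (F, \<theta>, G), b)"
    using m by (cases m) (auto simp: slice_cat_def Hom_def)
  have ab: "a \<in> Obj TP" "b \<in> Obj TP" and FG: "F = fst a" "G = fst b" and n: "is_nattrans J (SetCat U) (F, \<theta>, G)"
    and t: "(F, \<lambda>X\<in>Obj J. fst (snd b) X \<cdot>\<^bsub>SetCat U\<^esub> \<theta> X, snd (snd b)) = a"
    using m unfolding e by (cases a; cases b; auto simp: slice_cat_def functor_cat_def Hom_def)+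
  show "a \<in> Obj TP" "b \<in> Obj TP" by fact+
  have fn: "fn m h = fst (snd (\<theta> h))" for h by (simp add: e fn_def)
  have \<theta>: "\<theta> h = (el a h, fn m h, el b h) \<and> fn m h \<in> el a h \<rightarrow>\<^sub>E el b h" if "h \<in> Obj J" for h
  proof -
    have "\<theta> h \<in> Hom (SetCat U) (el a h) (el b h)" using n that by (auto simp: is_nattrans_def FG el_def)
    then show ?thesis unfolding SetCat_hom fn by simp
  qed
  show "fn m h \<in> el a h \<rightarrow>\<^sub>E el b h" if "h \<in> Obj J" for h using \<theta>[OF that] by simp
  have "\<theta> = (\<lambda>h\<in>Obj J. (el a h, fn m h, el b h))"
    by (rule extensionalityI[of _ "Obj J"]) (use n \<theta> in \<open>auto simp: is_nattrans_def\<close>)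
  then show "m = (a, (fst a, \<lambda>h\<in>Obj J. (el a h, fn m h, el b h), fst b), b)"
    by (simp add: e FG)
  show "fn m (Cod J u) (act a u x) = act b u (fn m (Dom J u) x)"
    if u: "u \<in> Arr J" and x: "x \<in> el a (Dom J u)" for u x
  proof -
    have "\<theta> (Cod J u) \<cdot>\<^bsub>SetCat U\<^esub> snd (fst a) u = snd (fst b) u \<cdot>\<^bsub>SetCat U\<^esub> \<theta> (Dom J u)"
      using n u by (auto simp: is_nattrans_def FG)
    then have "compose (el a (Dom J u)) (fn m (Cod J u)) (act a u) =
        compose (el a (Dom J u)) (act b u) (fn m (Dom J u))"
      using \<theta>[OF J.dom_obj[OF u]] \<theta>[OF J.cod_obj[OF u]]
        obj_structure(3)[OF ab(1) u] obj_structure(3)[OF ab(2) u] by (simp add: SetCat_cmp)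
    from fun_cong[OF this, of x] show ?thesis using x by (simp add: compose_eq)
  qed
  show "ty b h (fn m h x) = ty a h x" if h: "h \<in> Obj J" and x: "x \<in> el a h" for h x
  proof -
    have "fst (snd b) h \<cdot>\<^bsub>SetCat U\<^esub> \<theta> h = fst (snd a) h"
      using arg_cong[OF t, of "\<lambda>a. fst (snd a) h"] h by simp
    then have "compose (el a h) (ty b h) (fn m h) = ty a h"
      using \<theta>[OF h] obj_structure(5)[OF ab(1) h] obj_structure(5)[OF ab(2) h] by (simp add: SetCat_cmp)
    from fun_cong[OF this, of x] show ?thesis using x by (simp add: compose_eq)
  qed
qed

lemma fn_el: "m \<in> Hom TP a b \<Longrightarrow> h \<in> Obj J \<Longrightarrow> x \<in> el a h \<Longrightarrow> fn m h x \<in> el b h"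
  using hom_structure(3) by blast

lemma hom_eqI:
  assumes m: "m \<in> Hom TP a b" "m' \<in> Hom TP a b"
    and eq: "\<And>h x. h \<in> Obj J \<Longrightarrow> x \<in> el a h \<Longrightarrow> fn m h x = fn m' h x"
  shows "m = m'"
proof -
  have "fn m h = fn m' h" if "h \<in> Obj J" for h
    by (rule PiE_ext[OF hom_structure(3)[OF m(1) that] hom_structure(3)[OF m(2) that]]) (rule eq[OF that])
  then have "(\<lambda>h\<in>Obj J. (el a h, fn m h, el b h)) = (\<lambda>h\<in>Obj J. (el a h, fn m' h, el b h))"
    by (auto intro: restrict_ext)
  then show ?thesis using hom_structure(4)[OF m(1)] hom_structure(4)[OF m(2)] by simp
qed

lemma fn_cmp:
  assumes n: "n \<in> Hom TP a b" and m: "m \<in> Hom TP b c" and h: "h \<in> Obj J" and x: "x \<in> el a h"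
  shows "fn (m \<cdot>\<^bsub>TP\<^esub> n) h x = fn m h (fn n h x)"
proof -
  have "m \<cdot>\<^bsub>TP\<^esub> n = (a, (fst a, \<lambda>X\<in>Obj J. (el b X, fn m X, el c X) \<cdot>\<^bsub>SetCat U\<^esub> (el a X, fn n X, el b X), fst c), c)"
    by (subst hom_structure(4)[OF n], subst hom_structure(4)[OF m]) (simp add: TP_cmp cong: restrict_cong)
  then have "fn (m \<cdot>\<^bsub>TP\<^esub> n) h = compose (el a h) (fn m h) (fn n h)"
    using h by (simp add: fn_def SetCat_cmp)
  then show ?thesis using x by (simp add: compose_eq)
qed

lemma construct_hom:
  assumes a: "a \<in> Obj TP" and b: "b \<in> Obj TP"
    and el: "\<And>h x. h \<in> Obj J \<Longrightarrow> x \<in> el a h \<Longrightarrow> \<phi> h x \<in> el b h"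
    and nat: "\<And>u x. u \<in> Arr J \<Longrightarrow> x \<in> el a (Dom J u) \<Longrightarrow> \<phi> (Cod J u) (act a u x) = act b u (\<phi> (Dom J u) x)"
    and ty: "\<And>h x. h \<in> Obj J \<Longrightarrow> x \<in> el a h \<Longrightarrow> ty b h (\<phi> h x) = ty a h x"
  obtains m where "m \<in> Hom TP a b" "\<And>h x. h \<in> Obj J \<Longrightarrow> x \<in> el a h \<Longrightarrow> fn m h x = \<phi> h x"
proof -
  define \<theta> where "\<theta> = (\<lambda>h\<in>Obj J. (el a h, restrict (\<phi> h) (el a h), el b h))"
  have \<theta>: "\<theta> h = (el a h, restrict (\<phi> h) (el a h), el b h)" if "h \<in> Obj J" for h
    using that by (simp add: \<theta>_def)
  have nt: "is_nattrans J (SetCat U) (fst a, \<theta>, fst b)"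
    unfolding is_nattrans_def prod.case
  proof (intro conjI ballI)
    show "is_functor J (SetCat U) (fst a)" "is_functor J (SetCat U) (fst b)"
      by (rule obj_structure(1)[OF a] obj_structure(1)[OF b])+
    show "\<theta> \<in> extensional (Obj J)" by (simp add: \<theta>_def)
    show "\<theta> X \<in> Hom (SetCat U) (fst (fst a) X) (fst (fst b) X)" if "X \<in> Obj J" for X
      unfolding el_def[symmetric] SetCat_hom \<theta>[OF that]
      using that obj_structure(2)[OF a] obj_structure(2)[OF b] el by auto
    show "\<theta> (Cod J u) \<cdot>\<^bsub>SetCat U\<^esub> snd (fst a) u = snd (fst b) u \<cdot>\<^bsub>SetCat U\<^esub> \<theta> (Dom J u)" if u: "u \<in> Arr J" for u
      unfolding \<theta>[OF J.dom_obj[OF u]] \<theta>[OF J.cod_obj[OF u]] obj_structure(3)[OF a u] obj_structure(3)[OF b u] SetCat_cmp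
      using nat[OF u] act_el[OF a u] by (auto simp: compose_def intro: restrict_ext)
  qed
  have "(\<lambda>X\<in>Obj J. fst (snd b) X \<cdot>\<^bsub>SetCat U\<^esub> \<theta> X) = fst (snd a)"
  proof (rule extensionalityI[of _ "Obj J"])
    fix h assume h: "h \<in> Obj J"
    have "compose (el a h) (ty b h) (restrict (\<phi> h) (el a h)) = ty a h"
      by (rule extensionalityI[of _ "el a h"])
        (use obj_structure(6)[OF a h] ty[OF h] in \<open>auto simp: compose_eq PiE_def\<close>)
    then show "(\<lambda>X\<in>Obj J. fst (snd b) X \<cdot>\<^bsub>SetCat U\<^esub> \<theta> X) h = fst (snd a) h"
      using h \<theta>[OF h] obj_structure(5)[OF a h] obj_structure(5)[OF b h] by (simp add: SetCat_cmp)
  qed (use obj_structure(8)[OF a] in auto)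
  then have "(fst b, fst (snd b), S) \<cdot>\<^bsub>functor_cat J (SetCat U)\<^esub> (fst a, \<theta>, fst b) = (fst a, fst (snd a), S)"
    by (simp add: functor_cat_def)
  then have sl: "b \<cdot>\<^bsub>functor_cat J (SetCat U)\<^esub> (fst a, \<theta>, fst b) = a"
    by (simp only: obj_structure(7)[OF a, symmetric] obj_structure(7)[OF b, symmetric])
  have hom: "(a, (fst a, \<theta>, fst b), b) \<in> Hom TP a b"
    using a b nt sl by (cases a; cases b) (auto simp: slice_cat_def Hom_def functor_cat_def)
  show thesis
    by (rule that[OF hom]) (simp add: fn_def \<theta>)
qed

text \<open>With \<open>hom_structure\<close>, \<open>construct_hom\<close> and this lemma, the slice can be treated as a category of
  sets with an action and a typing, without reference to the encoding by tuples.\<close>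

lemma construct_obj_in_U:
  fixes Z :: "'j \<Rightarrow> 'u set" and \<alpha> :: "'k \<Rightarrow> 'u \<Rightarrow> 'u" and \<tau> :: "'j \<Rightarrow> 'u \<Rightarrow> 'u"
  assumes Z: "\<And>h. h \<in> Obj J \<Longrightarrow> Z h \<in> U"
    and \<alpha>: "\<And>u z. u \<in> Arr J \<Longrightarrow> z \<in> Z (Dom J u) \<Longrightarrow> \<alpha> u z \<in> Z (Cod J u)"
    and \<alpha>_ide: "\<And>h z. h \<in> Obj J \<Longrightarrow> z \<in> Z h \<Longrightarrow> \<alpha> (Ide J h) z = z"
    and \<alpha>_cmp: "\<And>u v z. u \<in> Arr J \<Longrightarrow> v \<in> Arr J \<Longrightarrow> Dom J v = Cod J u \<Longrightarrow> z \<in> Z (Dom J u) \<Longrightarrow>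
      \<alpha> (v \<cdot>\<^bsub>J\<^esub> u) z = \<alpha> v (\<alpha> u z)"
    and \<tau>: "\<And>h z. h \<in> Obj J \<Longrightarrow> z \<in> Z h \<Longrightarrow> \<tau> h z \<in> fst S h"
    and \<tau>_nat: "\<And>u z. u \<in> Arr J \<Longrightarrow> z \<in> Z (Dom J u) \<Longrightarrow> \<tau> (Cod J u) (\<alpha> u z) = sact u (\<tau> (Dom J u) z)"
  obtains a where "a \<in> Obj TP" "\<And>h. h \<in> Obj J \<Longrightarrow> el a h = Z h"
    "\<And>u z. u \<in> Arr J \<Longrightarrow> z \<in> Z (Dom J u) \<Longrightarrow> act a u z = \<alpha> u z"
    "\<And>h z. h \<in> Obj J \<Longrightarrow> z \<in> Z h \<Longrightarrow> ty a h z = \<tau> h z"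
proof -
  define F where "F = (\<lambda>h\<in>Obj J. Z h, \<lambda>u\<in>Arr J. (Z (Dom J u), restrict (\<alpha> u) (Z (Dom J u)), Z (Cod J u)))"
  define \<eta> where "\<eta> = (\<lambda>h\<in>Obj J. (Z h, restrict (\<tau> h) (Z h), fst S h))"
  have F0: "fst F h = Z h" if "h \<in> Obj J" for h using that by (simp add: F_def)
  have F1: "snd F u = (Z (Dom J u), restrict (\<alpha> u) (Z (Dom J u)), Z (Cod J u))" if "u \<in> Arr J" for u
    using that by (simp add: F_def)
  have \<eta>: "\<eta> h = (Z h, restrict (\<tau> h) (Z h), fst S h)" if "h \<in> Obj J" for h using that by (simp add: \<eta>_def)
  have SU: "fst S h \<in> U" if "h \<in> Obj J" for h
    using S that unfolding functor_SetCat_iff[OF J.category_axioms] by auto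
  have F: "is_functor J (SetCat U) F"
    unfolding functor_SetCat_iff[OF J.category_axioms]
  proof (intro conjI ballI impI)
    show "fst F \<in> Obj J \<rightarrow>\<^sub>E U" using Z by (auto simp: F_def)
    show "snd F \<in> extensional (Arr J)" by (simp add: F_def)
    show "snd F u \<in> Hom (SetCat U) (fst F (Dom J u)) (fst F (Cod J u))" if u: "u \<in> Arr J" for u
      unfolding SetCat_hom F1[OF u] F0[OF J.dom_obj[OF u]] F0[OF J.cod_obj[OF u]]
      using Z J.dom_obj[OF u] J.cod_obj[OF u] \<alpha>[OF u] by auto
    show "snd F (Ide J X) = Ide (SetCat U) (fst F X)" if X: "X \<in> Obj J" for X
      using X F1[of "Ide J X"] \<alpha>_ide[OF X] by (auto simp: F0 SetCat_ide intro: restrict_ext)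
    show "snd F (v \<cdot>\<^bsub>J\<^esub> u) = snd F v \<cdot>\<^bsub>SetCat U\<^esub> snd F u" if uv: "u \<in> Arr J" "v \<in> Arr J" "Dom J v = Cod J u" for u v
      using uv F1[of "v \<cdot>\<^bsub>J\<^esub> u"] \<alpha>_cmp[OF uv] \<alpha>[OF uv(1)]
      by (auto simp: F1 SetCat_cmp compose_def intro: restrict_ext)
  qed
  have N: "is_nattrans J (SetCat U) (F, \<eta>, S)"
    unfolding is_nattrans_def prod.case
  proof (intro conjI ballI)
    show "\<eta> \<in> extensional (Obj J)" by (simp add: \<eta>_def)
    show "\<eta> X \<in> Hom (SetCat U) (fst F X) (fst S X)" if X: "X \<in> Obj J" for X
      unfolding SetCat_hom \<eta>[OF X] F0[OF X] using X Z SU \<tau> by auto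
    show "\<eta> (Cod J u) \<cdot>\<^bsub>SetCat U\<^esub> snd F u = snd S u \<cdot>\<^bsub>SetCat U\<^esub> \<eta> (Dom J u)" if u: "u \<in> Arr J" for u
      unfolding \<eta>[OF J.dom_obj[OF u]] \<eta>[OF J.cod_obj[OF u]] F1[OF u] S_act[OF u] SetCat_cmp
      using \<tau>_nat[OF u] \<alpha>[OF u] by (auto simp: compose_def intro: restrict_ext)
  qed (use F S in auto)
  show thesis
  proof (rule that[of "(F, \<eta>, S)"])
    show "(F, \<eta>, S) \<in> Obj TP" using N by (simp add: obj_iff)
  qed (simp_all add: el_def act_def ty_def F0 F1 \<eta>)
qed

lemma small_encoding:
  assumes "\<exists>D\<in>U. Z \<lesssim> D"
  shows "\<exists>e :: 'z \<Rightarrow> 'u. inj_on e Z \<and> e ` Z \<in> U"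
proof -
  obtain D e where "D \<in> U" "inj_on e Z" "e ` Z \<subseteq> D" using assms unfolding lepoll_def by auto
  moreover from this have "e ` Z \<in> U"
    using U subset_imp_lepoll unfolding set_universe_def by blast
  ultimately show ?thesis by blast
qed

text \<open>Kernel pairs consist of pairs and gluings of tagged elements, neither of which lies in \<open>'u\<close>.
  Each set \<open>Z h\<close> is therefore carried into the universe by an injection \<open>e h\<close> with inverse \<open>d h\<close>, and
  the rest of the structure is transported along it.\<close>

lemma construct_obj:
  fixes Z :: "'j \<Rightarrow> 'z set" and \<alpha> :: "'k \<Rightarrow> 'z \<Rightarrow> 'z" and \<tau> :: "'j \<Rightarrow> 'z \<Rightarrow> 'u"
  assumes Z: "\<And>h. h \<in> Obj J \<Longrightarrow> \<exists>D\<in>U. Z h \<lesssim> D"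
    and \<alpha>: "\<And>u z. u \<in> Arr J \<Longrightarrow> z \<in> Z (Dom J u) \<Longrightarrow> \<alpha> u z \<in> Z (Cod J u)"
    and \<alpha>_ide: "\<And>h z. h \<in> Obj J \<Longrightarrow> z \<in> Z h \<Longrightarrow> \<alpha> (Ide J h) z = z"
    and \<alpha>_cmp: "\<And>u v z. u \<in> Arr J \<Longrightarrow> v \<in> Arr J \<Longrightarrow> Dom J v = Cod J u \<Longrightarrow> z \<in> Z (Dom J u) \<Longrightarrow>
      \<alpha> (v \<cdot>\<^bsub>J\<^esub> u) z = \<alpha> v (\<alpha> u z)"
    and \<tau>: "\<And>h z. h \<in> Obj J \<Longrightarrow> z \<in> Z h \<Longrightarrow> \<tau> h z \<in> fst S h"
    and \<tau>_nat: "\<And>u z. u \<in> Arr J \<Longrightarrow> z \<in> Z (Dom J u) \<Longrightarrow> \<tau> (Cod J u) (\<alpha> u z) = sact u (\<tau> (Dom J u) z)"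
  obtains a e d where "a \<in> Obj TP"
    "\<And>h z. h \<in> Obj J \<Longrightarrow> z \<in> Z h \<Longrightarrow> e h z \<in> el a h"
    "\<And>h z. h \<in> Obj J \<Longrightarrow> z \<in> Z h \<Longrightarrow> d h (e h z) = z"
    "\<And>h x. h \<in> Obj J \<Longrightarrow> x \<in> el a h \<Longrightarrow> d h x \<in> Z h"
    "\<And>u z. u \<in> Arr J \<Longrightarrow> z \<in> Z (Dom J u) \<Longrightarrow> act a u (e (Dom J u) z) = e (Cod J u) (\<alpha> u z)"
    "\<And>u x. u \<in> Arr J \<Longrightarrow> x \<in> el a (Dom J u) \<Longrightarrow> d (Cod J u) (act a u x) = \<alpha> u (d (Dom J u) x)"
    "\<And>h z. h \<in> Obj J \<Longrightarrow> z \<in> Z h \<Longrightarrow> ty a h (e h z) = \<tau> h z"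
    "\<And>h x. h \<in> Obj J \<Longrightarrow> x \<in> el a h \<Longrightarrow> \<tau> h (d h x) = ty a h x"
proof -
  have "\<exists>e. \<forall>h\<in>Obj J. inj_on (e h :: 'z \<Rightarrow> 'u) (Z h) \<and> e h ` Z h \<in> U"
    by (rule bchoice) (use small_encoding[OF Z] in blast)
  then obtain e :: "'j \<Rightarrow> 'z \<Rightarrow> 'u"
    where e: "\<And>h. h \<in> Obj J \<Longrightarrow> inj_on (e h) (Z h)" "\<And>h. h \<in> Obj J \<Longrightarrow> e h ` Z h \<in> U"
    by blast
  define d where "d h = inv_into (Z h) (e h)" for h
  have de: "d h (e h z) = z" if "h \<in> Obj J" "z \<in> Z h" for h z
    using e(1) that by (simp add: d_def)
  have ed: "e h (d h x) = x" "d h x \<in> Z h" if "x \<in> e h ` Z h" for h x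
    using that by (auto simp: d_def f_inv_into_f intro: inv_into_into)
  note J1 = J.dom_obj J.cod_obj
  obtain a where a: "a \<in> Obj TP" and el: "\<And>h. h \<in> Obj J \<Longrightarrow> el a h = e h ` Z h"
    and act: "\<And>u x. u \<in> Arr J \<Longrightarrow> x \<in> e (Dom J u) ` Z (Dom J u) \<Longrightarrow> act a u x = e (Cod J u) (\<alpha> u (d (Dom J u) x))"
    and ty: "\<And>h x. h \<in> Obj J \<Longrightarrow> x \<in> e h ` Z h \<Longrightarrow> ty a h x = \<tau> h (d h x)"
  proof (rule construct_obj_in_U[of "\<lambda>h. e h ` Z h" "\<lambda>u x. e (Cod J u) (\<alpha> u (d (Dom J u) x))" "\<lambda>h x. \<tau> h (d h x)"])
    fix u v x assume uv: "u \<in> Arr J" "v \<in> Arr J" "Dom J v = Cod J u" and "x \<in> e (Dom J u) ` Z (Dom J u)"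
    then obtain z where z: "z \<in> Z (Dom J u)" "x = e (Dom J u) z" by blast
    have "d (Cod J u) (e (Cod J u) (\<alpha> u z)) = \<alpha> u z" using de J1 uv \<alpha> z by blast
    then show "e (Cod J (v \<cdot>\<^bsub>J\<^esub> u)) (\<alpha> (v \<cdot>\<^bsub>J\<^esub> u) (d (Dom J (v \<cdot>\<^bsub>J\<^esub> u)) x)) =
        e (Cod J v) (\<alpha> v (d (Dom J v) (e (Cod J u) (\<alpha> u (d (Dom J u) x)))))"
      using uv z \<alpha>_cmp[OF uv z(1)] de[OF J1(1) z(1)] by simp
  qed (use e de J1 \<alpha> \<alpha>_ide \<tau> \<tau>_nat in auto)
  show thesis
    by (rule that[of a e d]) (use a el act ty de ed \<alpha> J1 in \<open>auto\<close>)
qed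

end

section \<open>Pushouts of monomorphisms of typed presheaves\<close>

context typed_presheaves begin

lemma category_TP: "category TP"
  by (intro category_slice_cat category_functor_cat category_SetCat J.category_axioms)

interpretation TP: category TP by (rule category_TP)

lemma injective_mono:
  assumes m: "m \<in> Hom TP a b" and inj: "\<And>h. h \<in> Obj J \<Longrightarrow> inj_on (fn m h) (el a h)"
  shows "mono_arr TP m"
proof (rule TP.mono_arrI)
  show "m \<in> Arr TP" using m by (simp add: Hom_def)
  have d: "Dom TP m = a" using m by (simp add: Hom_def)
  fix g g' assume g: "g \<in> Arr TP" "g' \<in> Arr TP" "Cod TP g = Dom TP m" "Cod TP g' = Dom TP m"
    "Dom TP g = Dom TP g'" "m \<cdot>\<^bsub>TP\<^esub> g = m \<cdot>\<^bsub>TP\<^esub> g'"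
  define w where "w = Dom TP g'"
  have gh: "g \<in> Hom TP w a" "g' \<in> Hom TP w a" using g d by (auto simp: Hom_def w_def)
  show "g = g'"
  proof (rule hom_eqI[OF gh])
    fix h x assume h: "h \<in> Obj J" and x: "x \<in> el w h"
    have "fn m h (fn g h x) = fn m h (fn g' h x)"
      using fn_cmp[OF gh(1) m h x] fn_cmp[OF gh(2) m h x] g(6) by simp
    then show "fn g h x = fn g' h x"
      using inj_onD[OF inj[OF h]] fn_el[OF gh(1) h x] fn_el[OF gh(2) h x] by blast
  qed
qed

text \<open>The pairs of elements that \<open>m\<close> identifies form a typed presheaf, the kernel pair of \<open>m\<close>.  Its two
  projections become equal after \<open>m\<close>, so they are equal if \<open>m\<close> is monic.\<close>

lemma mono_injective:
  assumes m: "m \<in> Hom TP a b" and mono: "mono_arr TP m" and h: "h \<in> Obj J"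
  shows "inj_on (fn m h) (el a h)"
proof (rule inj_onI)
  fix x y assume xy: "x \<in> el a h" "y \<in> el a h" "fn m h x = fn m h y"
  note a = hom_structure(1)[OF m] and J1 = J.dom_obj J.cod_obj
  define Z where "Z h = {z \<in> el a h \<times> el a h. fn m h (fst z) = fn m h (snd z)}" for h
  obtain k e d where k: "k \<in> Obj TP"
    and e: "\<And>h z. h \<in> Obj J \<Longrightarrow> z \<in> Z h \<Longrightarrow> e h z \<in> el k h"
    "\<And>h z. h \<in> Obj J \<Longrightarrow> z \<in> Z h \<Longrightarrow> d h (e h z) = z"
    and d: "\<And>h x. h \<in> Obj J \<Longrightarrow> x \<in> el k h \<Longrightarrow> d h x \<in> Z h"
    "\<And>u x. u \<in> Arr J \<Longrightarrow> x \<in> el k (Dom J u) \<Longrightarrow>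
       d (Cod J u) (act k u x) = map_prod (act a u) (act a u) (d (Dom J u) x)"
    "\<And>h x. h \<in> Obj J \<Longrightarrow> x \<in> el k h \<Longrightarrow> ty a h (fst (d h x)) = ty k h x"
  proof (rule construct_obj[of Z "\<lambda>u. map_prod (act a u) (act a u)" "\<lambda>h z. ty a h (fst z)"])
    fix h assume h: "h \<in> Obj J"
    have "\<exists>D\<in>U. el a h \<times> el a h \<lesssim> D"
      using U obj_structure(2)[OF a h] unfolding set_universe_def by blast
    moreover have "Z h \<lesssim> el a h \<times> el a h" by (rule subset_imp_lepoll) (auto simp: Z_def)
    ultimately show "\<exists>D\<in>U. Z h \<lesssim> D" using lepoll_trans by blast
  next
    fix u z assume u: "u \<in> Arr J" and z: "z \<in> Z (Dom J u)"
    then have zz: "fst z \<in> el a (Dom J u)" "snd z \<in> el a (Dom J u)" "fn m (Dom J u) (fst z) = fn m (Dom J u) (snd z)"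
      by (auto simp: Z_def)
    then show "map_prod (act a u) (act a u) z \<in> Z (Cod J u)"
      using u act_el[OF a u] hom_structure(5)[OF m u] by (simp add: Z_def mem_Times_iff)
    show "ty a (Cod J u) (fst (map_prod (act a u) (act a u) z)) = sact u (ty a (Dom J u) (fst z))"
      using ty_act[OF a u zz(1)] by simp
  qed ((rule that; assumption) | (auto simp: Z_def act_ide[OF a] act_cmp[OF a] ty_el[OF a])[1])+
  have dZ: "fst (d h x) \<in> el a h" "snd (d h x) \<in> el a h" "fn m h (fst (d h x)) = fn m h (snd (d h x))"
    if "h \<in> Obj J" "x \<in> el k h" for h x
    using d(1)[OF that] by (auto simp: Z_def)
  have ty2: "ty a h (snd (d h x)) = ty k h x" if "h \<in> Obj J" "x \<in> el k h" for h x
    using dZ[OF that] hom_structure(6)[OF m that(1)] d(3)[OF that] by metis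
  obtain p where p: "p \<in> Hom TP k a" "\<And>h x. h \<in> Obj J \<Longrightarrow> x \<in> el k h \<Longrightarrow> fn p h x = fst (d h x)"
    by (rule construct_hom[OF k a, of "\<lambda>h x. fst (d h x)"]) (use dZ d J1 in auto)
  obtain q where q: "q \<in> Hom TP k a" "\<And>h x. h \<in> Obj J \<Longrightarrow> x \<in> el k h \<Longrightarrow> fn q h x = snd (d h x)"
    by (rule construct_hom[OF k a, of "\<lambda>h x. snd (d h x)"]) (use dZ d ty2 J1 in auto)
  have "m \<cdot>\<^bsub>TP\<^esub> p = m \<cdot>\<^bsub>TP\<^esub> q"
    by (rule hom_eqI[OF TP.cmp_hom[OF p(1) m] TP.cmp_hom[OF q(1) m]])
      (simp add: fn_cmp[OF p(1) m] fn_cmp[OF q(1) m] p(2) q(2) dZ(3))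
  then have "p = q"
    using TP.mono_cancel[OF mono, of p q] p(1) q(1) m by (auto simp: Hom_def)
  moreover have z: "(x, y) \<in> Z h" using xy by (simp add: Z_def)
  ultimately show "x = y" using p(2)[OF h e(1)[OF h z]] q(2)[OF h e(1)[OF h z]] e(2)[OF h z] by simp
qed

text \<open>The object \<open>z\<close> is the pushout in explicit form: the elements of \<open>b\<close> outside the image of \<open>f\<close>,
  together with all elements of \<open>c\<close>.  Only the properties listed matter below, and
  \<open>pushout_mono_transfer\<close> carries them over to any pushout.\<close>

lemma glue:
  assumes f: "f \<in> Hom TP a b" and g: "g \<in> Hom TP a c"
    and inj: "\<And>h. h \<in> Obj J \<Longrightarrow> inj_on (fn f h) (el a h)"
  obtains z x y where "x \<in> Hom TP b z" "y \<in> Hom TP c z" "x \<cdot>\<^bsub>TP\<^esub> f = y \<cdot>\<^bsub>TP\<^esub> g"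
    "\<And>h. h \<in> Obj J \<Longrightarrow> inj_on (fn y h) (el c h)"
    "\<And>h s t. h \<in> Obj J \<Longrightarrow> s \<in> el b h \<Longrightarrow> t \<in> el c h \<Longrightarrow> fn x h s = fn y h t \<Longrightarrow>
       \<exists>r\<in>el a h. fn f h r = s \<and> fn g h r = t"
proof -
  note a = hom_structure(1)[OF f] and b = hom_structure(2)[OF f] and c = hom_structure(2)[OF g]
    and J1 = J.dom_obj J.cod_obj
  \<comment> \<open>\<open>P\<close> is the arrow from \<open>b\<close> to the gluing: an element \<open>f r\<close> is sent to \<open>g r\<close>.\<close>
  define P where "P h s = (if s \<in> fn f h ` el a h then Inr (fn g h (inv_into (el a h) (fn f h) s)) else Inl s)"
    for h s
  define Z where "Z h = Inl ` (el b h - fn f h ` el a h) \<union> Inr ` el c h" for h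
  \<comment> \<open>The complement of the image of \<open>f\<close> is not closed under the action, so an element of it may have
    to be sent into \<open>c\<close> after \<open>u\<close> has acted.\<close>
  define \<alpha> where "\<alpha> u = case_sum (\<lambda>s. P (Cod J u) (act b u s)) (\<lambda>t. Inr (act c u t))" for u
  define \<tau> where "\<tau> h = case_sum (ty b h) (ty c h)" for h
  have Pf: "P h (fn f h r) = Inr (fn g h r)" if "h \<in> Obj J" "r \<in> el a h" for h r
    using that inj by (simp add: P_def)
  have P_cases: "(\<exists>r\<in>el a h. s = fn f h r \<and> P h s = Inr (fn g h r)) \<or> (s \<notin> fn f h ` el a h \<and> P h s = Inl s)"
    if "h \<in> Obj J" for h s
    using Pf[OF that] by (auto simp: P_def)
  have PZ: "P h s \<in> Z h" if "h \<in> Obj J" "s \<in> el b h" for h s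
    using P_cases[OF that(1), of s] that fn_el[OF g that(1)] by (auto simp: Z_def)
  have InrZ: "Inr t \<in> Z h" if "t \<in> el c h" for t h using that by (simp add: Z_def)
  have P_nat: "\<alpha> u (P (Dom J u) s) = P (Cod J u) (act b u s)" if u: "u \<in> Arr J" for u s
    using P_cases[OF J1(1)[OF u], of s]
  proof
    assume "\<exists>r\<in>el a (Dom J u). s = fn f (Dom J u) r \<and> P (Dom J u) s = Inr (fn g (Dom J u) r)"
    then obtain r where r: "r \<in> el a (Dom J u)" "s = fn f (Dom J u) r" "P (Dom J u) s = Inr (fn g (Dom J u) r)"
      by blast
    have "P (Cod J u) (act b u s) = P (Cod J u) (fn f (Cod J u) (act a u r))"
      using hom_structure(5)[OF f u r(1)] r(2) by simp
    also have "\<dots> = Inr (fn g (Cod J u) (act a u r))"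
      by (rule Pf[OF J1(2)[OF u] act_el[OF a u r(1)]])
    finally show ?thesis using r(3) hom_structure(5)[OF g u r(1)] by (simp add: \<alpha>_def)
  qed (simp add: \<alpha>_def)
  have P_ty: "\<tau> h (P h s) = ty b h s" if "h \<in> Obj J" for h s
    using P_cases[OF that, of s] hom_structure(6)[OF f that] hom_structure(6)[OF g that]
    by (auto simp: \<tau>_def)
  obtain z e d where z: "z \<in> Obj TP"
    and e: "\<And>h v. h \<in> Obj J \<Longrightarrow> v \<in> Z h \<Longrightarrow> e h v \<in> el z h"
    "\<And>h v. h \<in> Obj J \<Longrightarrow> v \<in> Z h \<Longrightarrow> d h (e h v) = v"
    "\<And>u v. u \<in> Arr J \<Longrightarrow> v \<in> Z (Dom J u) \<Longrightarrow> act z u (e (Dom J u) v) = e (Cod J u) (\<alpha> u v)"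
    "\<And>h v. h \<in> Obj J \<Longrightarrow> v \<in> Z h \<Longrightarrow> ty z h (e h v) = \<tau> h v"
  proof (rule construct_obj[of Z \<alpha> \<tau>])
    fix h assume h: "h \<in> Obj J"
    have "\<exists>D\<in>U. el b h <+> el c h \<lesssim> D"
      using U obj_structure(2)[OF b h] obj_structure(2)[OF c h] unfolding set_universe_def by blast
    moreover have "Z h \<lesssim> el b h <+> el c h" by (rule subset_imp_lepoll) (auto simp: Z_def)
    ultimately show "\<exists>D\<in>U. Z h \<lesssim> D" using lepoll_trans by blast
  next
    fix u v assume u: "u \<in> Arr J" and v: "v \<in> Z (Dom J u)"
    from v consider s where "s \<in> el b (Dom J u)" "v = Inl s" | t where "t \<in> el c (Dom J u)" "v = Inr t"
      unfolding Z_def by blast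
    then show "\<alpha> u v \<in> Z (Cod J u)"
    proof cases
      case 1 then show ?thesis using PZ[OF J1(2)[OF u] act_el[OF b u]] by (simp add: \<alpha>_def)
    next
      case 2 then show ?thesis using InrZ[OF act_el[OF c u]] by (simp add: \<alpha>_def)
    qed
    show "\<tau> (Cod J u) (\<alpha> u v) = sact u (\<tau> (Dom J u) v)"
      using v P_ty[OF J1(2)[OF u]] ty_act[OF b u] ty_act[OF c u] by (auto simp: Z_def \<alpha>_def \<tau>_def)
  next
    fix h v assume h: "h \<in> Obj J" and v: "v \<in> Z h"
    then show "\<alpha> (Ide J h) v = v"
      using act_ide[OF b h] act_ide[OF c h] by (auto simp: Z_def \<alpha>_def P_def)
    show "\<tau> h v \<in> fst S h" using v ty_el[OF b h] ty_el[OF c h] by (auto simp: Z_def \<tau>_def)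
  next
    fix u w v assume uw: "u \<in> Arr J" "w \<in> Arr J" "Dom J w = Cod J u" and v: "v \<in> Z (Dom J u)"
    show "\<alpha> (w \<cdot>\<^bsub>J\<^esub> u) v = \<alpha> w (\<alpha> u v)"
    proof (cases v)
      case (Inl s)
      then have s: "s \<in> el b (Dom J u)" using v by (auto simp: Z_def)
      have "\<alpha> w (\<alpha> u v) = P (Cod J w) (act b w (act b u s))"
        using P_nat[OF uw(2), of "act b u s"] uw Inl by (simp add: \<alpha>_def)
      then show ?thesis using Inl act_cmp[OF b uw s] uw by (simp add: \<alpha>_def)
    next
      case (Inr t)
      then have "t \<in> el c (Dom J u)" using v by (auto simp: Z_def)
      then show ?thesis using Inr act_cmp[OF c uw] by (simp add: \<alpha>_def)
    qed
  qed (rule that; assumption)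
  obtain x where x: "x \<in> Hom TP b z" "\<And>h s. h \<in> Obj J \<Longrightarrow> s \<in> el b h \<Longrightarrow> fn x h s = e h (P h s)"
    by (rule construct_hom[OF b z, of "\<lambda>h s. e h (P h s)"]) (use e PZ P_nat P_ty J1 in auto)
  have \<alpha>r: "\<alpha> u (Inr t) = Inr (act c u t)" "\<tau> h (Inr t) = ty c h t" for u t h
    by (simp_all add: \<alpha>_def \<tau>_def)
  obtain y where y: "y \<in> Hom TP c z" "\<And>h t. h \<in> Obj J \<Longrightarrow> t \<in> el c h \<Longrightarrow> fn y h t = e h (Inr t)"
    by (rule construct_hom[OF c z, of "\<lambda>h t. e h (Inr t)"]) (use e InrZ \<alpha>r J1 in auto)
  have "x \<cdot>\<^bsub>TP\<^esub> f = y \<cdot>\<^bsub>TP\<^esub> g"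
    by (rule hom_eqI[OF TP.cmp_hom[OF f x(1)] TP.cmp_hom[OF g y(1)]])
      (simp add: fn_cmp[OF f x(1)] fn_cmp[OF g y(1)] x(2) y(2) Pf fn_el[OF f] fn_el[OF g])
  moreover have "inj_on (fn y h) (el c h)" if h: "h \<in> Obj J" for h
    using e(2)[OF h InrZ] y(2)[OF h] by (auto simp: inj_on_def) (metis sum.inject(2))
  moreover have "\<exists>r\<in>el a h. fn f h r = s \<and> fn g h r = t"
    if h: "h \<in> Obj J" and st: "s \<in> el b h" "t \<in> el c h" "fn x h s = fn y h t" for h s t
  proof -
    have "d h (e h (P h s)) = d h (e h (Inr t))" using st x(2)[OF h st(1)] y(2)[OF h st(2)] by simp
    then have "P h s = Inr t" using e(2)[OF h PZ[OF h st(1)]] e(2)[OF h InrZ[OF st(2)]] by simp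
    then show ?thesis using P_cases[OF h, of s] by auto
  qed
  ultimately show thesis using that x(1) y(1) by blast
qed

text \<open>Pullbacks are computed on elements: where \<open>x s = y t\<close> there is an \<open>r\<close> over \<open>s\<close> and \<open>t\<close>, which is
  unique since \<open>f\<close> is injective.  Injectivity also makes the choice of \<open>r\<close> natural.\<close>

lemma elementwise_pullback:
  assumes f: "f \<in> Hom TP a b" and g: "g \<in> Hom TP a c" and x: "x \<in> Hom TP b z" and y: "y \<in> Hom TP c z"
    and eq: "x \<cdot>\<^bsub>TP\<^esub> f = y \<cdot>\<^bsub>TP\<^esub> g"
    and inj: "\<And>h. h \<in> Obj J \<Longrightarrow> inj_on (fn f h) (el a h)"
    and ex: "\<And>h s t. h \<in> Obj J \<Longrightarrow> s \<in> el b h \<Longrightarrow> t \<in> el c h \<Longrightarrow> fn x h s = fn y h t \<Longrightarrow>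
       \<exists>r\<in>el a h. fn f h r = s \<and> fn g h r = t"
  shows "is_pullback TP x y f g"
  unfolding is_pullback_def
proof (intro conjI allI ballI impI)
  note a = hom_structure(1)[OF f] and J1 = J.dom_obj J.cod_obj
  have ends: "Dom TP f = a" "Dom TP x = b" "Dom TP y = c" using f x y by (auto simp: Hom_def)
  fix w p q assume "p \<in> Hom TP w (Dom TP x)" "q \<in> Hom TP w (Dom TP y)" and pq: "x \<cdot>\<^bsub>TP\<^esub> p = y \<cdot>\<^bsub>TP\<^esub> q"
  then have p: "p \<in> Hom TP w b" and q: "q \<in> Hom TP w c" by (simp_all add: ends)
  note w = hom_structure(1)[OF p]
  define \<rho> where "\<rho> h v = inv_into (el a h) (fn f h) (fn p h v)" for h v
  have \<rho>: "\<rho> h v \<in> el a h \<and> fn f h (\<rho> h v) = fn p h v \<and> fn g h (\<rho> h v) = fn q h v" if h: "h \<in> Obj J" and v: "v \<in> el w h" for h v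
  proof -
    have "fn x h (fn p h v) = fn y h (fn q h v)"
      using fn_cmp[OF p x h v] fn_cmp[OF q y h v] pq by simp
    then obtain r where r: "r \<in> el a h" "fn f h r = fn p h v" "fn g h r = fn q h v"
      using ex[OF h fn_el[OF p h v] fn_el[OF q h v]] by blast
    have "\<rho> h v = r" unfolding \<rho>_def r(2)[symmetric] by (rule inv_into_f_f[OF inj[OF h] r(1)])
    then show ?thesis using r by simp
  qed
  obtain r where r: "r \<in> Hom TP w a" "\<And>h v. h \<in> Obj J \<Longrightarrow> v \<in> el w h \<Longrightarrow> fn r h v = \<rho> h v"
  proof (rule construct_hom[OF w a, of \<rho>])
    show "\<rho> h v \<in> el a h" if "h \<in> Obj J" "v \<in> el w h" for h v using \<rho>[OF that] by simp
    show "\<rho> (Cod J u) (act w u v) = act a u (\<rho> (Dom J u) v)" if u: "u \<in> Arr J" and v: "v \<in> el w (Dom J u)" for u v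
    proof (rule inj_onD[OF inj[OF J1(2)[OF u]]])
      note 1 = \<rho>[OF J1(1)[OF u] v] and 2 = \<rho>[OF J1(2)[OF u] act_el[OF w u v]]
      show "fn f (Cod J u) (\<rho> (Cod J u) (act w u v)) = fn f (Cod J u) (act a u (\<rho> (Dom J u) v))"
        using 1 2 hom_structure(5)[OF f u, of "\<rho> (Dom J u) v"] hom_structure(5)[OF p u v] by simp
      show "\<rho> (Cod J u) (act w u v) \<in> el a (Cod J u)" "act a u (\<rho> (Dom J u) v) \<in> el a (Cod J u)"
        using 1 2 act_el[OF a u] by auto
    qed
    show "ty a h (\<rho> h v) = ty w h v" if "h \<in> Obj J" "v \<in> el w h" for h v
      using hom_structure(6)[OF f that(1), of "\<rho> h v"] hom_structure(6)[OF p that] \<rho>[OF that] by simp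
  qed (rule that; assumption)
  have fr: "f \<cdot>\<^bsub>TP\<^esub> r = p"
    by (rule hom_eqI[OF TP.cmp_hom[OF r(1) f] p]) (simp add: fn_cmp[OF r(1) f] r(2) \<rho>)
  moreover have "g \<cdot>\<^bsub>TP\<^esub> r = q"
    by (rule hom_eqI[OF TP.cmp_hom[OF r(1) g] q]) (simp add: fn_cmp[OF r(1) g] r(2) \<rho>)
  moreover have "r' = r" if r': "r' \<in> Hom TP w a" "f \<cdot>\<^bsub>TP\<^esub> r' = p" for r'
    using TP.mono_cancel[OF injective_mono[OF f inj], of r' r] r' r(1) fr ends by (auto simp: Hom_def)
  ultimately show "\<exists>!r. r \<in> Hom TP w (Dom TP f) \<and> f \<cdot>\<^bsub>TP\<^esub> r = p \<and> g \<cdot>\<^bsub>TP\<^esub> r = q"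
    using r(1) unfolding ends by blast
qed (use f g x y eq in \<open>auto simp: Hom_def\<close>)

lemma pushout_of_mono:
  assumes P: "is_pushout TP f g p q" and mono: "mono_arr TP f"
  shows "mono_arr TP q" "is_pullback TP p q f g"
proof -
  note B = TP.pushout_simps[OF P]
  have f: "f \<in> Hom TP (Dom TP f) (Cod TP f)" and g: "g \<in> Hom TP (Dom TP f) (Cod TP g)"
    using B by (auto simp: Hom_def)
  note inj = mono_injective[OF f mono]
  obtain z x y where x: "x \<in> Hom TP (Cod TP f) z" and y: "y \<in> Hom TP (Cod TP g) z"
    and eq: "x \<cdot>\<^bsub>TP\<^esub> f = y \<cdot>\<^bsub>TP\<^esub> g"
    and iy: "\<And>h. h \<in> Obj J \<Longrightarrow> inj_on (fn y h) (el (Cod TP g) h)"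
    and ex: "\<And>h s t. h \<in> Obj J \<Longrightarrow> s \<in> el (Cod TP f) h \<Longrightarrow> t \<in> el (Cod TP g) h \<Longrightarrow> fn x h s = fn y h t \<Longrightarrow>
       \<exists>r\<in>el (Dom TP f) h. fn f h r = s \<and> fn g h r = t"
    by (rule glue[OF f g inj]) (assumption | rule that; assumption)+
  have X: "x \<in> Arr TP" "y \<in> Arr TP" "Dom TP x = Cod TP f" "Dom TP y = Cod TP g" "Cod TP x = Cod TP y"
    using x y by (auto simp: Hom_def)
  show "mono_arr TP q" "is_pullback TP p q f g"
    by (rule TP.pushout_mono_transfer[OF P X eq injective_mono[OF y iy] elementwise_pullback[OF f g x y eq inj ex]]; assumption)+
qed

end

section \<open>Locally thin bicategories\<close>

text \<open>The axioms that a bicategory has to satisfy if parallel 2-cells are equal and any 2-cell can be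
  reversed.  The primed facts are the typing axioms of \<open>bicategory\<close>.\<close>

locale thin_bicategory =
  fixes B :: "('o, 'm, 'c) bicat" (structure)
  assumes hom1_ob': "f \<in> Hom1 B a b \<Longrightarrow> a \<in> Ob B \<and> b \<in> Ob B"
    and hom1_unique': "f \<in> Hom1 B a b \<Longrightarrow> f \<in> Hom1 B a' b' \<Longrightarrow> a = a' \<and> b = b'"
    and hom2_parallel': "\<alpha> \<in> Hom2 B f g \<Longrightarrow> \<exists>a b. f \<in> Hom1 B a b \<and> g \<in> Hom1 B a b"
    and id1_hom': "a \<in> Ob B \<Longrightarrow> id1 B a \<in> Hom1 B a a"
    and comp1_hom': "f \<in> Hom1 B a b \<Longrightarrow> g \<in> Hom1 B b c \<Longrightarrow> g \<odot> f \<in> Hom1 B a c"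
    and id2_hom': "f \<in> Hom1 B a b \<Longrightarrow> id2 B f \<in> Hom2 B f f"
    and vcomp_hom': "\<alpha> \<in> Hom2 B f g \<Longrightarrow> \<beta> \<in> Hom2 B g h \<Longrightarrow> \<beta> \<bullet> \<alpha> \<in> Hom2 B f h"
    and hcomp_hom': "f \<in> Hom1 B a b \<Longrightarrow> g \<in> Hom1 B b c \<Longrightarrow> \<alpha> \<in> Hom2 B f f' \<Longrightarrow> \<beta> \<in> Hom2 B g g' \<Longrightarrow>
          \<beta> \<star> \<alpha> \<in> Hom2 B (g \<odot> f) (g' \<odot> f')"
    and assoc_hom: "f \<in> Hom1 B a b \<Longrightarrow> g \<in> Hom1 B b c \<Longrightarrow> h \<in> Hom1 B c d \<Longrightarrow>
          assoc B h g f \<in> Hom2 B ((h \<odot> g) \<odot> f) (h \<odot> (g \<odot> f))"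
    and lunit_hom: "f \<in> Hom1 B a b \<Longrightarrow> lunit B f \<in> Hom2 B (id1 B b \<odot> f) f"
    and runit_hom: "f \<in> Hom1 B a b \<Longrightarrow> runit B f \<in> Hom2 B (f \<odot> id1 B a) f"
    and hom2_sym: "\<alpha> \<in> Hom2 B f g \<Longrightarrow> \<exists>\<beta>. \<beta> \<in> Hom2 B g f"
    and thin: "\<alpha> \<in> Hom2 B f g \<Longrightarrow> \<beta> \<in> Hom2 B f g \<Longrightarrow> \<alpha> = \<beta>"
begin

lemma hom2_target: "\<alpha> \<in> Hom2 B f g \<Longrightarrow> f \<in> Hom1 B a b \<Longrightarrow> g \<in> Hom1 B a b"
  using hom1_unique' hom2_parallel' by blast

lemma iso2_thin: "\<alpha> \<in> Hom2 B f g \<Longrightarrow> iso2 B f g \<alpha>"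
  unfolding iso2_def by (meson hom2_parallel' hom2_sym id2_hom' thin vcomp_hom')

lemmas typing = id1_hom' comp1_hom' id2_hom' vcomp_hom' hcomp_hom' assoc_hom lunit_hom runit_hom

text \<open>Each law is an equation between two 2-cells with the same source and target.  Hence the proof only
  determines the type of both sides.\<close>

lemma bicategory: "bicategory B"
proof
  fix \<alpha> f g assume a: "\<alpha> \<in> Hom2 B f g"
  then obtain a b where "f \<in> Hom1 B a b" "g \<in> Hom1 B a b" using hom2_parallel' by blast
  with a show "\<alpha> \<bullet> id2 B f = \<alpha>" "id2 B g \<bullet> \<alpha> = \<alpha>" by (blast intro: thin typing)+
next
  fix \<alpha> f g \<beta> h \<gamma> k assume "\<alpha> \<in> Hom2 B f g" "\<beta> \<in> Hom2 B g h" "\<gamma> \<in> Hom2 B h k"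
  then show "(\<gamma> \<bullet> \<beta>) \<bullet> \<alpha> = \<gamma> \<bullet> (\<beta> \<bullet> \<alpha>)" by (blast intro: thin typing)
next
  fix f a b g c assume "f \<in> Hom1 B a b" "g \<in> Hom1 B b c"
  then show "id2 B g \<star> id2 B f = id2 B (g \<odot> f)" by (blast intro: thin typing)
next
  fix f a b g c \<alpha> f' \<alpha>' f'' \<beta> g' \<beta>' g''
  assume fg: "f \<in> Hom1 B a b" "g \<in> Hom1 B b c"
    and h: "\<alpha> \<in> Hom2 B f f'" "\<alpha>' \<in> Hom2 B f' f''" "\<beta> \<in> Hom2 B g g'" "\<beta>' \<in> Hom2 B g' g''"
  then have "f' \<in> Hom1 B a b" "g' \<in> Hom1 B b c" by (blast intro: hom2_target)+
  with fg h show "(\<beta>' \<bullet> \<beta>) \<star> (\<alpha>' \<bullet> \<alpha>) = (\<beta>' \<star> \<alpha>') \<bullet> (\<beta> \<star> \<alpha>)"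
    by (intro thin[of _ "g \<odot> f" "g'' \<odot> f''"]) (blast intro: typing)+
next
  fix f a b g c h d \<alpha> f' \<beta> g' \<gamma> h'
  assume fg: "f \<in> Hom1 B a b" "g \<in> Hom1 B b c" "h \<in> Hom1 B c d"
    and h: "\<alpha> \<in> Hom2 B f f'" "\<beta> \<in> Hom2 B g g'" "\<gamma> \<in> Hom2 B h h'"
  then have "f' \<in> Hom1 B a b" "g' \<in> Hom1 B b c" "h' \<in> Hom1 B c d" by (blast intro: hom2_target)+
  with fg h show "assoc B h' g' f' \<bullet> ((\<gamma> \<star> \<beta>) \<star> \<alpha>) = (\<gamma> \<star> (\<beta> \<star> \<alpha>)) \<bullet> assoc B h g f"
    by (intro thin[of _ "(h \<odot> g) \<odot> f" "h' \<odot> (g' \<odot> f')"]) (blast intro: typing)+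
next
  fix f a b \<alpha> f' assume f: "f \<in> Hom1 B a b" and h: "\<alpha> \<in> Hom2 B f f'"
  have g: "f' \<in> Hom1 B a b" and ab: "a \<in> Ob B" "b \<in> Ob B"
    using hom2_target[OF h f] hom1_ob'[OF f] by auto
  show "lunit B f' \<bullet> (id2 B (id1 B b) \<star> \<alpha>) = \<alpha> \<bullet> lunit B f"
    by (rule thin[of _ "id1 B b \<odot> f" f']) (use f g h ab in \<open>blast intro: typing\<close>)+
  show "runit B f' \<bullet> (\<alpha> \<star> id2 B (id1 B a)) = \<alpha> \<bullet> runit B f"
    by (rule thin[of _ "f \<odot> id1 B a" f']) (use f g h ab in \<open>blast intro: typing\<close>)+
next
  fix f a b g c h d k e
  assume "f \<in> Hom1 B a b" "g \<in> Hom1 B b c" "h \<in> Hom1 B c d" "k \<in> Hom1 B d e"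
  then show "assoc B k h (g \<odot> f) \<bullet> assoc B (k \<odot> h) g f =
      (id2 B k \<star> assoc B h g f) \<bullet> (assoc B k (h \<odot> g) f \<bullet> (assoc B k h g \<star> id2 B f))"
    by (intro thin[of _ "((k \<odot> h) \<odot> g) \<odot> f" "k \<odot> (h \<odot> (g \<odot> f))"]) (blast intro: typing)+
next
  fix f a b g c assume f: "f \<in> Hom1 B a b" and g: "g \<in> Hom1 B b c"
  have "b \<in> Ob B" using hom1_ob'[OF f] by simp
  with f g show "(id2 B g \<star> lunit B f) \<bullet> assoc B g (id1 B b) f = runit B g \<star> id2 B f"
    by (intro thin[of _ "(g \<odot> id1 B b) \<odot> f" "g \<odot> f"]) (blast intro: typing)+
qed (auto intro: typing iso2_thin dest: hom1_ob' hom1_unique' hom2_parallel')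

text \<open>The map on 1-cells is strict, so identities serve as structure isomorphisms.  Functoriality
  on 2-cells, naturality and coherence compare parallel 2-cells of a thin bicategory.\<close>

lemma pseudofunctor_into_thin:
  assumes A: "bicategory A"
    and ob: "\<And>a. a \<in> Ob A \<Longrightarrow> F0 a \<in> Ob B"
    and h1: "\<And>f a b. f \<in> Hom1 A a b \<Longrightarrow> F1 f \<in> Hom1 B (F0 a) (F0 b)"
    and id1: "\<And>a. a \<in> Ob A \<Longrightarrow> F1 (id1 A a) = id1 B (F0 a)"
    and comp1: "\<And>f g a b c. f \<in> Hom1 A a b \<Longrightarrow> g \<in> Hom1 A b c \<Longrightarrow> F1 (g \<odot>\<^bsub>A\<^esub> f) = F1 g \<odot> F1 f"
    and h2: "\<And>\<alpha> f g. \<alpha> \<in> Hom2 A f g \<Longrightarrow> F2 \<alpha> \<in> Hom2 B (F1 f) (F1 g)"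
  shows "pseudofunctor A B \<lparr>map0 = F0, map1 = F1, map2 = F2,
    cmpr = \<lambda>g f. id2 B (F1 g \<odot> F1 f), unitr = \<lambda>a. id2 B (id1 B (F0 a))\<rparr>"
proof -
  interpret A: bicategory A by (rule A)
  interpret bicategory B by (rule bicategory)
  have iso2_hom: "\<And>f g \<alpha>. iso2 A f g \<alpha> \<Longrightarrow> \<alpha> \<in> Hom2 A f g" by (simp add: iso2_def)
  note A_assoc = A.assoc_iso[THEN iso2_hom] and A_l = A.lunit_iso[THEN iso2_hom]
    and A_r = A.runit_iso[THEN iso2_hom]
  have t1: "id2 B (F1 g \<odot> F1 f) \<in> Hom2 B (F1 g \<odot> F1 f) (F1 g \<odot> F1 f)"
    if "f \<in> Hom1 A a b" "g \<in> Hom1 A b c" for f g a b c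
    using that by (blast intro: h1 typing)
  have t0: "id2 B (id1 B (F0 a)) \<in> Hom2 B (id1 B (F0 a)) (id1 B (F0 a))" if "a \<in> Ob A" for a
    using that by (blast intro: ob typing)
  have ti: "id2 B (F1 f) \<in> Hom2 B (F1 f) (F1 f)" if "f \<in> Hom1 A a b" for f a b
    using that by (blast intro: h1 typing)
  show ?thesis
  proof (unfold_locales, goal_cases)
    \<comment> \<open>The cases follow the axioms of \<open>pseudofunctor\<close>: 1-3 typing, 4 and 5 functoriality on 2-cells,
      6 and 8 structure isomorphisms, 7 naturality, 9-11 coherence.\<close>
    case (1 a) then show ?case by (simp add: ob)
  next
    case (2 f a b) then show ?case by (simp add: h1)
  next
    case (3 \<alpha> f g) then show ?case by (simp add: h2)
  next
    case (4 f a b)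
    then show ?case using h2[OF A.id2_hom[OF 4]] ti[OF 4] by (auto intro: thin)
  next
    case (5 \<alpha> f g \<beta> h)
    then show ?case using h2[OF A.vcomp_hom[OF 5]] vcomp_hom'[OF h2[OF 5(1)] h2[OF 5(2)]]
      by (auto intro: thin)
  next
    case (6 f a b g c)
    then show ?case using t1[OF 6] comp1[OF 6] by (auto intro: iso2_thin)
  next
    case (7 f a b g c \<alpha> f' \<beta> g')
    then obtain x y x' y' where "f \<in> Hom1 A x y" "f' \<in> Hom1 A x y" "g \<in> Hom1 A x' y'" "g' \<in> Hom1 A x' y'"
      using A.hom2_parallel by meson
    then have f': "f' \<in> Hom1 A a b" "g' \<in> Hom1 A b c"
      using 7 A.hom1_unique by blast+
    have p: "F2 (\<beta> \<star>\<^bsub>A\<^esub> \<alpha>) \<in> Hom2 B (F1 g \<odot> F1 f) (F1 g' \<odot> F1 f')"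
      using h2[OF A.hcomp_hom[OF 7]] comp1[OF 7(1,2)] comp1[OF f'] by simp
    have q: "F2 \<beta> \<star> F2 \<alpha> \<in> Hom2 B (F1 g \<odot> F1 f) (F1 g' \<odot> F1 f')"
      by (rule hcomp_hom'[OF h1[OF 7(1)] h1[OF 7(2)] h2[OF 7(3)] h2[OF 7(4)]])
    show ?case
      using vcomp_hom'[OF t1[OF 7(1,2)] p] vcomp_hom'[OF q t1[OF f']] by (auto intro: thin)
  next
    case (8 a)
    then show ?case using t0[OF 8] id1[OF 8] by (auto intro: iso2_thin)
  next
    case (9 f a b g c h d)
    have m: "F2 (assoc A h g f) \<in> Hom2 B ((F1 h \<odot> F1 g) \<odot> F1 f) (F1 h \<odot> (F1 g \<odot> F1 f))"
      using h2[OF A_assoc[OF 9]] 9 A.comp1_hom[OF 9(1,2)] A.comp1_hom[OF 9(2,3)]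
      by (simp add: comp1)
    have c: "F1 (g \<odot>\<^bsub>A\<^esub> f) = F1 g \<odot> F1 f" "F1 (h \<odot>\<^bsub>A\<^esub> g) = F1 h \<odot> F1 g"
      using 9 by (auto simp: comp1)
    note F = h1[OF 9(1)] h1[OF 9(2)] h1[OF 9(3)]
    have "F2 (assoc A h g f) \<bullet> (id2 B ((F1 h \<odot> F1 g) \<odot> F1 f) \<bullet> (id2 B (F1 h \<odot> F1 g) \<star> id2 B (F1 f)))
        = id2 B (F1 h \<odot> (F1 g \<odot> F1 f)) \<bullet> ((id2 B (F1 h) \<star> id2 B (F1 g \<odot> F1 f)) \<bullet>
            assoc B (F1 h) (F1 g) (F1 f))"
      by (rule thin[of _ "(F1 h \<odot> F1 g) \<odot> F1 f" "F1 h \<odot> (F1 g \<odot> F1 f)"])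
        (use F m in \<open>blast intro: typing\<close>)+
    then show ?case by (simp add: c)
  next
    case (10 f a b)
    have ab: "a \<in> Ob A" "b \<in> Ob A" using A.hom1_ob[OF 10] by auto
    have m: "F2 (lunit A f) \<in> Hom2 B (id1 B (F0 b) \<odot> F1 f) (F1 f)"
      using h2[OF A_l[OF 10]] comp1[OF 10 A.id1_hom[OF ab(2)]] id1[OF ab(2)] by simp
    show ?case using id1[OF ab(2)]
      by simp (rule thin[of _ "id1 B (F0 b) \<odot> F1 f" "F1 f"],
        (use h1[OF 10] ob[OF ab(2)] m in \<open>blast intro: typing\<close>)+)
  next
    case (11 f a b)
    have ab: "a \<in> Ob A" "b \<in> Ob A" using A.hom1_ob[OF 11] by auto
    have m: "F2 (runit A f) \<in> Hom2 B (F1 f \<odot> id1 B (F0 a)) (F1 f)"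
      using h2[OF A_r[OF 11]] comp1[OF A.id1_hom[OF ab(1)] 11] id1[OF ab(1)] by simp
    show ?case using id1[OF ab(1)]
      by simp (rule thin[of _ "F1 f \<odot> id1 B (F0 a)" "F1 f"],
        (use h1[OF 11] ob[OF ab(1)] m in \<open>blast intro: typing\<close>)+)
  qed
qed

end

section \<open>The free bicategory on a computad\<close>

inductive_cases One_typeE: "has_type1 X (One x) a b"
inductive_cases Gen_typeE: "has_type1 X (Gen x) a b"
inductive_cases Comp_typeE: "has_type1 X (Comp g f) a b"
inductive_cases G2_typeE: "atom_type X (G2 e) f g"
inductive_cases As_typeE: "atom_type X (As u t s) f g"
inductive_cases Lu_typeE: "atom_type X (Lu s) f g"
inductive_cases Ru_typeE: "atom_type X (Ru s) f g"
inductive_cases Pos_typeE: "has_type2 X (Pos x) f g"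
inductive_cases Inv_typeE: "has_type2 X (Inv x) f g"
inductive_cases Idn_typeE: "has_type2 X (Idn x) f g"
inductive_cases VC_typeE: "has_type2 X (VC t s) f g"
inductive_cases HC_typeE: "has_type2 X (HC t s) f g"

lemmas ty_one = has_type1.intros(1) and ty_comp = has_type1.intros(3)
lemmas ty_pos = has_type2.intros(1) and ty_idn = has_type2.intros(3)
  and ty_vc = has_type2.intros(4) and ty_hc = has_type2.intros(5)
lemmas ty_as = ty_pos[OF atom_type.intros(2)] and ty_lu = ty_pos[OF atom_type.intros(3)]
  and ty_ru = ty_pos[OF atom_type.intros(4)]

lemma type1_unique: "has_type1 X f a b \<Longrightarrow> has_type1 X f a' b' \<Longrightarrow> a' = a \<and> b' = b"
proof (induction f a b arbitrary: a' b' rule: has_type1.induct)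
  case (1 a)
  then show ?case by (auto elim: One_typeE)
next
  case (2 x)
  from 2(4) show ?case by (auto elim: Gen_typeE)
next
  case (3 f a b g c)
  from 3(5) obtain d where "has_type1 X f a' d" "has_type1 X g d b'" by (auto elim: Comp_typeE)
  with 3 show ?case by blast
qed

lemma type1_ob: "has_type1 X f a b \<Longrightarrow> a \<in> Gen0 X \<and> b \<in> Gen0 X"
  by (induction rule: has_type1.induct) auto

lemma ty_one_ends: "has_type1 X f a b \<Longrightarrow> has_type1 X (One a) a a" "has_type1 X f a b \<Longrightarrow> has_type1 X (One b) b b"
  by (auto intro: ty_one dest: type1_ob)

lemma atom_unique:
  assumes "atom_type X x f g" "atom_type X x f' g'"
  shows "f' = f \<and> g' = g"
proof (cases x)
  case (G2 e)
  with assms show ?thesis by (auto elim!: G2_typeE)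
next
  case (As u t s)
  with assms show ?thesis by (auto elim!: As_typeE)
next
  case (Lu s)
  with assms show ?thesis by (auto elim!: Lu_typeE dest: type1_unique)
next
  case (Ru s)
  with assms show ?thesis by (auto elim!: Ru_typeE dest: type1_unique)
qed

lemma atom_parallel: "atom_type X x f g \<Longrightarrow> \<exists>a b. has_type1 X f a b \<and> has_type1 X g a b"
  by (induction rule: atom_type.induct) (blast intro: has_type1.intros dest: type1_ob)+

lemma type2_unique: "has_type2 X t f g \<Longrightarrow> has_type2 X t f' g' \<Longrightarrow> f' = f \<and> g' = g"
proof (induction t f g arbitrary: f' g' rule: has_type2.induct)
  case (1 x f g)
  from 1(2) have "atom_type X x f' g'" by (rule Pos_typeE)
  with 1(1) show ?case by (rule atom_unique)
next
  case (2 x f g)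
  from 2(2) have "atom_type X x g' f'" by (rule Inv_typeE)
  with 2(1) show ?case using atom_unique by metis
next
  case (3 f a b)
  from 3(2) show ?case by (rule Idn_typeE) simp
next
  case (4 s f g t h)
  from 4(5) obtain k where "has_type2 X s f' k" "has_type2 X t k g'" by (rule VC_typeE)
  with 4 show ?case by blast
next
  case (5 f a b g c s f0 t g0)
  from 5(7) obtain f1 g1 f2 g2 where "f' = Comp g1 f1" "g' = Comp g2 f2"
    "has_type2 X s f1 f2" "has_type2 X t g1 g2" by (rule HC_typeE)
  with 5 show ?case by blast
qed

lemma type2_parallel: "has_type2 X t f g \<Longrightarrow> \<exists>a b. has_type1 X f a b \<and> has_type1 X g a b"
proof (induction rule: has_type2.induct)
  case (4 s f g t h)
  then show ?case by (metis type1_unique)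
next
  case (5 f a b g c s f' t g')
  then have "has_type1 X f' a b" "has_type1 X g' b c" by (metis type1_unique)+
  with 5 show ?case by (blast intro: has_type1.intros)
qed (blast dest: atom_parallel)+

lemma type2_target: "has_type2 X t f g \<Longrightarrow> has_type1 X f a b \<Longrightarrow> has_type1 X g a b"
  using type2_parallel type1_unique by metis

lemma type2_source: "has_type2 X t f g \<Longrightarrow> \<exists>a b. has_type1 X f a b"
  using type2_parallel by metis

text \<open>The congruence relates only terms of the same type.  Since types are unique, a class of terms has one
  source and one target.\<close>

lemma eq2_typed: "eq2 X s t \<Longrightarrow> \<exists>f g. has_type2 X s f g \<and> has_type2 X t f g"
proof (induction rule: eq2.induct)
  case (eq2_trans s t u)
  then show ?case by (metis type2_unique)
next
  case (eq2_VC s s' t t' f g)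
  from eq2_VC.hyps(3) obtain h where "has_type2 X s f h" "has_type2 X t h g" by (blast elim: VC_typeE)
  with eq2_VC have "has_type2 X s' f h" "has_type2 X t' h g" by (metis type2_unique)+
  with eq2_VC.hyps(3) show ?case by (blast intro: has_type2.intros)
next
  case (eq2_HC s s' t t' f g)
  from eq2_HC.hyps(3) obtain f0 a b g0 c f1 g1 where *: "f = Comp g0 f0" "g = Comp g1 f1"
    "has_type1 X f0 a b" "has_type1 X g0 b c" "has_type2 X s f0 f1" "has_type2 X t g0 g1"
    by (blast elim: HC_typeE)
  with eq2_HC have "has_type2 X s' f0 f1" "has_type2 X t' g0 g1" by (metis type2_unique)+
  with * eq2_HC.hyps(3) show ?case by (blast intro: has_type2.intros)
next
  case (eq2_inv_left x f g)
  then show ?case by (meson atom_parallel has_type2.intros)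
next
  case (eq2_inv_right x f g)
  then show ?case by (meson atom_parallel has_type2.intros)
next
  case (eq2_id_right t f g)
  then show ?case by (meson type2_parallel has_type2.intros)
next
  case (eq2_id_left t f g)
  then show ?case by (meson type2_parallel has_type2.intros)
next
  case (eq2_hid f a b g c)
  then show ?case by (meson has_type1.intros has_type2.intros)
next
  case (eq2_interchange f a b g c s f' s' f'' t g' t' g'')
  note h = eq2_interchange
  have f': "has_type1 X f' a b" and g': "has_type1 X g' b c"
    using type2_target h(1-3,5) by metis+
  show ?case
    using ty_hc[OF h(1,2) ty_vc[OF h(3,4)] ty_vc[OF h(5,6)]]
      ty_vc[OF ty_hc[OF h(1,2,3,5)] ty_hc[OF f' g' h(4,6)]] by blast
next
  case (eq2_assoc_natural f a b g c h d s f' t g' u h')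
  note p = eq2_assoc_natural
  have *: "has_type1 X f' a b" "has_type1 X g' b c" "has_type1 X h' c d"
    using type2_target p(1-6) by metis+
  show ?case
    using ty_vc[OF ty_hc[OF p(1) ty_comp[OF p(2,3)] p(4) ty_hc[OF p(2,3,5,6)]] ty_as[OF *]]
      ty_vc[OF ty_as[OF p(1-3)] ty_hc[OF ty_comp[OF p(1,2)] p(3) ty_hc[OF p(1,2,4,5)] p(6)]]
    by blast
next
  case (eq2_lunit_natural f a b s f')
  note h = eq2_lunit_natural
  have f': "has_type1 X f' a b" using type2_target h by metis
  have o: "has_type1 X (One b) b b" by (rule ty_one_ends(2)[OF h(1)])
  show ?case
    using ty_vc[OF ty_hc[OF h(1) o h(2) ty_idn[OF o]] ty_lu[OF f']] ty_vc[OF ty_lu[OF h(1)] h(2)] by blast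
next
  case (eq2_runit_natural f a b s f')
  note h = eq2_runit_natural
  have f': "has_type1 X f' a b" using type2_target h by metis
  have o: "has_type1 X (One a) a a" by (rule ty_one_ends(1)[OF h(1)])
  show ?case
    using ty_vc[OF ty_hc[OF o h(1) ty_idn[OF o] h(2)] ty_ru[OF f']] ty_vc[OF ty_ru[OF h(1)] h(2)] by blast
next
  case (eq2_pentagon f a b g c h d k e)
  note p = eq2_pentagon
  have "has_type2 X (VC (Pos (As k h (Comp g f))) (Pos (As (Comp k h) g f)))
      (Comp (Comp (Comp k h) g) f) (Comp k (Comp h (Comp g f)))"
    by (rule ty_vc[OF ty_as[OF p(1,2) ty_comp[OF p(3,4)]] ty_as[OF ty_comp[OF p(1,2)] p(3,4)]])
  moreover have "has_type2 X (VC (HC (Idn k) (Pos (As h g f)))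
        (VC (Pos (As k (Comp h g) f)) (HC (Pos (As k h g)) (Idn f))))
      (Comp (Comp (Comp k h) g) f) (Comp k (Comp h (Comp g f)))"
    by (rule ty_vc[OF ty_vc[OF
        ty_hc[OF p(1) ty_comp[OF p(2) ty_comp[OF p(3,4)]] ty_idn[OF p(1)] ty_as[OF p(2-4)]]
        ty_as[OF p(1) ty_comp[OF p(2,3)] p(4)]]
        ty_hc[OF ty_comp[OF p(1) ty_comp[OF p(2,3)]] p(4) ty_as[OF p(1-3)] ty_idn[OF p(4)]]])
  ultimately show ?case by blast
next
  case (eq2_triangle f a b g c)
  note h = eq2_triangle
  have o: "has_type1 X (One b) b b" by (rule ty_one_ends(2)[OF h(1)])
  show ?case
    using ty_vc[OF ty_as[OF h(1) o h(2)] ty_hc[OF ty_comp[OF h(1) o] h(2) ty_lu[OF h(1)] ty_idn[OF h(2)]]]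
      ty_hc[OF h(1) ty_comp[OF o h(2)] ty_idn[OF h(1)] ty_ru[OF h(2)]] by blast
next
  case (eq2_vassoc s f g t h u k)
  note p = eq2_vassoc
  show ?case using ty_vc[OF p(1) ty_vc[OF p(2,3)]] ty_vc[OF ty_vc[OF p(1,2)] p(3)] by blast
qed blast+

lemma eq2_has_type2: "eq2 X s t \<Longrightarrow> has_type2 X s f g \<Longrightarrow> has_type2 X t f g"
  using eq2_typed type2_unique by metis

lemma cls2_eqI: "eq2 X s t \<Longrightarrow> cls2 X s = cls2 X t"
  unfolding cls2_def by (blast intro: eq2_sym eq2_trans)

lemma cls2_self: "has_type2 X t f g \<Longrightarrow> t \<in> cls2 X t"
  unfolding cls2_def by (blast intro: eq2_refl)

lemma free_hom2E:
  assumes "\<alpha> \<in> Hom2 (free_bicat X) f g"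
  obtains t where "\<alpha> = cls2 X t" "has_type2 X t f g"
  using assms by (auto simp: free_bicat_def)

lemma free_hom2I: "has_type2 X t f g \<Longrightarrow> cls2 X t \<in> Hom2 (free_bicat X) f g"
  by (auto simp: free_bicat_def)

text \<open>On classes, the compositions of \<open>free_bicat\<close> are defined by ranging over all representatives.
  Because \<open>eq2\<close> is a congruence, one representative of each class is enough.\<close>

lemma free_vcomp:
  assumes "has_type2 X s f g" "has_type2 X t g h"
  shows "cls2 X t \<bullet>\<^bsub>free_bicat X\<^esub> cls2 X s = cls2 X (VC t s)"
proof -
  have "eq2 X (VC t s) (VC t' s')" if "eq2 X t t'" "eq2 X s s'" for t' s'
    using that assms by (blast intro: eq2_VC has_type2.intros)
  moreover have "eq2 X t t" "eq2 X s s" using assms by (blast intro: eq2_refl)+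
  ultimately show ?thesis
    unfolding free_bicat_def cls2_def by simp (blast intro: eq2_trans)
qed

lemma free_hcomp:
  assumes "has_type1 X f a b" "has_type1 X g b c" "has_type2 X s f f'" "has_type2 X t g g'"
  shows "cls2 X t \<star>\<^bsub>free_bicat X\<^esub> cls2 X s = cls2 X (HC t s)"
proof -
  have "eq2 X (HC t s) (HC t' s')" if "eq2 X t t'" "eq2 X s s'" for t' s'
    using that assms by (blast intro: eq2_HC has_type2.intros)
  moreover have "eq2 X t t" "eq2 X s s" using assms by (blast intro: eq2_refl)+
  ultimately show ?thesis
    unfolding free_bicat_def cls2_def by simp (blast intro: eq2_trans)
qed

lemma free_simps:
  "Ob (free_bicat X) = Gen0 X"
  "f \<in> Hom1 (free_bicat X) a b \<longleftrightarrow> has_type1 X f a b"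
  "id1 (free_bicat X) = One"
  "comp1 (free_bicat X) = Comp"
  "id2 (free_bicat X) f = cls2 X (Idn f)"
  "assoc (free_bicat X) h g f = cls2 X (Pos (As h g f))"
  "lunit (free_bicat X) f = cls2 X (Pos (Lu f))"
  "runit (free_bicat X) f = cls2 X (Pos (Ru f))"
  by (simp_all add: free_bicat_def)

lemma free_atom_iso2:
  assumes "atom_type X x f g"
  shows "iso2 (free_bicat X) f g (cls2 X (Pos x))"
proof -
  have t: "has_type2 X (Pos x) f g" "has_type2 X (Inv x) g f"
    using assms by (blast intro: has_type2.intros)+
  show ?thesis
    unfolding iso2_def
    using t free_vcomp[OF t] free_vcomp[OF t(2,1)] cls2_eqI[OF eq2_inv_left[OF assms]]
      cls2_eqI[OF eq2_inv_right[OF assms]]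
    by (auto simp: free_simps intro!: free_hom2I bexI[of _ "cls2 X (Inv x)"])
qed

text \<open>Each law of a bicategory is one of the generating rules of the congruence, read on classes.\<close>

lemma free_bicategory: "bicategory (free_bicat X)"
proof (unfold_locales, unfold free_simps, goal_cases)
  \<comment> \<open>The cases follow the axioms of \<open>bicategory\<close>: 1-7 typing, 8-10 vertical composition, 11-13
    horizontal composition, 14-19 associators and unitors, 20 pentagon, 21 triangle.\<close>
  case (1 f a b) then show ?case by (rule type1_ob)
next
  case (2 f a b a' b') then show ?case using type1_unique by metis
next
  case (3 \<alpha> f g) then show ?case by (auto elim!: free_hom2E dest: type2_parallel)
next
  case (4 a) then show ?case by (rule has_type1.intros)
next
  case (5 f a b g c) then show ?case by (rule has_type1.intros)
next
  case (6 f a b) then show ?case by (intro free_hom2I has_type2.intros)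
next
  case (7 \<alpha> f g \<beta> h)
  then show ?case by (auto elim!: free_hom2E simp: free_vcomp intro!: free_hom2I intro: has_type2.intros)
next
  case (8 \<alpha> f g)
  then obtain t where t: "\<alpha> = cls2 X t" "has_type2 X t f g" by (rule free_hom2E)
  then obtain a b where "has_type1 X f a b" using type2_source by metis
  then have "has_type2 X (Idn f) f f" by (rule has_type2.intros)
  with t show ?case by (simp add: free_vcomp cls2_eqI[OF eq2_id_right])
next
  case (9 \<alpha> f g)
  then obtain t where t: "\<alpha> = cls2 X t" "has_type2 X t f g" by (rule free_hom2E)
  then obtain a b where "has_type1 X g a b" using type2_parallel by metis
  then have "has_type2 X (Idn g) g g" by (rule has_type2.intros)
  with t show ?case by (simp add: free_vcomp cls2_eqI[OF eq2_id_left])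
next
  case (10 \<alpha> f g \<beta> h \<gamma> k)
  then obtain s t u where *: "\<alpha> = cls2 X s" "\<beta> = cls2 X t" "\<gamma> = cls2 X u"
    and t: "has_type2 X s f g" "has_type2 X t g h" "has_type2 X u h k"
    by (meson free_hom2E)
  have "has_type2 X (VC u t) g k" "has_type2 X (VC t s) f h" 
    by (fact ty_vc[OF t(2,3)] ty_vc[OF t(1,2)])+
  with * t show ?case by (simp add: free_vcomp cls2_eqI[OF eq2_vassoc])
next
  case (11 f a b g c \<alpha> f' \<beta> g')
  then show ?case
    by (auto elim!: free_hom2E simp: free_hcomp intro!: free_hom2I intro: has_type2.intros)
next
  case (12 f a b g c)
  then have "has_type2 X (Idn f) f f" "has_type2 X (Idn g) g g" by (blast intro: has_type2.intros)+
  with 12 show ?case by (simp add: free_hcomp cls2_eqI[OF eq2_hid])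
next
  case (13 f a b g c \<alpha> f' \<alpha>' f'' \<beta> g' \<beta>' g'')
  then obtain s s' t t' where *: "\<alpha> = cls2 X s" "\<alpha>' = cls2 X s'" "\<beta> = cls2 X t" "\<beta>' = cls2 X t'"
    and t: "has_type2 X s f f'" "has_type2 X s' f' f''" "has_type2 X t g g'" "has_type2 X t' g' g''"
    by (meson free_hom2E)
  have f': "has_type1 X f' a b" "has_type1 X g' b c" using t 13 type2_target by metis+
  have "has_type2 X (VC s' s) f f''" "has_type2 X (VC t' t) g g''"
    "has_type2 X (HC t s) (Comp g f) (Comp g' f')" "has_type2 X (HC t' s') (Comp g' f') (Comp g'' f'')"
    by (fact ty_vc[OF t(1,2)] ty_vc[OF t(3,4)] ty_hc[OF 13(1,2) t(1,3)] ty_hc[OF f' t(2,4)])+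
  with * t f' 13(1,2) show ?case
    by (simp add: free_vcomp free_hcomp[of X f a b g c] free_hcomp[of X f' a b g' c]
        cls2_eqI[OF eq2_interchange])
next
  case (14 f a b g c h d)
  then show ?case by (intro free_atom_iso2 atom_type.intros)
next
  case (15 f a b g c h d \<alpha> f' \<beta> g' \<gamma> h')
  then obtain s t u where *: "\<alpha> = cls2 X s" "\<beta> = cls2 X t" "\<gamma> = cls2 X u"
    and t: "has_type2 X s f f'" "has_type2 X t g g'" "has_type2 X u h h'"
    by (meson free_hom2E)
  have f': "has_type1 X f' a b" "has_type1 X g' b c" "has_type1 X h' c d"
    using t 15 type2_target by metis+
  have c: "has_type1 X (Comp g f) a c" "has_type1 X (Comp h g) b d"
    using 15 by (blast intro: has_type1.intros)+
  have c2: "has_type2 X (HC t s) (Comp g f) (Comp g' f')" "has_type2 X (HC u t) (Comp h g) (Comp h' g')"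
    by (fact ty_hc[OF 15(1,2) t(1,2)] ty_hc[OF 15(2,3) t(2,3)])+
  have c3: "has_type2 X (HC (HC u t) s) (Comp (Comp h g) f) (Comp (Comp h' g') f')"
    "has_type2 X (HC u (HC t s)) (Comp h (Comp g f)) (Comp h' (Comp g' f'))"
    "has_type2 X (Pos (As h g f)) (Comp (Comp h g) f) (Comp h (Comp g f))"
    "has_type2 X (Pos (As h' g' f')) (Comp (Comp h' g') f') (Comp h' (Comp g' f'))"
    by (fact ty_hc[OF 15(1) c(2) t(1) c2(2)] ty_hc[OF c(1) 15(3) c2(1) t(3)] ty_as[OF 15(1-3)] ty_as[OF f'])+
  have e: "eq2 X (VC (Pos (As h' g' f')) (HC (HC u t) s)) (VC (HC u (HC t s)) (Pos (As h g f)))"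
    using eq2_assoc_natural 15 t by metis
  show ?case
    unfolding * free_hcomp[OF 15(1,2) t(1,2)] free_hcomp[OF 15(2,3) t(2,3)]
      free_hcomp[OF 15(1) c(2) t(1) c2(2)] free_hcomp[OF c(1) 15(3) c2(1) t(3)]
      free_vcomp[OF c3(1,4)] free_vcomp[OF c3(3,2)]
    by (rule cls2_eqI[OF e])
next
  case (16 f a b)
  then show ?case by (intro free_atom_iso2 atom_type.intros)
next
  case (17 f a b \<alpha> f')
  then obtain s where *: "\<alpha> = cls2 X s" and t: "has_type2 X s f f'" by (meson free_hom2E)
  have f': "has_type1 X f' a b" using t 17 type2_target by metis
  have o: "has_type1 X (One b) b b" by (rule ty_one_ends[OF 17(1)])
  have i: "has_type2 X (Idn (One b)) (One b) (One b)" using o by (rule has_type2.intros)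
  have c: "has_type2 X (HC (Idn (One b)) s) (Comp (One b) f) (Comp (One b) f')"
    "has_type2 X (Pos (Lu f)) (Comp (One b) f) f" "has_type2 X (Pos (Lu f')) (Comp (One b) f') f'"
    by (fact ty_hc[OF 17(1) o t i] ty_lu[OF 17(1)] ty_lu[OF f'])+
  show ?case
    unfolding * free_hcomp[OF 17(1) o t i] free_vcomp[OF c(1,3)] free_vcomp[OF c(2) t]
    by (rule cls2_eqI[OF eq2_lunit_natural[OF 17(1) t]])
next
  case (18 f a b)
  then show ?case by (intro free_atom_iso2 atom_type.intros)
next
  case (19 f a b \<alpha> f')
  then obtain s where *: "\<alpha> = cls2 X s" and t: "has_type2 X s f f'" by (meson free_hom2E)
  have f': "has_type1 X f' a b" using t 19 type2_target by metis
  have o: "has_type1 X (One a) a a" by (rule ty_one_ends[OF 19(1)])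
  have i: "has_type2 X (Idn (One a)) (One a) (One a)" using o by (rule has_type2.intros)
  have c: "has_type2 X (HC s (Idn (One a))) (Comp f (One a)) (Comp f' (One a))"
    "has_type2 X (Pos (Ru f)) (Comp f (One a)) f" "has_type2 X (Pos (Ru f')) (Comp f' (One a)) f'"
    by (fact ty_hc[OF o 19(1) i t] ty_ru[OF 19(1)] ty_ru[OF f'])+
  show ?case
    unfolding * free_hcomp[OF o 19(1) i t] free_vcomp[OF c(1,3)] free_vcomp[OF c(2) t]
    by (rule cls2_eqI[OF eq2_runit_natural[OF 19(1) t]])
next
  case (20 f a b g c h d k e)
  have *: "has_type1 X (Comp g f) a c" "has_type1 X (Comp h g) b d" "has_type1 X (Comp k h) c e"
    "has_type1 X (Comp (Comp k h) g) b e" "has_type1 X (Comp h (Comp g f)) a d"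
    "has_type1 X (Comp (Comp h g) f) a d" "has_type1 X (Comp k (Comp h g)) b e"
    using 20 by (blast intro: has_type1.intros)+
  have i: "has_type2 X (Idn f) f f" "has_type2 X (Idn k) k k" using 20 by (blast intro: has_type2.intros)+
  have p: "has_type2 X (Pos (As h g f)) (Comp (Comp h g) f) (Comp h (Comp g f))"
    "has_type2 X (Pos (As k h g)) (Comp (Comp k h) g) (Comp k (Comp h g))"
    "has_type2 X (Pos (As k (Comp h g) f)) (Comp (Comp k (Comp h g)) f) (Comp k (Comp (Comp h g) f))"
    "has_type2 X (Pos (As (Comp k h) g f)) (Comp (Comp (Comp k h) g) f) (Comp (Comp k h) (Comp g f))"
    "has_type2 X (Pos (As k h (Comp g f))) (Comp (Comp k h) (Comp g f)) (Comp k (Comp h (Comp g f)))"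
    by (fact ty_as[OF 20(1-3)] ty_as[OF 20(2-4)] ty_as[OF 20(1) *(2) 20(4)] ty_as[OF 20(1,2) *(3)]
        ty_as[OF *(1) 20(3,4)])+
  have q: "has_type2 X (HC (Pos (As k h g)) (Idn f)) (Comp (Comp (Comp k h) g) f) (Comp (Comp k (Comp h g)) f)"
    "has_type2 X (HC (Idn k) (Pos (As h g f))) (Comp k (Comp (Comp h g) f)) (Comp k (Comp h (Comp g f)))"
    by (fact ty_hc[OF 20(1) *(4) i(1) p(2)] ty_hc[OF *(6) 20(4) p(1) i(2)])+
  have r: "has_type2 X (VC (Pos (As k (Comp h g) f)) (HC (Pos (As k h g)) (Idn f)))
    (Comp (Comp (Comp k h) g) f) (Comp k (Comp (Comp h g) f))"
    by (rule ty_vc[OF q(1) p(3)])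
  show ?case
    unfolding free_vcomp[OF p(4,5)] free_hcomp[OF 20(1) *(4) i(1) p(2)] free_vcomp[OF q(1) p(3)]
      free_hcomp[OF *(6) 20(4) p(1) i(2)] free_vcomp[OF r q(2)]
    by (rule cls2_eqI[OF eq2_pentagon[OF 20]])
next
  case (21 f a b g c)
  have o: "has_type1 X (One b) b b" by (rule ty_one_ends[OF 21(1)])
  have *: "has_type1 X (Comp g (One b)) b c" "has_type1 X (Comp (One b) f) a b"
    using 21 o by (blast intro: has_type1.intros)+
  have i: "has_type2 X (Idn f) f f" "has_type2 X (Idn g) g g" using 21 by (blast intro: has_type2.intros)+
  have p: "has_type2 X (Pos (Lu f)) (Comp (One b) f) f" "has_type2 X (Pos (Ru g)) (Comp g (One b)) g"
    "has_type2 X (Pos (As g (One b) f)) (Comp (Comp g (One b)) f) (Comp g (Comp (One b) f))"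
    by (fact ty_lu[OF 21(1)] ty_ru[OF 21(2)] ty_as[OF 21(1) o 21(2)])+
  have q: "has_type2 X (HC (Idn g) (Pos (Lu f))) (Comp g (Comp (One b) f)) (Comp g f)"
    by (rule ty_hc[OF *(2) 21(2) p(1) i(2)])
  show ?case
    unfolding free_hcomp[OF *(2) 21(2) p(1) i(2)] free_vcomp[OF p(3) q] free_hcomp[OF 21(1) *(1) i(1) p(2)]
    by (rule cls2_eqI[OF eq2_triangle[OF 21]])
qed

primrec extend1 :: "('p, 'n, 'd) bicat \<Rightarrow> ('o \<Rightarrow> 'p) \<Rightarrow> ('g \<Rightarrow> 'n) \<Rightarrow> ('o, 'g) tm1 \<Rightarrow> 'n" where
  "extend1 B F0 F1 (One a) = id1 B (F0 a)"
| "extend1 B F0 F1 (Gen x) = F1 x"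
| "extend1 B F0 F1 (Comp g f) = extend1 B F0 F1 g \<odot>\<^bsub>B\<^esub> extend1 B F0 F1 f"

text \<open>Over a thin target it is enough that the images of source and target of each generating 2-cell are
  connected by some 2-cell.  By induction on terms the same holds for every typed 2-cell term, and
  the resulting 2-cell depends on the type alone.  So it respects the congruence automatically.\<close>

theorem (in thin_bicategory) free_bicat_extension:
  assumes ob: "\<And>a. a \<in> Gen0 X \<Longrightarrow> F0 a \<in> Ob B"
    and g1: "\<And>x. x \<in> Gen1 X \<Longrightarrow> F1 x \<in> Hom1 B (F0 (src1 X x)) (F0 (trg1 X x))"
    and g2: "\<And>e. e \<in> Gen2 X \<Longrightarrow>
      Hom2 B (extend1 B F0 F1 (src2 X e)) (extend1 B F0 F1 (trg2 X e)) \<noteq> {}"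
  shows "\<exists>F. pseudofunctor (free_bicat X) B F \<and> map0 F = F0 \<and> map1 F = extend1 B F0 F1"
proof -
  let ?F = "extend1 B F0 F1"
  have h1: "?F f \<in> Hom1 B (F0 a) (F0 b)" if "has_type1 X f a b" for f a b
    using that
  proof (induction rule: has_type1.induct)
    case (1 a) then show ?case using id1_hom'[OF ob] by simp
  next
    case (2 x) then show ?case using g1 by simp
  next
    case (3 f a b g c) then show ?case using comp1_hom' by simp
  qed
  have at: "\<exists>\<beta>. \<beta> \<in> Hom2 B (?F f) (?F g)" if "atom_type X x f g" for x f g
    using that
  proof cases
    case 1 then show ?thesis using g2 by blast
  next
    case (2 f a b g c h d)
    then show ?thesis using assoc_hom[OF h1 h1 h1, OF 2(4-6)] by auto
  next
    case (3 a b)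
    then show ?thesis using lunit_hom[OF h1[OF 3(3)]] by auto
  next
    case (4 a b)
    then show ?thesis using runit_hom[OF h1[OF 4(3)]] by auto
  qed
  have h2: "\<exists>\<beta>. \<beta> \<in> Hom2 B (?F f) (?F g)" if "has_type2 X t f g" for t f g
    using that
  proof (induction rule: has_type2.induct)
    case (1 x f g) then show ?case by (rule at)
  next
    case (2 x f g) then show ?case using at hom2_sym by blast
  next
    case (3 f a b) then show ?case using h1 id2_hom' by blast
  next
    case (4 s f g t h) then show ?case using vcomp_hom' by blast
  next
    case (5 f a b g c s f' t g')
    then show ?case using hcomp_hom'[OF h1[OF 5(1)] h1[OF 5(2)]] unfolding extend1.simps by blast
  qed
  \<comment> \<open>A class determines its source and target; the type in the choice is therefore the expected one.\<close>
  define F2 where "F2 \<alpha> = (SOME \<beta>. \<exists>f g. \<alpha> \<in> Hom2 (free_bicat X) f g \<and> \<beta> \<in> Hom2 B (?F f) (?F g))" for \<alpha>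
  have F2: "F2 \<alpha> \<in> Hom2 B (?F f) (?F g)" if a: "\<alpha> \<in> Hom2 (free_bicat X) f g" for \<alpha> f g
  proof -
    obtain t where t: "\<alpha> = cls2 X t" "has_type2 X t f g" using a by (rule free_hom2E)
    have u: "f' = f \<and> g' = g" if "\<alpha> \<in> Hom2 (free_bicat X) f' g'" for f' g'
    proof -
      obtain t' where "\<alpha> = cls2 X t'" "has_type2 X t' f' g'"
        by (rule free_hom2E[OF \<open>\<alpha> \<in> Hom2 (free_bicat X) f' g'\<close>])
      moreover from this have "t' \<in> cls2 X t" using t cls2_self by metis
      ultimately show ?thesis using t eq2_has_type2 type2_unique unfolding cls2_def by blast
    qed
    have "\<exists>f g. \<alpha> \<in> Hom2 (free_bicat X) f g \<and> F2 \<alpha> \<in> Hom2 B (?F f) (?F g)"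
      unfolding F2_def by (rule someI_ex) (use a h2[OF t(2)] in blast)
    then show ?thesis using u by blast
  qed
  have "pseudofunctor (free_bicat X) B \<lparr>map0 = F0, map1 = ?F, map2 = F2,
    cmpr = \<lambda>g f. id2 B (?F g \<odot> ?F f), unitr = \<lambda>a. id2 B (id1 B (F0 a))\<rparr>"
    by (rule pseudofunctor_into_thin[OF free_bicategory]) (auto simp: free_simps ob h1 F2)
  then show ?thesis by force
qed

section \<open>The bicategory of spans with monic left leg\<close>

locale pullback_category = category +
  fixes pb :: "'a \<Rightarrow> 'a \<Rightarrow> 'a \<times> 'a"
  assumes pb: "chosen_pullbacks C pb"
begin

lemma span_simps:
  assumes "s \<in> par_spans C X Y"
  shows "mono_arr C (fst s)" "fst s \<in> Arr C" "snd s \<in> Arr C" "Dom C (fst s) = apex C s" "Dom C (snd s) = apex C s"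
    "Cod C (fst s) = X" "Cod C (snd s) = Y"
  using assms by (auto simp: par_spans_def apex_def)

text \<open>If \<open>\<phi>\<close> and \<open>\<psi>\<close> are opposite arrows between the apexes and commute with the left legs, then both
  composites become identities after a monic left leg, so they are identities.  Invertibility thus
  comes for free once such an arrow exists in each direction.\<close>

lemma span_isosI:
  assumes s: "s \<in> par_spans C X Y" and t: "t \<in> par_spans C X Y"
    and \<phi>: "\<phi> \<in> Hom C (apex C s) (apex C t)" "fst t \<cdot> \<phi> = fst s" "snd t \<cdot> \<phi> = snd s"
    and \<psi>: "\<psi> \<in> Hom C (apex C t) (apex C s)" "fst s \<cdot> \<psi> = fst t"
  shows "(s, \<phi>, t) \<in> span_isos C s t"
proof -
  note S = span_simps[OF s] and T = span_simps[OF t]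
  have o: "apex C s \<in> Obj C" "apex C t \<in> Obj C" using S T dom_obj by metis+
  have A: "\<phi> \<in> Arr C" "Dom C \<phi> = apex C s" "Cod C \<phi> = apex C t"
    "\<psi> \<in> Arr C" "Dom C \<psi> = apex C t" "Cod C \<psi> = apex C s" using \<phi> \<psi> by (auto simp: Hom_def)
  have "fst s \<cdot> (\<psi> \<cdot> \<phi>) = fst s \<cdot> Ide C (apex C s)"
    using A S T \<phi> \<psi> o by (simp flip: cmp_assoc)
  then have 1: "\<psi> \<cdot> \<phi> = Ide C (apex C s)"
    using mono_cancel[OF S(1)] A S o by simp
  have "fst t \<cdot> (\<phi> \<cdot> \<psi>) = fst t \<cdot> Ide C (apex C t)"
    using A S T \<phi> \<psi> o by (simp flip: cmp_assoc)
  then have 2: "\<phi> \<cdot> \<psi> = Ide C (apex C t)"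
    using mono_cancel[OF T(1)] A T o by simp
  show ?thesis
    using s t \<phi> \<psi> A 1 2 unfolding span_isos_def iso_arr_def by auto
qed

lemma span_isosE:
  assumes "\<alpha> \<in> span_isos C s t"
  obtains \<phi> \<psi> X Y where "\<alpha> = (s, \<phi>, t)" "s \<in> par_spans C X Y" "t \<in> par_spans C X Y"
    "\<phi> \<in> Hom C (apex C s) (apex C t)" "fst t \<cdot> \<phi> = fst s" "snd t \<cdot> \<phi> = snd s"
    "\<psi> \<in> Hom C (apex C t) (apex C s)" "fst s \<cdot> \<psi> = fst t" "snd s \<cdot> \<psi> = snd t"
proof -
  obtain \<phi> X Y where a: "\<alpha> = (s, \<phi>, t)" and s: "s \<in> par_spans C X Y" and t: "t \<in> par_spans C X Y"
    and \<phi>: "\<phi> \<in> Hom C (apex C s) (apex C t)" "fst t \<cdot> \<phi> = fst s" "snd t \<cdot> \<phi> = snd s" and i: "iso_arr C \<phi>"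
    using assms unfolding span_isos_def by auto
  note S = span_simps[OF s] and T = span_simps[OF t]
  have A: "\<phi> \<in> Arr C" "Dom C \<phi> = apex C s" "Cod C \<phi> = apex C t" using \<phi> by (auto simp: Hom_def)
  then obtain \<psi> where \<psi>: "\<psi> \<in> Hom C (apex C t) (apex C s)" "\<phi> \<cdot> \<psi> = Ide C (apex C t)"
    using i unfolding iso_arr_def by auto
  have B: "\<psi> \<in> Arr C" "Dom C \<psi> = apex C t" "Cod C \<psi> = apex C s" using \<psi> by (auto simp: Hom_def)
  have "fst s \<cdot> \<psi> = fst t \<cdot> (\<phi> \<cdot> \<psi>)" "snd s \<cdot> \<psi> = snd t \<cdot> (\<phi> \<cdot> \<psi>)"
    unfolding \<phi>(2,3)[symmetric] using A B S T by (simp_all add: cmp_assoc)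
  then have "fst s \<cdot> \<psi> = fst t" "snd s \<cdot> \<psi> = snd t" using \<psi>(2) T by simp_all
  with that a s t \<phi> \<psi> show thesis by blast
qed

lemma span_isos_unique:
  assumes "\<alpha> \<in> span_isos C s t" "\<beta> \<in> span_isos C s t"
  shows "\<alpha> = \<beta>"
proof -
  obtain \<phi> X Y \<phi>' where *: "\<alpha> = (s, \<phi>, t)" "\<beta> = (s, \<phi>', t)" "t \<in> par_spans C X Y"
    "\<phi> \<in> Hom C (apex C s) (apex C t)" "fst t \<cdot> \<phi> = fst s"
    "\<phi>' \<in> Hom C (apex C s) (apex C t)" "fst t \<cdot> \<phi>' = fst s"
    using assms unfolding span_isos_def by auto
  then have "\<phi> = \<phi>'"
    using mono_cancel[OF span_simps(1)[OF *(3)], of \<phi> \<phi>'] span_simps[OF *(3)] by (auto simp: Hom_def)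
  with * show ?thesis by simp
qed

lemma span_isos_sym: "\<alpha> \<in> span_isos C s t \<Longrightarrow> \<exists>\<beta>. \<beta> \<in> span_isos C t s"
  by (erule span_isosE) (blast intro: span_isosI)

lemma proj_pullback:
  assumes "s \<in> par_spans C X Y" "t \<in> par_spans C Y Z"
  shows "is_pullback C (snd s) (fst t) (proj1 pb t s) (proj2 pb t s)"
  using pb span_simps[OF assms(1)] span_simps[OF assms(2)]
  unfolding chosen_pullbacks_def proj1_def proj2_def by simp

lemma proj_simps:
  assumes s: "s \<in> par_spans C X Y" and t: "t \<in> par_spans C Y Z"
  shows "proj1 pb t s \<in> Arr C" "proj2 pb t s \<in> Arr C"
    "Dom C (proj1 pb t s) = apex C (span_comp C pb t s)"
    "Dom C (proj2 pb t s) = apex C (span_comp C pb t s)"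
    "Cod C (proj1 pb t s) = apex C s" "Cod C (proj2 pb t s) = apex C t"
    "snd s \<cdot> proj1 pb t s = fst t \<cdot> proj2 pb t s"
proof -
  note S = span_simps[OF s] and T = span_simps[OF t] and P = pullback_simps[OF proj_pullback[OF s t]]
  have "apex C (span_comp C pb t s) = Dom C (proj1 pb t s)"
    unfolding span_comp_def apex_def fst_conv by (rule cmp_simps(2)) (simp_all only: S P)
  then show "proj1 pb t s \<in> Arr C" "proj2 pb t s \<in> Arr C"
    "Dom C (proj1 pb t s) = apex C (span_comp C pb t s)"
    "Dom C (proj2 pb t s) = apex C (span_comp C pb t s)"
    "Cod C (proj1 pb t s) = apex C s" "Cod C (proj2 pb t s) = apex C t"
    "snd s \<cdot> proj1 pb t s = fst t \<cdot> proj2 pb t s"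
    by (simp_all only: S T P)
qed

lemma span_comp_hom:
  assumes s: "s \<in> par_spans C X Y" and t: "t \<in> par_spans C Y Z"
  shows "span_comp C pb t s \<in> par_spans C X Z"
proof -
  note S = span_simps[OF s] and T = span_simps[OF t] and P = proj_simps[OF s t]
  have "mono_arr C (proj1 pb t s)"
    by (rule pullback_mono[OF proj_pullback[OF s t]]) (rule T)
  then have "mono_arr C (fst s \<cdot> proj1 pb t s)" by (rule mono_cmp) (simp_all only: S P)
  moreover have "snd t \<cdot> proj2 pb t s \<in> Arr C"
    "Dom C (fst s \<cdot> proj1 pb t s) = Dom C (snd t \<cdot> proj2 pb t s)"
    "Cod C (fst s \<cdot> proj1 pb t s) = X" "Cod C (snd t \<cdot> proj2 pb t s) = Z"
    using S T P(1-6) by simp_all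
  ultimately show ?thesis by (simp add: span_comp_def par_spans_def)
qed

lemma span_comp_legs:
  "fst (span_comp C pb t s) = fst s \<cdot> proj1 pb t s" "snd (span_comp C pb t s) = snd t \<cdot> proj2 pb t s"
  by (simp_all add: span_comp_def)

text \<open>The universal property of the chosen pullback in terms of apexes and legs of the composite span.\<close>

lemma comp_pair:
  assumes s: "s \<in> par_spans C X Y" and t: "t \<in> par_spans C Y Z"
    and xy: "x \<in> Hom C W (apex C s)" "y \<in> Hom C W (apex C t)" "snd s \<cdot> x = fst t \<cdot> y"
  obtains w where "w \<in> Hom C W (apex C (span_comp C pb t s))"
    "proj1 pb t s \<cdot> w = x" "proj2 pb t s \<cdot> w = y"
    "fst (span_comp C pb t s) \<cdot> w = fst s \<cdot> x" "snd (span_comp C pb t s) \<cdot> w = snd t \<cdot> y"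
proof -
  note S = span_simps[OF s] and T = span_simps[OF t] and P = proj_simps[OF s t]
  have "\<exists>!w. w \<in> Hom C W (Dom C (proj1 pb t s)) \<and> proj1 pb t s \<cdot> w = x \<and> proj2 pb t s \<cdot> w = y"
    by (rule pullback_ex1[OF proj_pullback[OF s t]]) (simp_all only: S T xy)
  then obtain w where "w \<in> Hom C W (Dom C (proj1 pb t s))" and p: "proj1 pb t s \<cdot> w = x" "proj2 pb t s \<cdot> w = y"
    by blast
  then have w: "w \<in> Hom C W (apex C (span_comp C pb t s))" by (simp only: P)
  then have A: "w \<in> Arr C" "Cod C w = apex C (span_comp C pb t s)" by (auto simp: Hom_def)
  have "fst (span_comp C pb t s) \<cdot> w = fst s \<cdot> x"
    unfolding p(1)[symmetric] span_comp_legs by (rule cmp_assoc) (simp_all only: A P S)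
  moreover have "snd (span_comp C pb t s) \<cdot> w = snd t \<cdot> y"
    unfolding p(2)[symmetric] span_comp_legs by (rule cmp_assoc) (simp_all only: A P T)
  ultimately show thesis using that w p by blast
qed

lemma comp_unique:
  assumes s: "s \<in> par_spans C X Y" and t: "t \<in> par_spans C Y Z"
    and "v \<in> Hom C W (apex C (span_comp C pb t s))" "w \<in> Hom C W (apex C (span_comp C pb t s))"
    and "proj1 pb t s \<cdot> v = proj1 pb t s \<cdot> w" "proj2 pb t s \<cdot> v = proj2 pb t s \<cdot> w"
  shows "v = w"
  using pullback_unique[OF proj_pullback[OF s t], of v w] assms proj_simps[OF s t] by (auto simp: Hom_def)

lemma hcomp_arrow:
  assumes s: "s \<in> par_spans C X Y" "s' \<in> par_spans C X Y" and t: "t \<in> par_spans C Y Z" "t' \<in> par_spans C Y Z"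
    and \<phi>: "\<phi> \<in> Hom C (apex C s) (apex C s')" "fst s' \<cdot> \<phi> = fst s" "snd s' \<cdot> \<phi> = snd s"
    and \<psi>: "\<psi> \<in> Hom C (apex C t) (apex C t')" "fst t' \<cdot> \<psi> = fst t" "snd t' \<cdot> \<psi> = snd t"
  obtains \<chi> where "\<chi> \<in> Hom C (apex C (span_comp C pb t s)) (apex C (span_comp C pb t' s'))"
    "proj1 pb t' s' \<cdot> \<chi> = \<phi> \<cdot> proj1 pb t s" "proj2 pb t' s' \<cdot> \<chi> = \<psi> \<cdot> proj2 pb t s"
    "fst (span_comp C pb t' s') \<cdot> \<chi> = fst (span_comp C pb t s)"
    "snd (span_comp C pb t' s') \<cdot> \<chi> = snd (span_comp C pb t s)"
proof -
  note S = span_simps[OF s(1)] span_simps[OF s(2)] and T = span_simps[OF t(1)] span_simps[OF t(2)]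
    and P = proj_simps[OF s(1) t(1)]
  have A: "\<phi> \<in> Arr C" "Dom C \<phi> = apex C s" "Cod C \<phi> = apex C s'"
    "\<psi> \<in> Arr C" "Dom C \<psi> = apex C t" "Cod C \<psi> = apex C t'" using \<phi> \<psi> by (auto simp: Hom_def)
  have H: "\<phi> \<cdot> proj1 pb t s \<in> Hom C (apex C (span_comp C pb t s)) (apex C s')"
    "\<psi> \<cdot> proj2 pb t s \<in> Hom C (apex C (span_comp C pb t s)) (apex C t')"
    using A P by (auto simp: Hom_def)
  have L: "fst s' \<cdot> (\<phi> \<cdot> proj1 pb t s) = fst s \<cdot> proj1 pb t s" "snd s' \<cdot> (\<phi> \<cdot> proj1 pb t s) = snd s \<cdot> proj1 pb t s"
    "fst t' \<cdot> (\<psi> \<cdot> proj2 pb t s) = fst t \<cdot> proj2 pb t s" "snd t' \<cdot> (\<psi> \<cdot> proj2 pb t s) = snd t \<cdot> proj2 pb t s"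
    using A P S T \<phi> \<psi> by (simp_all flip: cmp_assoc)
  have E: "snd s' \<cdot> (\<phi> \<cdot> proj1 pb t s) = fst t' \<cdot> (\<psi> \<cdot> proj2 pb t s)"
    unfolding L by (rule P)
  from comp_pair[OF s(2) t(2) H E] that show thesis
    unfolding L span_comp_legs by metis
qed

text \<open>The three equations on projections are those that define the associator of \<open>ParSpan\<close>; the last two
  say that its arrow commutes with the legs.\<close>

lemma assoc_arrow:
  assumes s: "s \<in> par_spans C X Y" and t: "t \<in> par_spans C Y Z" and u: "u \<in> par_spans C Z V"
  defines "ts \<equiv> span_comp C pb t s" and "ut \<equiv> span_comp C pb u t"
  obtains \<chi> where "\<chi> \<in> Hom C (apex C (span_comp C pb ut s)) (apex C (span_comp C pb u ts))"
    "proj1 pb t s \<cdot> (proj1 pb u ts \<cdot> \<chi>) = proj1 pb ut s"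
    "proj2 pb t s \<cdot> (proj1 pb u ts \<cdot> \<chi>) = proj1 pb u t \<cdot> proj2 pb ut s"
    "proj2 pb u ts \<cdot> \<chi> = proj2 pb u t \<cdot> proj2 pb ut s"
    "fst (span_comp C pb u ts) \<cdot> \<chi> = fst (span_comp C pb ut s)"
    "snd (span_comp C pb u ts) \<cdot> \<chi> = snd (span_comp C pb ut s)"
proof -
  have ts: "ts \<in> par_spans C X Z" and ut: "ut \<in> par_spans C Y V"
    unfolding ts_def ut_def using s t u span_comp_hom by blast+
  note S = span_simps[OF s] and T = span_simps[OF t] and U = span_simps[OF u]
    and P = proj_simps[OF t u, folded ut_def] and Q = proj_simps[OF s ut]
  let ?x = "proj1 pb ut s" and ?y = "proj1 pb u t \<cdot> proj2 pb ut s" and ?z = "proj2 pb u t \<cdot> proj2 pb ut s"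
  let ?W = "apex C (span_comp C pb ut s)"
  have x: "?x \<in> Hom C ?W (apex C s)" and y: "?y \<in> Hom C ?W (apex C t)" and z: "?z \<in> Hom C ?W (apex C u)"
    using P Q by (auto simp: Hom_def)
  have e1: "snd s \<cdot> ?x = fst t \<cdot> ?y"
    using Q(7) S T P Q(1-6) unfolding ut_def span_comp_legs by (simp add: cmp_assoc)
  obtain w where w: "w \<in> Hom C ?W (apex C ts)" "proj1 pb t s \<cdot> w = ?x" "proj2 pb t s \<cdot> w = ?y"
    "fst ts \<cdot> w = fst s \<cdot> ?x" "snd ts \<cdot> w = snd t \<cdot> ?y"
    using comp_pair[OF s t x y e1] unfolding ts_def by metis
  have e2: "snd ts \<cdot> w = fst u \<cdot> ?z"
  proof -
    have "snd t \<cdot> ?y = (snd t \<cdot> proj1 pb u t) \<cdot> proj2 pb ut s" using P(1-6) Q(1-6) T by (simp add: cmp_assoc)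
    also have "\<dots> = fst u \<cdot> ?z" unfolding P(7) using P(1-6) Q(1-6) U by (simp add: cmp_assoc)
    finally show ?thesis using w by simp
  qed
  obtain \<chi> where c: "\<chi> \<in> Hom C ?W (apex C (span_comp C pb u ts))"
    "proj1 pb u ts \<cdot> \<chi> = w" "proj2 pb u ts \<cdot> \<chi> = ?z"
    "fst (span_comp C pb u ts) \<cdot> \<chi> = fst ts \<cdot> w" "snd (span_comp C pb u ts) \<cdot> \<chi> = snd u \<cdot> ?z"
    using comp_pair[OF ts u w(1) z e2] by metis
  have l: "snd u \<cdot> ?z = snd (span_comp C pb ut s)"
    unfolding span_comp_legs ut_def using P(1-6) Q(1-6) U unfolding ut_def by (simp add: cmp_assoc)
  show thesis
    by (rule that[OF c(1)]) (use c w l in \<open>simp_all add: span_comp_legs\<close>)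
qed

lemma assoc_arrow_inverse:
  assumes s: "s \<in> par_spans C X Y" and t: "t \<in> par_spans C Y Z" and u: "u \<in> par_spans C Z V"
  defines "ts \<equiv> span_comp C pb t s" and "ut \<equiv> span_comp C pb u t"
  obtains \<chi> where "\<chi> \<in> Hom C (apex C (span_comp C pb u ts)) (apex C (span_comp C pb ut s))"
    "fst (span_comp C pb ut s) \<cdot> \<chi> = fst (span_comp C pb u ts)"
proof -
  have ts: "ts \<in> par_spans C X Z" and ut: "ut \<in> par_spans C Y V"
    unfolding ts_def ut_def using s t u span_comp_hom by blast+
  note S = span_simps[OF s] and T = span_simps[OF t] and U = span_simps[OF u]
    and P = proj_simps[OF s t, folded ts_def] and Q = proj_simps[OF ts u]
  let ?x = "proj1 pb t s \<cdot> proj1 pb u ts" and ?y = "proj2 pb t s \<cdot> proj1 pb u ts" and ?z = "proj2 pb u ts"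
  let ?W = "apex C (span_comp C pb u ts)"
  have x: "?x \<in> Hom C ?W (apex C s)" and y: "?y \<in> Hom C ?W (apex C t)" and z: "?z \<in> Hom C ?W (apex C u)"
    using P Q by (auto simp: Hom_def)
  have e1: "snd t \<cdot> ?y = fst u \<cdot> ?z"
    using Q(7) T U P Q(1-6) unfolding ts_def span_comp_legs by (simp add: cmp_assoc)
  obtain w where w: "w \<in> Hom C ?W (apex C ut)" "fst ut \<cdot> w = fst t \<cdot> ?y"
    using comp_pair[OF t u y z e1] unfolding ut_def by metis
  have e2: "snd s \<cdot> ?x = fst ut \<cdot> w"
  proof -
    have "snd s \<cdot> ?x = (snd s \<cdot> proj1 pb t s) \<cdot> proj1 pb u ts" using P(1-6) Q(1-6) S by (simp add: cmp_assoc)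
    also have "\<dots> = fst t \<cdot> ?y" unfolding P(7) using P(1-6) Q(1-6) T by (simp add: cmp_assoc)
    finally show ?thesis using w by simp
  qed
  obtain \<chi> where c: "\<chi> \<in> Hom C ?W (apex C (span_comp C pb ut s))"
    "fst (span_comp C pb ut s) \<cdot> \<chi> = fst s \<cdot> ?x"
    using comp_pair[OF s ut x w(1) e2] by metis
  have l: "fst s \<cdot> ?x = fst (span_comp C pb u ts)"
    unfolding span_comp_legs ts_def using P(1-6) Q(1-6) S unfolding ts_def by (simp add: cmp_assoc)
  show thesis by (rule that[OF c(1)]) (use c l in simp)
qed

lemma id_span_hom: "X \<in> Obj C \<Longrightarrow> (Ide C X, Ide C X) \<in> par_spans C X X"
  by (auto simp: par_spans_def mono_ide)

text \<open>For the horizontal composite and the associator it has to be seen that the definite description in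
  \<open>ParSpan\<close> denotes: existence is \<open>hcomp_arrow\<close> and \<open>assoc_arrow\<close>, uniqueness is \<open>comp_unique\<close>.\<close>

lemma thin_ParSpan: "thin_bicategory (ParSpan C pb)"
proof (unfold_locales, goal_cases)
  \<comment> \<open>The cases follow the axioms of \<open>thin_bicategory\<close>: 7 and 8 are the vertical and the horizontal
    composite, 9 is the associator, 10 and 11 are the unitors.\<close>
  case (1 f a b)
  then show ?case using span_simps[of f a b] cod_obj by (auto simp: ParSpan_def)
next
  case (2 f a b a' b')
  then show ?case by (auto simp: ParSpan_def par_spans_def)
next
  case (3 \<alpha> f g)
  then show ?case by (auto simp: ParSpan_def span_isos_def)
next
  case (4 a)
  then show ?case by (simp add: ParSpan_def id_span_hom)
next
  case (5 f a b g c)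
  then show ?case by (simp add: ParSpan_def span_comp_hom)
next
  case (6 f a b)
  then have f: "f \<in> par_spans C a b" by (simp add: ParSpan_def)
  note F = span_simps[OF f]
  have "apex C f \<in> Obj C" using F dom_obj by metis
  then have "Ide C (apex C f) \<in> Hom C (apex C f) (apex C f)" by (rule ide_hom)
  then show ?case using span_isosI[OF f f, of "Ide C (apex C f)" "Ide C (apex C f)"] F
    by (simp add: ParSpan_def)
next
  case (7 \<alpha> f g \<beta> h)
  obtain \<phi> \<phi>' X Y where a: "\<alpha> = (f, \<phi>, g)" "f \<in> par_spans C X Y" "g \<in> par_spans C X Y"
    "\<phi> \<in> Hom C (apex C f) (apex C g)" "fst g \<cdot> \<phi> = fst f" "snd g \<cdot> \<phi> = snd f"
    "\<phi>' \<in> Hom C (apex C g) (apex C f)" "fst f \<cdot> \<phi>' = fst g"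
    using 7(1) by (auto simp: ParSpan_def elim: span_isosE)
  obtain \<psi> \<psi>' X' Y' where b: "\<beta> = (g, \<psi>, h)" "g \<in> par_spans C X' Y'" "h \<in> par_spans C X' Y'"
    "\<psi> \<in> Hom C (apex C g) (apex C h)" "fst h \<cdot> \<psi> = fst g" "snd h \<cdot> \<psi> = snd g"
    "\<psi>' \<in> Hom C (apex C h) (apex C g)" "fst g \<cdot> \<psi>' = fst h"
    using 7(2) by (auto simp: ParSpan_def elim: span_isosE)
  have h: "h \<in> par_spans C X Y" using a b by (auto simp: par_spans_def)
  note S = span_simps[OF a(2)] span_simps[OF a(3)] span_simps[OF h]
  have A: "\<phi> \<in> Arr C" "Dom C \<phi> = apex C f" "Cod C \<phi> = apex C g"
    "\<phi>' \<in> Arr C" "Dom C \<phi>' = apex C g" "Cod C \<phi>' = apex C f"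
    "\<psi> \<in> Arr C" "Dom C \<psi> = apex C g" "Cod C \<psi> = apex C h"
    "\<psi>' \<in> Arr C" "Dom C \<psi>' = apex C h" "Cod C \<psi>' = apex C g"
    using a b by (auto simp: Hom_def)
  have "(f, \<psi> \<cdot> \<phi>, h) \<in> span_isos C f h"
  proof (rule span_isosI[OF a(2) h])
    show "\<psi> \<cdot> \<phi> \<in> Hom C (apex C f) (apex C h)" "\<phi>' \<cdot> \<psi>' \<in> Hom C (apex C h) (apex C f)"
      using A by (auto simp: Hom_def)
    show "fst h \<cdot> (\<psi> \<cdot> \<phi>) = fst f" "snd h \<cdot> (\<psi> \<cdot> \<phi>) = snd f" "fst f \<cdot> (\<phi>' \<cdot> \<psi>') = fst h"
      using A S a b by (simp_all flip: cmp_assoc)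
  qed
  then show ?case by (simp add: ParSpan_def a(1) b(1))
next
  case (8 f a b g c \<alpha> f' \<beta> g')
  have f: "f \<in> par_spans C a b" and g: "g \<in> par_spans C b c" using 8 by (auto simp: ParSpan_def)
  obtain \<phi> \<phi>' X Y where a: "\<alpha> = (f, \<phi>, f')" "f \<in> par_spans C X Y" "f' \<in> par_spans C X Y"
    "\<phi> \<in> Hom C (apex C f) (apex C f')" "fst f' \<cdot> \<phi> = fst f" "snd f' \<cdot> \<phi> = snd f"
    "\<phi>' \<in> Hom C (apex C f') (apex C f)" "fst f \<cdot> \<phi>' = fst f'" "snd f \<cdot> \<phi>' = snd f'"
    using 8(3) by (auto simp: ParSpan_def elim: span_isosE)
  obtain \<psi> \<psi>' X' Y' where b: "\<beta> = (g, \<psi>, g')" "g \<in> par_spans C X' Y'" "g' \<in> par_spans C X' Y'"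
    "\<psi> \<in> Hom C (apex C g) (apex C g')" "fst g' \<cdot> \<psi> = fst g" "snd g' \<cdot> \<psi> = snd g"
    "\<psi>' \<in> Hom C (apex C g') (apex C g)" "fst g \<cdot> \<psi>' = fst g'" "snd g \<cdot> \<psi>' = snd g'"
    using 8(4) by (auto simp: ParSpan_def elim: span_isosE)
  have f': "f' \<in> par_spans C a b" and g': "g' \<in> par_spans C b c"
    using a b f g by (auto simp: par_spans_def)
  let ?H = "Hom C (apex C (span_comp C pb g f)) (apex C (span_comp C pb g' f'))"
  let ?P = "\<lambda>\<chi>. \<chi> \<in> ?H \<and> proj1 pb g' f' \<cdot> \<chi> = \<phi> \<cdot> proj1 pb g f \<and> proj2 pb g' f' \<cdot> \<chi> = \<psi> \<cdot> proj2 pb g f"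
  obtain \<chi> where c: "\<chi> \<in> ?H" "proj1 pb g' f' \<cdot> \<chi> = \<phi> \<cdot> proj1 pb g f" "proj2 pb g' f' \<cdot> \<chi> = \<psi> \<cdot> proj2 pb g f"
    "fst (span_comp C pb g' f') \<cdot> \<chi> = fst (span_comp C pb g f)"
    "snd (span_comp C pb g' f') \<cdot> \<chi> = snd (span_comp C pb g f)"
    by (rule hcomp_arrow[OF f f' g g' a(4-6) b(4-6)])
  obtain \<chi>' where d: "\<chi>' \<in> Hom C (apex C (span_comp C pb g' f')) (apex C (span_comp C pb g f))"
    "fst (span_comp C pb g f) \<cdot> \<chi>' = fst (span_comp C pb g' f')"
    by (rule hcomp_arrow[OF f' f g' g a(7-9) b(7-9)])
  have "(THE \<chi>. ?P \<chi>) = \<chi>"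
  proof (rule the_equality)
    show "?P \<chi>" using c by blast
    show "\<chi>' = \<chi>" if "?P \<chi>'" for \<chi>'
      by (rule comp_unique[OF f' g', of _ "apex C (span_comp C pb g f)"]) (use that c in simp_all)
  qed
  then show ?case
    using span_isosI[OF span_comp_hom[OF f g] span_comp_hom[OF f' g'] c(1,4,5) d]
    by (simp add: ParSpan_def a(1) b(1))
next
  case (9 f a b g c h d)
  have f: "f \<in> par_spans C a b" and g: "g \<in> par_spans C b c" and h: "h \<in> par_spans C c d"
    using 9 by (auto simp: ParSpan_def)
  define gf where "gf = span_comp C pb g f"
  define hg where "hg = span_comp C pb h g"
  note gf = span_comp_hom[OF f g, folded gf_def] and hg = span_comp_hom[OF g h, folded hg_def]
  let ?H = "Hom C (apex C (span_comp C pb hg f)) (apex C (span_comp C pb h gf))"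
  let ?P = "\<lambda>\<chi>. \<chi> \<in> ?H \<and> proj1 pb g f \<cdot> (proj1 pb h gf \<cdot> \<chi>) = proj1 pb hg f \<and>
    proj2 pb g f \<cdot> (proj1 pb h gf \<cdot> \<chi>) = proj1 pb h g \<cdot> proj2 pb hg f \<and>
    proj2 pb h gf \<cdot> \<chi> = proj2 pb h g \<cdot> proj2 pb hg f"
  obtain \<chi> where c: "\<chi> \<in> ?H"
    "proj1 pb g f \<cdot> (proj1 pb h gf \<cdot> \<chi>) = proj1 pb hg f"
    "proj2 pb g f \<cdot> (proj1 pb h gf \<cdot> \<chi>) = proj1 pb h g \<cdot> proj2 pb hg f"
    "proj2 pb h gf \<cdot> \<chi> = proj2 pb h g \<cdot> proj2 pb hg f"
    "fst (span_comp C pb h gf) \<cdot> \<chi> = fst (span_comp C pb hg f)"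
    "snd (span_comp C pb h gf) \<cdot> \<chi> = snd (span_comp C pb hg f)"
    by (rule assoc_arrow[OF f g h, folded gf_def hg_def])
  obtain \<chi>' where d: "\<chi>' \<in> Hom C (apex C (span_comp C pb h gf)) (apex C (span_comp C pb hg f))"
    "fst (span_comp C pb hg f) \<cdot> \<chi>' = fst (span_comp C pb h gf)"
    by (rule assoc_arrow_inverse[OF f g h, folded gf_def hg_def])
  have "(THE \<chi>. ?P \<chi>) = \<chi>"
  proof (rule the_equality)
    show "?P \<chi>" using c by blast
    fix \<chi>' assume x: "?P \<chi>'"
    have pr: "proj1 pb h gf \<cdot> \<chi>' \<in> Hom C (apex C (span_comp C pb hg f)) (apex C gf)"
      "proj1 pb h gf \<cdot> \<chi> \<in> Hom C (apex C (span_comp C pb hg f)) (apex C gf)"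
      using x c(1) proj_simps[OF gf h] by (auto simp: Hom_def)
    have "proj1 pb h gf \<cdot> \<chi>' = proj1 pb h gf \<cdot> \<chi>"
      by (rule comp_unique[OF f g pr[unfolded gf_def], folded gf_def]) (use x c in simp_all)
    then show "\<chi>' = \<chi>"
      using comp_unique[OF gf h, of \<chi>' "apex C (span_comp C pb hg f)" \<chi>] x c by simp
  qed
  then show ?case
    using span_isosI[OF span_comp_hom[OF f hg] span_comp_hom[OF gf h] c(1,5,6) d]
    by (simp add: ParSpan_def gf_def hg_def)
next
  case (10 f a b)
  then have f: "f \<in> par_spans C a b" by (simp add: ParSpan_def)
  note F = span_simps[OF f]
  have b: "b \<in> Obj C" "apex C f \<in> Obj C" using F cod_obj dom_obj by metis+
  let ?i = "(Ide C b, Ide C b)"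
  have ai: "apex C ?i = b" using b by (simp add: apex_def)
  note i = id_span_hom[OF b(1)] and P = proj_simps[OF f id_span_hom[OF b(1)]]
  have "Ide C (apex C f) \<in> Hom C (apex C f) (apex C f)" "snd f \<in> Hom C (apex C f) (apex C ?i)"
    using F b ai by (auto simp: Hom_def)
  from comp_pair[OF f i this] obtain w where w: "w \<in> Hom C (apex C f) (apex C (span_comp C pb ?i f))"
    "fst (span_comp C pb ?i f) \<cdot> w = fst f \<cdot> Ide C (apex C f)"
    using F b by auto
  have "snd f \<cdot> proj1 pb ?i f = snd (span_comp C pb ?i f)"
    using P(7) by (simp add: span_comp_def)
  then have "(span_comp C pb ?i f, proj1 pb ?i f, f) \<in> span_isos C (span_comp C pb ?i f) f"
    using P w F b by (intro span_isosI[OF span_comp_hom[OF f i] f, of _ w]) (auto simp: Hom_def span_comp_def)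
  then show ?case using F by (simp add: ParSpan_def Let_def)
next
  case (11 f a b)
  then have f: "f \<in> par_spans C a b" by (simp add: ParSpan_def)
  note F = span_simps[OF f]
  have b: "a \<in> Obj C" "apex C f \<in> Obj C" using F cod_obj dom_obj by metis+
  let ?i = "(Ide C a, Ide C a)"
  have ai: "apex C ?i = a" using b by (simp add: apex_def)
  note i = id_span_hom[OF b(1)] and P = proj_simps[OF id_span_hom[OF b(1)] f]
  have "fst f \<in> Hom C (apex C f) (apex C ?i)" "Ide C (apex C f) \<in> Hom C (apex C f) (apex C f)"
    using F b ai by (auto simp: Hom_def)
  from comp_pair[OF i f this] obtain w where w: "w \<in> Hom C (apex C f) (apex C (span_comp C pb f ?i))"
    "fst (span_comp C pb f ?i) \<cdot> w = Ide C a \<cdot> fst f"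
    using F b by auto
  have "fst f \<cdot> proj2 pb f ?i = fst (span_comp C pb f ?i)"
    using P(7) by (simp add: span_comp_def)
  then have "(span_comp C pb f ?i, proj2 pb f ?i, f) \<in> span_isos C (span_comp C pb f ?i) f"
    using P w F b by (intro span_isosI[OF span_comp_hom[OF i f] f, of _ w]) (auto simp: Hom_def span_comp_def)
  then show ?case using F by (simp add: ParSpan_def Let_def)
next
  case (12 \<alpha> f g)
  then show ?case using span_isos_sym by (auto simp: ParSpan_def)
next
  case (13 \<alpha> f g \<beta>)
  then show ?case using span_isos_unique by (auto simp: ParSpan_def)
qed

lemma span_isos_trans:
  assumes "\<alpha> \<in> span_isos C s t" "\<beta> \<in> span_isos C t u"
  shows "\<exists>\<gamma>. \<gamma> \<in> span_isos C s u"
proof -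
  have "Hom2 (ParSpan C pb) = span_isos C" by (simp add: ParSpan_def)
  then show ?thesis
    using thin_bicategory.vcomp_hom'[OF thin_ParSpan, of \<alpha> s t \<beta> u] assms by metis
qed

text \<open>The composite may be computed by any pullback in place of the chosen one.\<close>

lemma comp_span_iso:
  assumes s: "s \<in> par_spans C X Y" and t: "t \<in> par_spans C Y Z"
    and Q: "is_pullback C (snd s) (fst t) p q"
  shows "\<exists>\<alpha>. \<alpha> \<in> span_isos C (span_comp C pb t s) (fst s \<cdot> p, snd t \<cdot> q)"
proof -
  note S = span_simps[OF s] and T = span_simps[OF t] and P = proj_simps[OF s t] and q = pullback_simps[OF Q]
  let ?r = "(fst s \<cdot> p, snd t \<cdot> q)"
  have "mono_arr C (fst s \<cdot> p)"
    using pullback_mono[OF Q T(1)] S q by (intro mono_cmp) auto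
  then have r: "?r \<in> par_spans C X Z" using S T q by (auto simp: par_spans_def)
  have ar: "apex C ?r = Dom C p"
    unfolding apex_def fst_conv by (rule cmp_simps(2)) (simp_all only: S q)
  obtain w where w: "w \<in> Hom C (Dom C p) (apex C (span_comp C pb t s))"
    "fst (span_comp C pb t s) \<cdot> w = fst s \<cdot> p"
    by (rule comp_pair[OF s t, of p "Dom C p" q]) (use S T q in \<open>simp_all add: Hom_def\<close>)
  obtain v where v: "v \<in> Arr C" "Dom C v = apex C (span_comp C pb t s)" "Cod C v = Dom C p"
    "p \<cdot> v = proj1 pb t s" "q \<cdot> v = proj2 pb t s"
    by (rule pullback_pair[OF Q, of "proj1 pb t s" "proj2 pb t s"]) (use P S T in simp_all)
  have "(fst s \<cdot> p) \<cdot> v = fst (span_comp C pb t s)" "(snd t \<cdot> q) \<cdot> v = snd (span_comp C pb t s)"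
    using v q S T by (simp_all add: span_comp_legs cmp_assoc)
  then have "(span_comp C pb t s, v, ?r) \<in> span_isos C (span_comp C pb t s) ?r"
    using v w ar by (intro span_isosI[OF span_comp_hom[OF s t] r, of _ w]) (auto simp: Hom_def)
  then show ?thesis by blast
qed

end

section \<open>Track spans of derivations\<close>

text \<open>The two assumptions hold in every adhesive category.\<close>

locale rewriting_category = pullback_category +
  assumes mono_pushout: "is_pushout C f g p q \<Longrightarrow> mono_arr C f \<Longrightarrow> mono_arr C q"
    and pushout_pullback: "is_pushout C f g p q \<Longrightarrow> mono_arr C f \<Longrightarrow> is_pullback C p q f g"
begin

text \<open>The left leg is monic as a pushout of the left-hand side of the rule.\<close>

lemma trk_hom:
  assumes "direct_derivation C \<R> \<rho>" and lin: "\<forall>p\<in>\<R>. linear_rule C p"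
  shows "trk \<rho> \<in> par_spans C (dsource C \<rho>) (dtarget C \<rho>)"
proof -
  have L: "is_pushout C (lft (rl \<rho>)) (kk \<rho>) (mt \<rho>) (dd \<rho>)"
    and R: "is_pushout C (rgt (rl \<rho>)) (kk \<rho>) (nn \<rho>) (hh \<rho>)" and "rl \<rho> \<in> \<R>"
    using assms(1) by (auto simp: direct_derivation_def)
  then have "mono_arr C (dd \<rho>)" using lin mono_pushout by (auto simp: linear_rule_def)
  then show ?thesis
    using pushout_simps[OF L] pushout_simps[OF R]
    by (simp add: trk_def par_spans_def dsource_def dtarget_def)
qed

text \<open>Here \<open>r : K \<rightarrow> R\<close> is the right-hand side of one rule, \<open>H\<close> its pushout along \<open>k : K \<rightarrow> D\<close>, and \<open>D'\<close> its
  pushout along \<open>c : K \<rightarrow> D\<^sub>0\<close>, where \<open>k\<close> factors as \<open>e \<cdot> c\<close>.  Cancelling pushouts shows that \<open>H\<close> is also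
  the pushout of \<open>D'\<close> and \<open>D\<close> over \<open>D\<^sub>0\<close>.  This is a pushout of the monomorphism \<open>f' : D\<^sub>0 \<rightarrow> D'\<close>, and
  so a pullback.\<close>

lemma residual_pullback:
  assumes r: "mono_arr C r" and D: "is_pushout C r c g' f'" and H: "is_pushout C r k n h"
    and e: "e \<in> Arr C" "Dom C e = Cod C c" "e \<cdot> c = k"
    and d: "d \<in> Arr C" "Dom C d = Cod C f'" "d \<cdot> f' = h \<cdot> e" "d \<cdot> g' = n"
  shows "is_pullback C h d e f'"
proof -
  have "is_pushout C f' e d h"
    using pushout_cancel[OF D _ e(1) d(1) e(2) d(2,3,4)] H e(3) by simp
  then have "is_pullback C d h f' e"
    using pushout_pullback mono_pushout[OF D r] by blast
  then show ?thesis by (rule pullback_sym)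
qed

text \<open>Both composites are isomorphic to the span through the core \<open>D\<^sub>0\<close>.  Its left leg is the diagonal of the
  pullback square of the two contexts, its right leg the diagonal of the pushout square over \<open>X\<close>.\<close>

lemma diamond_iso:
  assumes \<delta>: "lcr_diamond C \<R> \<delta>" and lin: "\<forall>p\<in>\<R>. linear_rule C p"
  shows "\<exists>\<alpha>. \<alpha> \<in> span_isos C (span_comp C pb (trk (res2 \<delta>)) (trk (step1 \<delta>)))
    (span_comp C pb (trk (res1 \<delta>)) (trk (step2 \<delta>)))"
proof -
  define \<rho>1 where "\<rho>1 = step1 \<delta>"
  define \<rho>2 where "\<rho>2 = step2 \<delta>"
  define \<sigma>1 where "\<sigma>1 = res1 \<delta>"
  define \<sigma>2 where "\<sigma>2 = res2 \<delta>"
  note defs = \<rho>1_def[symmetric] \<rho>2_def[symmetric] \<sigma>1_def[symmetric] \<sigma>2_def[symmetric]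
  note D = \<delta>[unfolded lcr_diamond_def Let_def defs]
  have dd: "direct_derivation C \<R> \<rho>1" "direct_derivation C \<R> \<rho>2" "direct_derivation C \<R> \<sigma>1" "direct_derivation C \<R> \<sigma>2"
    and ends: "dsource C \<sigma>2 = dtarget C \<rho>1" "dsource C \<sigma>1 = dtarget C \<rho>2"
    using D by blast+
  obtain e1 e2 c1 c2 f1 f2 g1 g2 where
    P: "is_pullback C (dd \<rho>1) (dd \<rho>2) e1 e2"
    and c1: "c1 \<in> Hom C (Dom C (kk \<rho>1)) (Dom C e1)" "e1 \<cdot> c1 = kk \<rho>1"
    and c2: "c2 \<in> Hom C (Dom C (kk \<rho>2)) (Dom C e1)" "e2 \<cdot> c2 = kk \<rho>2"
    and Q1: "is_pushout C (rgt (rl \<rho>1)) c1 g1 f2" and Q2: "is_pushout C (rgt (rl \<rho>2)) c2 g2 f1"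
    and cod: "Cod C f2 = Dom C (dd \<sigma>2)" "Cod C f1 = Dom C (dd \<sigma>1)"
    and d2: "dd \<sigma>2 \<cdot> f2 = hh \<rho>1 \<cdot> e1" "dd \<sigma>2 \<cdot> g1 = nn \<rho>1"
    and d1: "dd \<sigma>1 \<cdot> f1 = hh \<rho>2 \<cdot> e2" "dd \<sigma>1 \<cdot> g2 = nn \<rho>2"
    and X: "is_pushout C f1 f2 (hh \<sigma>1) (hh \<sigma>2)"
    using D by blast
  note p = pullback_simps[OF P]
  have mono: "mono_arr C (rgt (rl \<rho>1))" "mono_arr C (rgt (rl \<rho>2))"
    and R: "is_pushout C (rgt (rl \<rho>1)) (kk \<rho>1) (nn \<rho>1) (hh \<rho>1)" "is_pushout C (rgt (rl \<rho>2)) (kk \<rho>2) (nn \<rho>2) (hh \<rho>2)"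
    using dd(1,2) lin by (auto simp: direct_derivation_def linear_rule_def)
  note T = trk_hom[OF dd(1) lin] trk_hom[OF dd(2) lin]
    trk_hom[OF dd(3) lin, unfolded ends] trk_hom[OF dd(4) lin, unfolded ends]
  have da: "dd \<sigma>1 \<in> Arr C" "dd \<sigma>2 \<in> Arr C"
    using span_simps(2)[OF T(3)] span_simps(2)[OF T(4)] by (simp_all add: trk_def)
  have "is_pullback C (hh \<rho>1) (dd \<sigma>2) e1 f2"
    by (rule residual_pullback[OF mono(1) Q1 R(1) p(3) _ c1(2) da(2) _ d2]) (use c1 cod in \<open>simp_all add: Hom_def\<close>)
  then have "\<exists>\<alpha>. \<alpha> \<in> span_isos C (span_comp C pb (trk \<sigma>2) (trk \<rho>1)) (dd \<rho>1 \<cdot> e1, hh \<sigma>2 \<cdot> f2)"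
    using comp_span_iso[OF T(1,4)] by (simp add: trk_def)
  moreover have "is_pullback C (hh \<rho>2) (dd \<sigma>1) e2 f1"
    by (rule residual_pullback[OF mono(2) Q2 R(2) p(4) _ c2(2) da(1) _ d1]) (use c2 cod p in \<open>simp_all add: Hom_def\<close>)
  then have "\<exists>\<alpha>. \<alpha> \<in> span_isos C (span_comp C pb (trk \<sigma>1) (trk \<rho>2)) (dd \<rho>2 \<cdot> e2, hh \<sigma>1 \<cdot> f1)"
    using comp_span_iso[OF T(2,3)] by (simp add: trk_def)
  moreover have "(dd \<rho>2 \<cdot> e2, hh \<sigma>1 \<cdot> f1) = (dd \<rho>1 \<cdot> e1, hh \<sigma>2 \<cdot> f2)"
    using p(9) pushout_simps(9)[OF X] by simp
  ultimately show ?thesis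
    unfolding defs using span_isos_trans span_isos_sym by metis
qed

theorem Trk_exists:
  assumes lin: "\<forall>p\<in>\<R>. linear_rule C p" and lcr: "\<forall>\<delta>\<in>\<Delta>. lcr_diamond C \<R> \<delta>"
  shows "\<exists>Trk. pseudofunctor (Rew C \<R> \<Delta>) (ParSpan C pb) Trk \<and> (\<forall>X. map0 Trk X = X) \<and>
    (\<forall>\<rho>. map1 Trk (Gen \<rho>) = trk \<rho>)"
proof -
  interpret P: thin_bicategory "ParSpan C pb" by (rule thin_ParSpan)
  define X where "X = \<lparr>Gen0 = Obj C, Gen1 = {\<rho>. direct_derivation C \<R> \<rho>}, src1 = dsource C, trg1 = dtarget C,
     Gen2 = \<Delta>, src2 = (\<lambda>\<delta>. Comp (Gen (res2 \<delta>)) (Gen (step1 \<delta>))),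
     trg2 = (\<lambda>\<delta>. Comp (Gen (res1 \<delta>)) (Gen (step2 \<delta>))) \<rparr>"
  have "\<exists>F. pseudofunctor (free_bicat X) (ParSpan C pb) F \<and> map0 F = (\<lambda>X. X) \<and>
      map1 F = extend1 (ParSpan C pb) (\<lambda>X. X) trk"
  proof (rule P.free_bicat_extension)
    fix \<delta> assume "\<delta> \<in> Gen2 X"
    then have "\<delta> \<in> \<Delta>" by (simp add: X_def)
    then show "Hom2 (ParSpan C pb) (extend1 (ParSpan C pb) (\<lambda>X. X) trk (src2 X \<delta>))
        (extend1 (ParSpan C pb) (\<lambda>X. X) trk (trg2 X \<delta>)) \<noteq> {}"
      using diamond_iso[of \<R> \<delta>] lin lcr by (auto simp: X_def ParSpan_def)
  qed (use trk_hom lin in \<open>auto simp: X_def ParSpan_def\<close>)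
  then show ?thesis unfolding Rew_def X_def[symmetric] by auto
qed

end

theorem theorem7p1:
  fixes U :: "'u set set"
    and S :: "'u hyp"
    and \<R> :: "'u thyp_map rule set"
    and \<Delta> :: "'u thyp_map diamond set"
    and pb :: "'u thyp_map \<Rightarrow> 'u thyp_map \<Rightarrow> 'u thyp_map \<times> 'u thyp_map"
  assumes "set_universe U"
    and "S \<in> Obj (Hyp U)"
    and "\<forall>p \<in> \<R>. linear_rule (TypedHyp U S) p"
    and "\<forall>\<delta> \<in> \<Delta>. lcr_diamond (TypedHyp U S) \<R> \<delta>"
    and "chosen_pullbacks (TypedHyp U S) pb"
  shows "(\<exists>Trk. pseudofunctor (Rew (TypedHyp U S) \<R> \<Delta>) (ParSpan (TypedHyp U S) pb) Trk \<and>
            (\<forall>X \<in> Obj (TypedHyp U S). map0 Trk X = X) \<and>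
            (\<forall>\<rho>. direct_derivation (TypedHyp U S) \<R> \<rho> \<longrightarrow> map1 Trk (Gen \<rho>) = trk \<rho>))
       \<and> (\<forall>\<delta> \<in> \<Delta>. \<exists>!\<phi>. \<phi> \<in> span_isos (TypedHyp U S)
            (span_comp (TypedHyp U S) pb (trk (res2 \<delta>)) (trk (step1 \<delta>)))
            (span_comp (TypedHyp U S) pb (trk (res1 \<delta>)) (trk (step2 \<delta>))))"
proof -
  interpret P: typed_presheaves HypIndex U S
  proof (intro typed_presheaves.intro typed_presheaves_axioms.intro)
    show "category HypIndex" unfolding HypIndex_def by (rule category_free_cat)
    show "is_functor HypIndex (SetCat U) S" using assms(2) by (simp add: Hyp_def functor_cat_def)
  qed (rule assms(1))
  have TP: "slice_cat (functor_cat HypIndex (SetCat U)) S = TypedHyp U S"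
    by (simp add: TypedHyp_def Hyp_def)
  interpret rewriting_category "TypedHyp U S" pb
  proof (intro rewriting_category.intro pullback_category.intro pullback_category_axioms.intro
      rewriting_category_axioms.intro)
    show "category (TypedHyp U S)" by (rule P.category_TP[unfolded TP])
    show "chosen_pullbacks (TypedHyp U S) pb" by (rule assms(5))
    fix f g p q assume "is_pushout (TypedHyp U S) f g p q" "mono_arr (TypedHyp U S) f"
    then show "mono_arr (TypedHyp U S) q" "is_pullback (TypedHyp U S) p q f g"
      by (rule P.pushout_of_mono[unfolded TP])+
  qed
  show ?thesis
    using Trk_exists[OF assms(3,4)] diamond_iso assms(3,4) span_isos_unique by blast
qed

end
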